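(* Let $\gamma_\nu\downarrow0$ and let $\{x^\nu\}$ be a sequence of iterates produced by the SPSA applied with the constraint functions $c_k=c_k^{\rm rst}$ and the majorization functions $\{\widehat c_k^{\,\rm rst}\}_{k\in[K]}$, or with $c_k=c_k^{\rm rlx}$ and $\{\widehat c_k^{\,\rm rlx}\}_{k\in[K]}$. Let $\kappa\subseteq\{1,2,\dots\}$ be any infinite index set such that $\lim_{\nu(\in\kappa)\to\infty}\|x^{\nu+1}-x^\nu\|=0$ with probability 1, and let $x^\infty$ be an accumulation point of $\{x^\nu\}_{\nu\in\kappa}$. Suppose $\mathbb P(\mathcal Z_\ell(x^\infty,\tilde z)=0)=0$ for all $\ell\in[L]$. Then the following two statements (i) and (ii) hold for $x^\infty$ almost surely. (i) The following three statements are equivalent: (ia) there exists $\widehat x\in X$ satisfying $$\sum_{\ell=1}^L\big[e_{k\ell}^+\,\mathbb P(L\mathcal Z_\ell^h(\widehat x,\tilde z;x^\infty)\ge0)-e_{k\ell}^-\,\mathbb P(L\mathcal Z_\ell^g(\widehat x,\tilde z;x^\infty)>0)\big]\le\zeta_k,\quad\forall k\in[K],$$ and also $\frac1{\lambda_\infty}\mathbb E[\widehat c_0(\widehat x,\tilde z;x^\infty)]\le\frac1{\lambda_\infty}\mathbb E[\widehat c_0(x^\infty,\tilde z;x^\infty)]$; (ib) $x^\infty$ is feasible to the problem $$(\mathrm Q)\qquad\operatorname*{minimize}_{x\in X}\ \mathbb E[\widehat c_0(x,\tilde z;x^\infty)]\quad\text{s.t.}\quad\sum_{\ell=1}^L\big[e_{k\ell}^+\,\mathbb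 P(L\mathcal Z_\ell^h(x,\tilde z;x^\infty)\ge0)-e_{k\ell}^-\,\mathbb P(L\mathcal Z_\ell^g(x,\tilde z;x^\infty)>0)\big]\le\zeta_k,\ \forall k\in[K];$$ (ic) $x^\infty$ is feasible to the chance-constrained problem: minimize $\mathbb E[c_0(x,\tilde z)]$ over $x\in X$ subject to $\sum_{\ell=1}^L e_{k\ell}\,\mathbb P(\mathcal Z_\ell(x,\tilde z)\ge0)\le\zeta_k$, $k\in[K]$. (ii) If in addition (to the equivalent conditions in (i)) the closure condition holds: $$\emptyset\ne\bigcap_{k=1}^K\{x\in X:\mathbb E[c_{k,\rm ub}(x,\tilde z;x^\infty)]\le\zeta_k\}\subseteq\mathrm{cl}\Big(\bigcap_{k=1}^K\{x\in X:\mathbb E[c_{k,\rm ub}(x,\tilde z;x^\infty)]<\zeta_k\}\Big),$$ then $x^\infty$ is a B-stationary point of the problem $(\mathrm Q)$.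
   Context: Notation: $[K]=\{1,\dots,K\}$; $1/\infty=0$; cl is closure; $f'(x;v)$ is the one-sided directional derivative; $\mathcal T(x;C)$ is the Bouligand tangent cone; $\mathbf 1_S$ is the indicator function of $S$. A function is B-differentiable at a point if it is locally Lipschitz continuous and directionally differentiable there. A point $\bar x\in C$ is a B-stationary point of minimizing $f$ over $C$ if $f'(\bar x;v)\ge0$ for all $v\in\mathcal T(\bar x;C)$. Random functionals. $X$ is a polytope (bounded polyhedron) contained in an open set $\mathcal O\subseteq\mathbb R^n$; $\tilde z$ is a random vector with values in $\Xi\subseteq\mathbb R^d$. For $\ell\in[L]$, $\mathcal Z_\ell(x,z)=\max_{1\le i\le I_\ell}g_{i\ell}(x,z)-\max_{1\le j\le J_\ell}h_{j\ell}(x,z)$, where $g_{i\ell},h_{j\ell}:\mathcal O\times\Xi\to\mathbb R$ are convex, differentiable and Lipschitz continuous in $x$ with constant $\mathrm{Lip}_{\rm c}(z)>0$, $\sup_{z\in\Xi}\mathrm{Lip}_{\rm c}(z)<\infty$, and measurable in $z$ with $\mathbb E|g_{i\ell}(x,\tilde z)|<\infty$, $\mathbb E|h_{j\ell}(x,\tilde z)|<\infty$ for all $x\in X$. $e_{k\ell}\in\mathbb R$, $e_{k\ell}^+=\max(e_{k\ell},0)$, $e_{k\ell}^-=\max(-e_{k\ell},0)$; $\zeta_k\in\mathbb R$. Approximations. $\widehat\theta_{\rm cvx}:\mathbb R\to\mathbb R$ is convex and $\widehat\theta_{\rm cve}:\mathbb R\to\mathbb R$ is concave, both take value $0$ at $0$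 and $1$ at $1$, and both are increasing on $[0,1]$ and nondecreasing outside. For $\gamma>0$: $\phi_{\rm ub}(t,\gamma)=\min\{\max(\widehat\theta_{\rm cvx}(1+\frac t\gamma),0),1\}$, $\phi_{\rm lb}(t,\gamma)=\max\{\min(\widehat\theta_{\rm cve}(\frac t\gamma),1),0\}$. Set $c_{k\ell}^{\rm rlx}(x,z;\gamma)=e_{k\ell}^+\phi_{\rm lb}(\mathcal Z_\ell(x,z),\gamma)-e_{k\ell}^-\phi_{\rm ub}(\mathcal Z_\ell(x,z),\gamma)$, $c_{k\ell}^{\rm rst}(x,z;\gamma)=e_{k\ell}^+\phi_{\rm ub}(\mathcal Z_\ell(x,z),\gamma)-e_{k\ell}^-\phi_{\rm lb}(\mathcal Z_\ell(x,z),\gamma)$, and $c_k^{\rm rlx/rst}=\sum_{\ell=1}^L c_{k\ell}^{\rm rlx/rst}$. Linearizations and majorizations. $Lg_{i\ell}(x,z;\bar x)=g_{i\ell}(\bar x,z)+\nabla_xg_{i\ell}(\bar x,z)^\top(x-\bar x)$, $Lh_{j\ell}(x,z;\bar x)=h_{j\ell}(\bar x,z)+\nabla_xh_{j\ell}(\bar x,z)^\top(x-\bar x)$; $L\mathcal Z_\ell^h(x,z;\bar x)=\max_ig_{i\ell}(x,z)-\max_jLh_{j\ell}(x,z;\bar x)$, $L\mathcal Z_\ell^g(x,z;\bar x)=\max_iLg_{i\ell}(x,z;\bar x)-\max_jh_{j\ell}(x,z)$; $\widehat c_k^{\,\rm rlx}(x,z;\gamma;\bar x)=\sum_\ell[e_{k\ell}^+\phi_{\rm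 lb}(L\mathcal Z_\ell^h(x,z;\bar x),\gamma)-e_{k\ell}^-\phi_{\rm ub}(L\mathcal Z_\ell^g(x,z;\bar x),\gamma)]$, $\widehat c_k^{\,\rm rst}(x,z;\gamma;\bar x)=\sum_\ell[e_{k\ell}^+\phi_{\rm ub}(L\mathcal Z_\ell^h(x,z;\bar x),\gamma)-e_{k\ell}^-\phi_{\rm lb}(L\mathcal Z_\ell^g(x,z;\bar x),\gamma)]$, $c_{k,\rm ub}(x,z;\bar x)=\sum_\ell[e_{k\ell}^+\mathbf 1_{[0,\infty)}(L\mathcal Z_\ell^h(x,z;\bar x))-e_{k\ell}^-\mathbf 1_{(0,\infty)}(L\mathcal Z_\ell^g(x,z;\bar x))]$. Standing assumptions, for $c_{k\ell}$ equal to $c_{k\ell}^{\rm rst}$ (resp. $c_{k\ell}^{\rm rlx}$), $c_k=\sum_\ell c_{k\ell}$ and $\bar c_k(x;\gamma)=\mathbb E[c_k(x,\tilde z;\gamma)]$: $c_0(\bullet,z)\ge0$ on $X$ for all $z\in\Xi$, is directionally differentiable and globally Lipschitz with constant $\mathrm{Lip}_0(z)>0$, $\mathbb E[\mathrm{Lip}_0(\tilde z)]<\infty$; there are integrable $\mathrm{Lip}_{\rm c},\widehat{\mathrm{Lip}}_{\rm c}:\Xi\to(0,\infty)$ and a probability-one set $\Xi_{\rm c}$ with $\sup_{\Xi_{\rm c}}\mathrm{Lip}_{\rm c}<\infty$ such that for $z\in\Xi_{\rm c}$, $|c_{k\ell}(x^1,z;\gamma)-c_{k\ell}(x^2,z;\gamma)|\le\frac{\mathrm{Lip}_{\rm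 c}(z)}\gamma\|x^1-x^2\|$ and $|c_{k\ell}(x,z;\gamma_1)-c_{k\ell}(x,z;\gamma_2)|\le\widehat{\mathrm{Lip}}_{\rm c}(z)[1+\|x\|]|\frac1{\gamma_1}-\frac1{\gamma_2}|$; $\bar c_k(\bullet;\gamma)$ is directionally differentiable with $\bar c_k(\bullet;\gamma)'(\bar x;v)=\sum_\ell\mathbb E[c_{k\ell}(\bullet,\tilde z;\gamma)'(\bar x;v)]$. With $\mathbf R_N(f,\Xi)=\sup_{(\xi_i)\in\Xi^N}\mathbb E_\sigma[\sup_{x\in X}|\frac1N\sum_{i=1}^N\sigma_if(x,\xi_i)|]$ ($\sigma_i$ i.i.d. uniform on $\{\pm1\}$), there are positive constants $W_0,W_1,W_2$ such that for all $N>0$ and $\beta\in(0,1/2)$, $\mathbf R_N(c_0,\Xi)\le W_0/N^\beta$ and $\max_k\mathbf R_N(c_k(\bullet,\bullet;\gamma),\Xi)\le\frac{W_1}{N^\beta}+\frac{W_2}{\gamma\sqrt N}$ for all $\gamma>0$. A surrogate $\widehat c_0(\bullet,z;\bar x)$ of $c_0(\bullet,z)$ is given for each $\bar x\in X$: it is B-differentiable on $X$, satisfies $\widehat c_0(x,z;\bar x)\ge c_0(x,z)$ on $X$, $\widehat c_0(\bar x,z;\bar x)=c_0(\bar x,z)$, is upper semicontinuous in $(x,\bar x)\in X\times X$, and $\widehat c_0(\bullet,z;\bar x)'(\bar x;d)=c_0(\bullet,z)'(\bar x;d)$ for all $d$. Parameters. $\{N_\nu\}_{\nu\ge0}$ increasing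 integers with $N_0=0$; $\{\lambda_\nu\}_{\nu\ge1}$ positive, nondecreasing, $\lambda_1=1$, limit $\lambda_\infty\in[1,\infty]$; $\{\rho_\nu\}_{\nu\ge1}$ positive with limit $\rho_\infty\in[0,\infty)$ and $\frac{\alpha_1}\nu\le\frac{\rho_\nu}{\lambda_\nu}\le\frac{\alpha_2}\nu$ for some $\alpha_2>\alpha_1>0$; $\{\gamma_\nu\}_{\nu\ge1}$ positive, nonincreasing, with $\sum_{\nu\ge2}\sup_{x\in X}|\bar c_k(x;\gamma_\nu)-\bar c_k(x;\gamma_{\nu-1})|<\infty$ for $k\in[K]$. Moreover there exist $\beta\in(0,1/2)$, a positive integer $\bar\nu$ and positive $\delta,c_1,c_2,c_3,c_4$ with $c_3<\bar\nu$, $\beta(1+c_1)>1+\delta$ such that $c_2\nu^{1+c_1}\le N_\nu\le N_{\nu-1}/(1-\frac{c_3}\nu)$ and $\gamma_\nu\ge c_4/\nu^\delta$ for all $\nu\ge\bar\nu$. SPSA algorithm (with $\widehat c_k=\widehat c_k^{\,\rm rst}$ or $\widehat c_k^{\,\rm rlx}$). Let $z^1,z^2,\dots$ be i.i.d. samples of $\tilde z$. Start with arbitrary $x^1\in X$; for $\nu=1,2,\dots$ let $x^{\nu+1}$ be a global minimizer over $x\in X$ of $\frac1{N_\nu}\sum_{s=1}^{N_\nu}\widehat c_0(x,z^s;x^\nu)+\lambda_\nu\sum_{k=1}^K\max\big(\frac1{N_\nu}\sum_{s=1}^{N_\nu}\widehat c_k(x,z^s;\gamma_\nu;x^\nu)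-\zeta_k,0\big)+\frac{\rho_\nu}2\|x-x^\nu\|^2$.
   Formalization: The surrogate ĉ_0 is additionally assumed jointly measurable in (x,z,x̄) and Lipschitz in x on X with an integrable modulus Lip(z) independent of the base point x̄; without control of this kind part (ii) can fail. *)

theory Defs
  imports "HOL-Probability.Probability" "HOL-Probability.Product_PMF"
begin

section \<open>Variational notions\<close>

definition has_dir_deriv ::
    "('a::real_normed_vector \<Rightarrow> real) \<Rightarrow> 'a \<Rightarrow> 'a \<Rightarrow> real \<Rightarrow> bool" where
  "has_dir_deriv f x v D \<longleftrightarrow> ((\<lambda>t. (f (x + t *\<^sub>R v) - f x) / t) \<longlongrightarrow> D) (at_right 0)"

text \<open>Only meaningful when the one-sided derivative exists, see \<open>has_dir_deriv\<close>.\<close>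
definition dir_deriv :: "('a::real_normed_vector \<Rightarrow> real) \<Rightarrow> 'a \<Rightarrow> 'a \<Rightarrow> real" where
  "dir_deriv f x v = Lim (at_right 0) (\<lambda>t. (f (x + t *\<^sub>R v) - f x) / t)"

definition dir_differentiable :: "('a::real_normed_vector \<Rightarrow> real) \<Rightarrow> 'a \<Rightarrow> bool" where
  "dir_differentiable f x \<longleftrightarrow> (\<forall>v. \<exists>D. has_dir_deriv f x v D)"

definition B_differentiable :: "('a::real_normed_vector \<Rightarrow> real) \<Rightarrow> 'a \<Rightarrow> bool" where
  "B_differentiable f x \<longleftrightarrow>
     (\<exists>r>0. \<exists>C. C-lipschitz_on (ball x r) f) \<and> dir_differentiable f x"

definition usc_on :: "'a::topological_space set \<Rightarrow> ('a \<Rightarrow> real) \<Rightarrow> bool" where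
  "usc_on S f \<longleftrightarrow> (\<forall>p\<in>S. \<forall>c>f p. \<forall>\<^sub>F q in at p within S. f q < c)"

definition tangent_cone :: "'a::real_normed_vector \<Rightarrow> 'a set \<Rightarrow> 'a set" where
  "tangent_cone x C =
     {v. \<exists>y \<tau>. (\<forall>i::nat. y i \<in> C \<and> \<tau> i > 0) \<and> y \<longlonglongrightarrow> x \<and> \<tau> \<longlonglongrightarrow> 0 \<and>
               (\<lambda>i. (y i - x) /\<^sub>R \<tau> i) \<longlonglongrightarrow> v}"

text \<open>The existence of \<open>f'(x; v)\<close> along tangent directions is part of the definition.\<close>
definition B_stationary ::
    "('a::real_normed_vector \<Rightarrow> real) \<Rightarrow> 'a set \<Rightarrow> 'a \<Rightarrow> bool" where
  "B_stationary f C x \<longleftrightarrow>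
     x \<in> C \<and> (\<forall>v \<in> tangent_cone x C. \<exists>D. has_dir_deriv f x v D \<and> D \<ge> 0)"

definition gradient :: "('a::real_inner \<Rightarrow> real) \<Rightarrow> 'a \<Rightarrow> 'a" where
  "gradient f x = (THE D. GDERIV f x :> D)"

text \<open>Accumulation point of the subfamily \<open>(x \<nu>)\<close> with \<open>\<nu>\<close> in \<open>\<kappa>\<close>.\<close>
definition acc_point_along :: "(nat \<Rightarrow> 'a::topological_space) \<Rightarrow> nat set \<Rightarrow> 'a \<Rightarrow> bool" where
  "acc_point_along x \<kappa> p \<longleftrightarrow>
     (\<exists>r. strict_mono r \<and> range r \<subseteq> \<kappa> \<and> (\<lambda>i. x (r i)) \<longlonglongrightarrow> p)"


section \<open>Problem data\<close>

text \<open>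
  Indices \<open>k\<close>, \<open>\<ell>\<close>, \<open>i\<close>, \<open>j\<close> run over \<open>{1..nK}\<close>, \<open>{1..nL}\<close>, \<open>{1..nI \<ell>}\<close>, \<open>{1..nJ \<ell>}\<close>.
  Functions of \<open>x\<close> are total in HOL; only their values for \<open>x\<close> in \<open>Odom\<close> and \<open>z\<close> in \<open>Xi\<close> matter.
\<close>
record ('n::finite, 'd::finite) cc_problem =
  Odom :: "(real^'n) set"
  Xset :: "(real^'n) set"
  Xi :: "(real^'d) set"
  nK :: nat
  nL :: nat
  nI :: "nat \<Rightarrow> nat"
  nJ :: "nat \<Rightarrow> nat"
  gfun :: "nat \<Rightarrow> nat \<Rightarrow> real^'n \<Rightarrow> real^'d \<Rightarrow> real"
  hfun :: "nat \<Rightarrow> nat \<Rightarrow> real^'n \<Rightarrow> real^'d \<Rightarrow> real"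
  ecoef :: "nat \<Rightarrow> nat \<Rightarrow> real"
  zeta :: "nat \<Rightarrow> real"
  th_cvx :: "real \<Rightarrow> real"
  th_cve :: "real \<Rightarrow> real"
  c0 :: "real^'n \<Rightarrow> real^'d \<Rightarrow> real"
  c0_hat :: "real^'n \<Rightarrow> real^'d \<Rightarrow> real^'n \<Rightarrow> real"

definition epos :: "('n::finite, 'd::finite) cc_problem \<Rightarrow> nat \<Rightarrow> nat \<Rightarrow> real" where
  "epos P k l = max (ecoef P k l) 0"

definition eneg :: "('n::finite, 'd::finite) cc_problem \<Rightarrow> nat \<Rightarrow> nat \<Rightarrow> real" where
  "eneg P k l = max (- ecoef P k l) 0"

text \<open>The sample space \<open>Xi\<close> with its trace Borel sigma-algebra.\<close>
definition Xi_space :: "('n::finite, 'd::finite) cc_problem \<Rightarrow> (real^'d) measure" where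
  "Xi_space P = restrict_space borel (Xi P)"

definition Zdiff ::
    "('n::finite, 'd::finite) cc_problem \<Rightarrow> nat \<Rightarrow> real^'n \<Rightarrow> real^'d \<Rightarrow> real" where
  "Zdiff P l x z =
     Max ((\<lambda>i. gfun P i l x z) ` {1..nI P l}) - Max ((\<lambda>j. hfun P j l x z) ` {1..nJ P l})"

definition linearization ::
    "('a::real_inner \<Rightarrow> 'b \<Rightarrow> real) \<Rightarrow> 'a \<Rightarrow> 'b \<Rightarrow> 'a \<Rightarrow> real" where
  "linearization f x z y = f y z + gradient (\<lambda>u. f u z) y \<bullet> (x - y)"

definition LZh ::
    "('n::finite, 'd::finite) cc_problem \<Rightarrow> nat \<Rightarrow> real^'n \<Rightarrow> real^'d \<Rightarrow> real^'n \<Rightarrow> real" where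
  "LZh P l x z y =
     Max ((\<lambda>i. gfun P i l x z) ` {1..nI P l})
     - Max ((\<lambda>j. linearization (hfun P j l) x z y) ` {1..nJ P l})"

definition LZg ::
    "('n::finite, 'd::finite) cc_problem \<Rightarrow> nat \<Rightarrow> real^'n \<Rightarrow> real^'d \<Rightarrow> real^'n \<Rightarrow> real" where
  "LZg P l x z y =
     Max ((\<lambda>i. linearization (gfun P i l) x z y) ` {1..nI P l})
     - Max ((\<lambda>j. hfun P j l x z) ` {1..nJ P l})"

definition phi_ub :: "('n::finite, 'd::finite) cc_problem \<Rightarrow> real \<Rightarrow> real \<Rightarrow> real" where
  "phi_ub P t \<gamma> = min (max (th_cvx P (1 + t / \<gamma>)) 0) 1"

definition phi_lb :: "('n::finite, 'd::finite) cc_problem \<Rightarrow> real \<Rightarrow> real \<Rightarrow> real" where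
  "phi_lb P t \<gamma> = max (min (th_cve P (t / \<gamma>)) 1) 0"

text \<open>Relaxed or restricted approximation of the chance constraints.\<close>
datatype approx = Rlx | Rst

fun phi_pos ::
    "approx \<Rightarrow> ('n::finite, 'd::finite) cc_problem \<Rightarrow> real \<Rightarrow> real \<Rightarrow> real" where
  "phi_pos Rlx P = phi_lb P"
| "phi_pos Rst P = phi_ub P"

fun phi_neg ::
    "approx \<Rightarrow> ('n::finite, 'd::finite) cc_problem \<Rightarrow> real \<Rightarrow> real \<Rightarrow> real" where
  "phi_neg Rlx P = phi_ub P"
| "phi_neg Rst P = phi_lb P"

definition c_kl ::
    "approx \<Rightarrow> ('n::finite, 'd::finite) cc_problem \<Rightarrow> nat \<Rightarrow> nat \<Rightarrow>
      real^'n \<Rightarrow> real^'d \<Rightarrow> real \<Rightarrow> real" where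
  "c_kl a P k l x z \<gamma> =
     epos P k l * phi_pos a P (Zdiff P l x z) \<gamma> - eneg P k l * phi_neg a P (Zdiff P l x z) \<gamma>"

definition c_k ::
    "approx \<Rightarrow> ('n::finite, 'd::finite) cc_problem \<Rightarrow> nat \<Rightarrow>
      real^'n \<Rightarrow> real^'d \<Rightarrow> real \<Rightarrow> real" where
  "c_k a P k x z \<gamma> = (\<Sum>l=1..nL P. c_kl a P k l x z \<gamma>)"

definition c_hat ::
    "approx \<Rightarrow> ('n::finite, 'd::finite) cc_problem \<Rightarrow> nat \<Rightarrow>
      real^'n \<Rightarrow> real^'d \<Rightarrow> real \<Rightarrow> real^'n \<Rightarrow> real" where
  "c_hat a P k x z \<gamma> y =
     (\<Sum>l=1..nL P. epos P k l * phi_pos a P (LZh P l x z y) \<gamma>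
                  - eneg P k l * phi_neg a P (LZg P l x z y) \<gamma>)"

definition c_ub ::
    "('n::finite, 'd::finite) cc_problem \<Rightarrow> nat \<Rightarrow> real^'n \<Rightarrow> real^'d \<Rightarrow> real^'n \<Rightarrow> real" where
  "c_ub P k x z y =
     (\<Sum>l=1..nL P. epos P k l * indicator {0..} (LZh P l x z y)
                  - eneg P k l * indicator {0<..} (LZg P l x z y))"

definition c_bar ::
    "approx \<Rightarrow> ('n::finite, 'd::finite) cc_problem \<Rightarrow> 'w measure \<Rightarrow> ('w \<Rightarrow> real^'d) \<Rightarrow>
      nat \<Rightarrow> real^'n \<Rightarrow> real \<Rightarrow> real" where
  "c_bar a P M zt k x \<gamma> = (\<integral>\<omega>. c_k a P k x (zt \<omega>) \<gamma> \<partial>M)"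


section \<open>Standing assumptions\<close>

definition component_fun ::
    "('n::finite, 'd::finite) cc_problem \<Rightarrow> 'w measure \<Rightarrow> ('w \<Rightarrow> real^'d) \<Rightarrow>
      (real^'d \<Rightarrow> real) \<Rightarrow> (real^'n \<Rightarrow> real^'d \<Rightarrow> real) \<Rightarrow> bool" where
  "component_fun P M zt Lip f \<longleftrightarrow>
     (\<forall>z\<in>Xi P. convex_on (Odom P) (\<lambda>x. f x z)
        \<and> (\<forall>x\<in>Odom P. (\<lambda>u. f u z) differentiable (at x))
        \<and> (Lip z)-lipschitz_on (Odom P) (\<lambda>x. f x z)) \<and>
     (\<forall>x\<in>Odom P. f x \<in> borel_measurable (Xi_space P)) \<and>
     (\<forall>x\<in>Xset P. integrable M (\<lambda>\<omega>. f x (zt \<omega>)))"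

definition random_functionals ::
    "('n::finite, 'd::finite) cc_problem \<Rightarrow> 'w measure \<Rightarrow> ('w \<Rightarrow> real^'d) \<Rightarrow> bool" where
  "random_functionals P M zt \<longleftrightarrow>
     polytope (Xset P) \<and> open (Odom P) \<and> Xset P \<subseteq> Odom P \<and>
     zt \<in> M \<rightarrow>\<^sub>M Xi_space P \<and>
     (\<forall>l\<in>{1..nL P}. nI P l \<ge> 1 \<and> nJ P l \<ge> 1) \<and>
     (\<exists>Lip. (\<forall>z\<in>Xi P. Lip z > 0) \<and> bdd_above (Lip ` Xi P) \<and>
        (\<forall>l\<in>{1..nL P}. (\<forall>i\<in>{1..nI P l}. component_fun P M zt Lip (gfun P i l)) \<and>
                        (\<forall>j\<in>{1..nJ P l}. component_fun P M zt Lip (hfun P j l))))"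

definition theta_shape :: "(real \<Rightarrow> real) \<Rightarrow> bool" where
  "theta_shape \<theta> \<longleftrightarrow> \<theta> 0 = 0 \<and> \<theta> 1 = 1 \<and>
     strict_mono_on {0..1} \<theta> \<and> mono_on {..0} \<theta> \<and> mono_on {1..} \<theta>"

definition approximation_funs :: "('n::finite, 'd::finite) cc_problem \<Rightarrow> bool" where
  "approximation_funs P \<longleftrightarrow>
     convex_on UNIV (th_cvx P) \<and> concave_on UNIV (th_cve P) \<and>
     theta_shape (th_cvx P) \<and> theta_shape (th_cve P)"

text \<open>
  The suprema are taken in the extended nonnegative reals, so that a bound on the Rademacher
  average carries its finiteness.
\<close>
definition rademacher ::
    "'a set \<Rightarrow> 'b set \<Rightarrow> nat \<Rightarrow> ('a \<Rightarrow> 'b \<Rightarrow> real) \<Rightarrow> ennreal" where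
  "rademacher X S N f =
     (SUP \<xi>\<in>{1..N} \<rightarrow>\<^sub>E S.
        \<integral>\<^sup>+\<sigma>. (SUP x\<in>X. ennreal \<bar>(\<Sum>i=1..N. \<sigma> i * f x (\<xi> i)) / real N\<bar>)
          \<partial>(Pi_pmf {1..N} 0 (\<lambda>_. pmf_of_set {-1, 1 :: real})))"

definition objective_assms ::
    "('n::finite, 'd::finite) cc_problem \<Rightarrow> 'w measure \<Rightarrow> ('w \<Rightarrow> real^'d) \<Rightarrow> bool" where
  "objective_assms P M zt \<longleftrightarrow>
     (\<forall>x\<in>Xset P. c0 P x \<in> borel_measurable (Xi_space P)) \<and>
     (\<forall>z\<in>Xi P. \<forall>x\<in>Xset P. c0 P x z \<ge> 0 \<and> dir_differentiable (\<lambda>u. c0 P u z) x) \<and>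
     (\<exists>Lip0. Lip0 \<in> borel_measurable (Xi_space P) \<and> integrable M (\<lambda>\<omega>. Lip0 (zt \<omega>)) \<and>
        (\<forall>z\<in>Xi P. Lip0 z > 0 \<and> (Lip0 z)-lipschitz_on (Xset P) (\<lambda>x. c0 P x z)))"

definition constraint_assms ::
    "approx \<Rightarrow> ('n::finite, 'd::finite) cc_problem \<Rightarrow> 'w measure \<Rightarrow> ('w \<Rightarrow> real^'d) \<Rightarrow> bool" where
  "constraint_assms a P M zt \<longleftrightarrow>
     (\<exists>Lip Lip' Xic.
        Lip \<in> borel_measurable (Xi_space P) \<and> integrable M (\<lambda>\<omega>. Lip (zt \<omega>)) \<and>
        Lip' \<in> borel_measurable (Xi_space P) \<and> integrable M (\<lambda>\<omega>. Lip' (zt \<omega>)) \<and>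
        (\<forall>z\<in>Xi P. Lip z > 0 \<and> Lip' z > 0) \<and>
        Xic \<in> sets (Xi_space P) \<and> \<P>(\<omega> in M. zt \<omega> \<in> Xic) = 1 \<and> bdd_above (Lip ` Xic) \<and>
        (\<forall>z\<in>Xic. \<forall>k\<in>{1..nK P}. \<forall>l\<in>{1..nL P}.
           (\<forall>\<gamma>>0. \<forall>x1\<in>Xset P. \<forall>x2\<in>Xset P.
              \<bar>c_kl a P k l x1 z \<gamma> - c_kl a P k l x2 z \<gamma>\<bar> \<le> Lip z / \<gamma> * norm (x1 - x2)) \<and>
           (\<forall>\<gamma>1>0. \<forall>\<gamma>2>0. \<forall>x\<in>Xset P.
              \<bar>c_kl a P k l x z \<gamma>1 - c_kl a P k l x z \<gamma>2\<bar>
                \<le> Lip' z * (1 + norm x) * \<bar>1 / \<gamma>1 - 1 / \<gamma>2\<bar>))) \<and>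
     (\<forall>k\<in>{1..nK P}. \<forall>\<gamma>>0. \<forall>x\<in>Xset P. \<forall>v.
        has_dir_deriv (\<lambda>u. c_bar a P M zt k u \<gamma>) x v
          (\<Sum>l=1..nL P. \<integral>\<omega>. dir_deriv (\<lambda>u. c_kl a P k l u (zt \<omega>) \<gamma>) x v \<partial>M))"

definition rademacher_assms ::
    "approx \<Rightarrow> ('n::finite, 'd::finite) cc_problem \<Rightarrow> bool" where
  "rademacher_assms a P \<longleftrightarrow>
     (\<exists>W0>0. \<exists>W1>0. \<exists>W2>0. \<forall>N>0. \<forall>\<beta>::real. 0 < \<beta> \<and> \<beta> < 1 / 2 \<longrightarrow>
        rademacher (Xset P) (Xi P) N (c0 P) \<le> ennreal (W0 / real N powr \<beta>) \<and>
        (\<forall>k\<in>{1..nK P}. \<forall>\<gamma>>0.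
           rademacher (Xset P) (Xi P) N (\<lambda>x z. c_k a P k x z \<gamma>)
             \<le> ennreal (W1 / real N powr \<beta> + W2 / (\<gamma> * sqrt (real N)))))"

text \<open>
  The last two conjuncts make the expectations of the surrogate meaningful and stable in the
  base point: joint measurability, and a Lipschitz modulus in \<open>x\<close> that is integrable and uniform
  in the base point (the analogue of the modulus of \<open>c0\<close>). Pointwise B-differentiability and
  upper semicontinuity alone do not control expectations.
\<close>
definition surrogate_assms ::
    "('n::finite, 'd::finite) cc_problem \<Rightarrow> 'w measure \<Rightarrow> ('w \<Rightarrow> real^'d) \<Rightarrow> bool" where
  "surrogate_assms P M zt \<longleftrightarrow>
     (\<forall>z\<in>Xi P.
        (\<forall>y\<in>Xset P.
           (\<forall>x\<in>Xset P. B_differentiable (\<lambda>u. c0_hat P u z y) x \<and> c0_hat P x z y \<ge> c0 P x z) \<and>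
           c0_hat P y z y = c0 P y z \<and>
           (\<forall>d. dir_deriv (\<lambda>u. c0_hat P u z y) y d = dir_deriv (\<lambda>u. c0 P u z) y d)) \<and>
        usc_on (Xset P \<times> Xset P) (\<lambda>(x, y). c0_hat P x z y)) \<and>
     (\<lambda>(x, z, y). c0_hat P x z y)
       \<in> borel_measurable
           (restrict_space borel (Xset P) \<Otimes>\<^sub>M Xi_space P \<Otimes>\<^sub>M restrict_space borel (Xset P)) \<and>
     (\<exists>Lip. Lip \<in> borel_measurable (Xi_space P) \<and> integrable M (\<lambda>\<omega>. Lip (zt \<omega>)) \<and>
        (\<forall>z\<in>Xi P. \<forall>y\<in>Xset P. (Lip z)-lipschitz_on (Xset P) (\<lambda>x. c0_hat P x z y)))"


section \<open>The SPSA algorithm\<close>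

definition iid_samples ::
    "('n::finite, 'd::finite) cc_problem \<Rightarrow> 'w measure \<Rightarrow> ('w \<Rightarrow> real^'d) \<Rightarrow>
      (nat \<Rightarrow> 'w \<Rightarrow> real^'d) \<Rightarrow> bool" where
  "iid_samples P M zt zs \<longleftrightarrow>
     prob_space.indep_vars M (\<lambda>_. Xi_space P) zs {1..} \<and>
     (\<forall>s\<ge>1. distr M (Xi_space P) (zs s) = distr M (Xi_space P) zt)"

definition spsa_params ::
    "approx \<Rightarrow> ('n::finite, 'd::finite) cc_problem \<Rightarrow> 'w measure \<Rightarrow> ('w \<Rightarrow> real^'d) \<Rightarrow>
      (nat \<Rightarrow> nat) \<Rightarrow> (nat \<Rightarrow> real) \<Rightarrow> ereal \<Rightarrow> (nat \<Rightarrow> real) \<Rightarrow> (nat \<Rightarrow> real) \<Rightarrow> bool" where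
  "spsa_params a P M zt N lam lam_inf \<rho> \<gamma> \<longleftrightarrow>
     strict_mono N \<and> N 0 = 0 \<and>
     (\<forall>\<nu>\<ge>1. lam \<nu> > 0) \<and> mono_on {1..} lam \<and> lam 1 = 1 \<and> (\<lambda>\<nu>. ereal (lam \<nu>)) \<longlonglongrightarrow> lam_inf \<and>
     (\<forall>\<nu>\<ge>1. \<rho> \<nu> > 0) \<and> (\<exists>\<rho>_inf\<ge>0. \<rho> \<longlonglongrightarrow> \<rho>_inf) \<and>
     (\<exists>\<alpha>1>0. \<exists>\<alpha>2>\<alpha>1. \<forall>\<nu>\<ge>1. \<alpha>1 / real \<nu> \<le> \<rho> \<nu> / lam \<nu> \<and> \<rho> \<nu> / lam \<nu> \<le> \<alpha>2 / real \<nu>) \<and>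
     (\<forall>\<nu>\<ge>1. \<gamma> \<nu> > 0) \<and> antimono_on {1..} \<gamma> \<and>
     (\<forall>k\<in>{1..nK P}. summable (\<lambda>\<nu>.
        SUP x\<in>Xset P. \<bar>c_bar a P M zt k x (\<gamma> (\<nu> + 2)) - c_bar a P M zt k x (\<gamma> (\<nu> + 1))\<bar>)) \<and>
     (\<exists>\<beta> \<nu>_bar \<delta> c1 c2 c3 c4.
        0 < \<beta> \<and> \<beta> < 1 / 2 \<and> (0::nat) < \<nu>_bar \<and>
        \<delta> > 0 \<and> c1 > 0 \<and> c2 > 0 \<and> c3 > 0 \<and> c4 > 0 \<and>
        c3 < real \<nu>_bar \<and> \<beta> * (1 + c1) > 1 + \<delta> \<and>
        (\<forall>\<nu>\<ge>\<nu>_bar. c2 * real \<nu> powr (1 + c1) \<le> real (N \<nu>) \<and>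
                   real (N \<nu>) \<le> real (N (\<nu> - 1)) / (1 - c3 / real \<nu>) \<and>
                   \<gamma> \<nu> \<ge> c4 / real \<nu> powr \<delta>))"

definition spsa_objective ::
    "approx \<Rightarrow> ('n::finite, 'd::finite) cc_problem \<Rightarrow> (nat \<Rightarrow> real^'d) \<Rightarrow>
      nat \<Rightarrow> real \<Rightarrow> real \<Rightarrow> real \<Rightarrow> real^'n \<Rightarrow> real^'n \<Rightarrow> real" where
  "spsa_objective a P z N lam \<rho> \<gamma> y x =
     (\<Sum>s=1..N. c0_hat P x (z s) y) / real N
     + lam * (\<Sum>k=1..nK P. max ((\<Sum>s=1..N. c_hat a P k x (z s) \<gamma> y) / real N - zeta P k) 0)
     + \<rho> / 2 * (norm (x - y))\<^sup>2"

definition spsa_iterates ::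
    "approx \<Rightarrow> ('n::finite, 'd::finite) cc_problem \<Rightarrow> 'w measure \<Rightarrow>
      (nat \<Rightarrow> 'w \<Rightarrow> real^'d) \<Rightarrow> (nat \<Rightarrow> nat) \<Rightarrow> (nat \<Rightarrow> real) \<Rightarrow> (nat \<Rightarrow> real) \<Rightarrow> (nat \<Rightarrow> real) \<Rightarrow>
      (nat \<Rightarrow> 'w \<Rightarrow> real^'n) \<Rightarrow> bool" where
  "spsa_iterates a P M zs N lam \<rho> \<gamma> x \<longleftrightarrow>
     (\<exists>x1\<in>Xset P. \<forall>\<omega>\<in>space M. x 1 \<omega> = x1) \<and>
     (\<forall>\<omega>\<in>space M. \<forall>\<nu>\<ge>1.
        is_arg_min
          (spsa_objective a P (\<lambda>s. zs s \<omega>) (N \<nu>) (lam \<nu>) (\<rho> \<nu>) (\<gamma> \<nu>) (x \<nu> \<omega>))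
          (\<lambda>y. y \<in> Xset P) (x (\<nu> + 1) \<omega>))"


section \<open>Limiting problems\<close>

definition Q_objective ::
    "('n::finite, 'd::finite) cc_problem \<Rightarrow> 'w measure \<Rightarrow> ('w \<Rightarrow> real^'d) \<Rightarrow>
      real^'n \<Rightarrow> real^'n \<Rightarrow> real" where
  "Q_objective P M zt y x = (\<integral>\<omega>. c0_hat P x (zt \<omega>) y \<partial>M)"

definition Q_feasible ::
    "('n::finite, 'd::finite) cc_problem \<Rightarrow> 'w measure \<Rightarrow> ('w \<Rightarrow> real^'d) \<Rightarrow>
      real^'n \<Rightarrow> (real^'n) set" where
  "Q_feasible P M zt y =
     {x \<in> Xset P. \<forall>k\<in>{1..nK P}.
        (\<Sum>l=1..nL P. epos P k l * \<P>(\<omega> in M. LZh P l x (zt \<omega>) y \<ge> 0)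
                     - eneg P k l * \<P>(\<omega> in M. LZg P l x (zt \<omega>) y > 0)) \<le> zeta P k}"

definition CCP_feasible ::
    "('n::finite, 'd::finite) cc_problem \<Rightarrow> 'w measure \<Rightarrow> ('w \<Rightarrow> real^'d) \<Rightarrow> (real^'n) set" where
  "CCP_feasible P M zt =
     {x \<in> Xset P. \<forall>k\<in>{1..nK P}.
        (\<Sum>l=1..nL P. ecoef P k l * \<P>(\<omega> in M. Zdiff P l x (zt \<omega>) \<ge> 0)) \<le> zeta P k}"

definition closure_condition ::
    "('n::finite, 'd::finite) cc_problem \<Rightarrow> 'w measure \<Rightarrow> ('w \<Rightarrow> real^'d) \<Rightarrow> real^'n \<Rightarrow> bool" where
  "closure_condition P M zt y \<longleftrightarrow>
     {x \<in> Xset P. \<forall>k\<in>{1..nK P}. (\<integral>\<omega>. c_ub P k x (zt \<omega>) y \<partial>M) \<le> zeta P k} \<noteq> {} \<and>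
     {x \<in> Xset P. \<forall>k\<in>{1..nK P}. (\<integral>\<omega>. c_ub P k x (zt \<omega>) y \<partial>M) \<le> zeta P k}
       \<subseteq> closure {x \<in> Xset P. \<forall>k\<in>{1..nK P}. (\<integral>\<omega>. c_ub P k x (zt \<omega>) y \<partial>M) < zeta P k}"

end

theory Submission
  imports Defs
begin

text \<open>
  The argument is pathwise. Outside a null set, one-sided uniform laws of large numbers give
  \<open>limsup\<close> bounds for the sample averages of \<open>c0_hat\<close> and \<open>c_hat\<close> and \<open>liminf\<close> bounds for those of
  \<open>c0\<close> and \<open>c_hat\<close> along arbitrary convergent, possibly sample-dependent, arguments. Comparing
  the iterate \<open>x (\<nu> + 1)\<close> with a fixed point \<open>u\<close> in the subproblem and dividing by \<open>\<lambda>\<^sub>\<nu>\<close> yields the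
  feasibility of the limit in (i); for strictly feasible \<open>u\<close> the penalty of \<open>u\<close> vanishes, so \<open>x_inf\<close>
  minimizes the limiting surrogate objective plus \<open>\<rho>\<^sub>\<infinity> / 2 * (norm (u - x_inf))\<^sup>2\<close> over the closure of the
  strictly feasible points, which gives (ii).

  The surrogate is only upper semicontinuous in its base point. Its suprema over small balls, to
  which the strong law is applied, are measurable after completion by the measurable projection
  theorem, obtained from Choquet's capacitability argument.
\<close>

text \<open>The limit point \<open>x_inf\<close> depends on the sample, so the exceptional null set
  has to be fixed before the limit point is known. Hence the uniform laws cover all convergent
  argument sequences at once and are reduced to countably many strong laws. They are one-sided
  because a local supremum bounds a function only from above; lower bounds come from negated
  functions. This works for \<open>c0\<close> and for continuous minorants of \<open>c_hat\<close>,
  but not for \<open>c0_hat\<close>, which is merely upper semicontinuous. The lower bound for the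
  objective therefore goes through \<open>c0\<close>, which minorizes the surrogate and agrees with
  it when argument and base point coincide; both iterates in the subproblem tend to
  \<open>x_inf\<close>, so nothing is lost in the limit. The other obstacle is that
  \<open>phi_ub\<close> and \<open>phi_lb\<close> tend to discontinuous indicators as \<gamma>
  shrinks: upper and lower limits of the constraints carry different indicators, which the null
  boundary events reconcile at \<open>x_inf\<close>. An integrable bound on the surrogate, uniform
  in the base point, comes from the Rademacher assumption for one sample and the uniform Lipschitz
  modulus.\<close>

section \<open>Measurable projection\<close>

text \<open>
  Here \<open>R n \<sigma>\<close> may depend on \<open>\<sigma> 0, \<dots>, \<sigma> n\<close> only, which replaces the usual indexing of Souslin schemes by
  finite sequences.
\<close>
definition souslin :: "'a set set \<Rightarrow> 'a set \<Rightarrow> bool" where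
  "souslin \<R> D \<longleftrightarrow> (\<exists>R :: nat \<Rightarrow> (nat \<Rightarrow> nat) \<Rightarrow> 'a set.
     (\<forall>n \<sigma>. R n \<sigma> \<in> \<R>) \<and> (\<forall>n \<sigma> \<tau>. (\<forall>i\<le>n. \<sigma> i = \<tau> i) \<longrightarrow> R n \<sigma> = R n \<tau>) \<and>
     D = {p. \<exists>\<sigma>. \<forall>n. p \<in> R n \<sigma>})"

section \<open>Closure properties of Souslin sets\<close>

lemma souslin_base: "A \<in> \<R> \<Longrightarrow> souslin \<R> A"
  unfolding souslin_def by (rule exI[of _ "\<lambda>_ _. A"]) auto

lemma souslin_UN:
  assumes "\<And>m::nat. souslin \<R> (D m)"
  shows "souslin \<R> (\<Union>m. D m)"
proof -
  obtain R where "\<forall>m. (\<forall>n \<sigma>. R m n \<sigma> \<in> \<R>) \<and>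
      (\<forall>n \<sigma> \<tau>. (\<forall>i\<le>n. \<sigma> i = \<tau> i) \<longrightarrow> R m n \<sigma> = R m n \<tau>) \<and>
      D m = {p. \<exists>\<sigma>::nat\<Rightarrow>nat. \<forall>n::nat. p \<in> R m n \<sigma>}"
    using choice[of "\<lambda>m R. (\<forall>n \<sigma>. R n \<sigma> \<in> \<R>) \<and>
      (\<forall>n \<sigma> \<tau>. (\<forall>i\<le>n. \<sigma> i = \<tau> i) \<longrightarrow> R n \<sigma> = R n \<tau>) \<and>
      D m = {p. \<exists>\<sigma>::nat\<Rightarrow>nat. \<forall>n::nat. p \<in> R n \<sigma>}"] assms[unfolded souslin_def] by blast
  then have R: "\<And>m n \<sigma>. R m n \<sigma> \<in> \<R>"
    "\<And>m n \<sigma> \<tau>. (\<forall>i\<le>n. \<sigma> i = \<tau> i) \<Longrightarrow> R m n \<sigma> = R m n \<tau>"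
    "\<And>m. D m = {p. \<exists>\<sigma>. \<forall>n. p \<in> R m n \<sigma>}"
    by simp_all
  \<comment> \<open>Coordinate 0 holds the pair of the index \<open>m\<close> and the old coordinate
    0. Prepending \<open>m\<close> instead would make stage \<open>n\<close> read coordinate
    \<open>n + 1\<close>.\<close>
  define R' where "R' n \<sigma> = R (fst (prod_decode (\<sigma> 0))) n (\<sigma>(0 := snd (prod_decode (\<sigma> 0))))"
    for n and \<sigma> :: "nat \<Rightarrow> nat"
  have "R' n \<sigma> = R' n \<tau>" if "\<forall>i\<le>n. \<sigma> i = \<tau> i" for n \<sigma> \<tau>
    using that unfolding R'_def by (auto intro!: R(2))
  moreover have "(\<Union>m. D m) = {p. \<exists>\<sigma>. \<forall>n. p \<in> R' n \<sigma>}"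
  proof (intro set_eqI iffI)
    fix p assume "p \<in> (\<Union>m. D m)"
    then obtain m \<sigma> where "\<forall>n. p \<in> R m n \<sigma>" using R(3) by auto
    then have "\<forall>n. p \<in> R' n (\<sigma>(0 := prod_encode (m, \<sigma> 0)))"
      by (simp add: R'_def)
    then show "p \<in> {p. \<exists>\<sigma>. \<forall>n. p \<in> R' n \<sigma>}" by blast
  next
    fix p assume "p \<in> {p. \<exists>\<sigma>. \<forall>n. p \<in> R' n \<sigma>}"
    then obtain \<sigma> where "\<forall>n. p \<in> R' n \<sigma>" by blast
    then have "p \<in> D (fst (prod_decode (\<sigma> 0)))"
      unfolding R(3) R'_def by blast
    then show "p \<in> (\<Union>m. D m)" by blast
  qed
  moreover have "R' n \<sigma> \<in> \<R>" for n \<sigma> by (simp add: R'_def R(1))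
  ultimately show ?thesis
    unfolding souslin_def by blast
qed

lemma souslin_INT:
  assumes "\<And>m::nat. souslin \<R> (D m)"
  shows "souslin \<R> (\<Inter>m. D m)"
proof -
  obtain R where "\<forall>m. (\<forall>n \<sigma>. R m n \<sigma> \<in> \<R>) \<and>
      (\<forall>n \<sigma> \<tau>. (\<forall>i\<le>n. \<sigma> i = \<tau> i) \<longrightarrow> R m n \<sigma> = R m n \<tau>) \<and>
      D m = {p. \<exists>\<sigma>::nat\<Rightarrow>nat. \<forall>n::nat. p \<in> R m n \<sigma>}"
    using choice[of "\<lambda>m R. (\<forall>n \<sigma>. R n \<sigma> \<in> \<R>) \<and>
      (\<forall>n \<sigma> \<tau>. (\<forall>i\<le>n. \<sigma> i = \<tau> i) \<longrightarrow> R n \<sigma> = R n \<tau>) \<and>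
      D m = {p. \<exists>\<sigma>::nat\<Rightarrow>nat. \<forall>n::nat. p \<in> R n \<sigma>}"] assms[unfolded souslin_def] by blast
  then have R: "\<And>m n \<sigma>. R m n \<sigma> \<in> \<R>"
    "\<And>m n \<sigma> \<tau>. (\<forall>i\<le>n. \<sigma> i = \<tau> i) \<Longrightarrow> R m n \<sigma> = R m n \<tau>"
    "\<And>m. D m = {p. \<exists>\<sigma>. \<forall>n. p \<in> R m n \<sigma>}"
    by simp_all
  \<comment> \<open>One sequence codes countably many: the \<open>m\<close>-th consists of the
    values at \<open>prod_encode (m, i)\<close>. Stage \<open>k\<close> stands for the pair
    \<open>(m, n)\<close> that it codes and reads only the codes of \<open>(m, i)\<close> with
    \<open>i \<le> n\<close>, which are at most \<open>k\<close> because the pairing is monotone in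
    its second argument.\<close>
  define R' where "R' k \<sigma> = (case prod_decode k of (m, n) \<Rightarrow> R m n (\<lambda>i. \<sigma> (prod_encode (m, i))))"
    for k and \<sigma> :: "nat \<Rightarrow> nat"
  have mono: "prod_encode (m, i) \<le> prod_encode (m, n)" if "i \<le> n" for m i n
    using that by (auto simp: prod_encode_def triangle_def intro!: div_le_mono mult_le_mono add_mono)
  have "R' k \<sigma> = R' k \<tau>" if "\<forall>i\<le>k. \<sigma> i = \<tau> i" for k \<sigma> \<tau>
  proof -
    obtain m n where mn: "prod_decode k = (m, n)" by fastforce
    then have "k = prod_encode (m, n)" by (metis prod_decode_inverse)
    then show ?thesis using that mono by (auto simp: R'_def mn intro!: R(2))
  qed
  moreover have "(\<Inter>m. D m) = {p. \<exists>\<sigma>. \<forall>n. p \<in> R' n \<sigma>}"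
  proof (intro set_eqI iffI)
    fix p assume "p \<in> (\<Inter>m. D m)"
    then have "\<forall>m. \<exists>\<sigma>. \<forall>n. p \<in> R m n \<sigma>" using R(3) by auto
    then obtain \<sigma> where \<sigma>: "\<And>m n. p \<in> R m n (\<sigma> m)" by metis
    have "\<forall>n. p \<in> R' n (\<lambda>k. case prod_decode k of (m, i) \<Rightarrow> \<sigma> m i)"
      by (auto simp: R'_def \<sigma> split: prod.split)
    then show "p \<in> {p. \<exists>\<sigma>. \<forall>n. p \<in> R' n \<sigma>}" by blast
  next
    fix p assume "p \<in> {p. \<exists>\<sigma>. \<forall>n. p \<in> R' n \<sigma>}"
    then obtain \<sigma> where \<sigma>: "\<And>n. p \<in> R' n \<sigma>" by auto
    have "p \<in> R m n (\<lambda>i. \<sigma> (prod_encode (m, i)))" for m n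
      using \<sigma>[of "prod_encode (m, n)"] by (simp add: R'_def)
    then show "p \<in> (\<Inter>m. D m)" using R(3) by blast
  qed
  moreover have "R' k \<sigma> \<in> \<R>" for k \<sigma> by (simp add: R'_def R(1) split: prod.split)
  ultimately show ?thesis
    unfolding souslin_def by blast
qed

text \<open>Souslin sets need not be closed under complement, so the induction carries each set
  together with its complement; countable unions become countable intersections on the complementary
  side.\<close>

lemma sigma_sets_imp_souslin:
  assumes "A \<in> sigma_sets \<Omega> G" "G \<subseteq> Pow \<Omega>"
    and "\<And>A. A \<in> G \<Longrightarrow> souslin \<R> A" "\<And>A. A \<in> G \<Longrightarrow> souslin \<R> (\<Omega> - A)"
    and "souslin \<R> {}" "souslin \<R> \<Omega>"
  shows "souslin \<R> A"
proof -
  have "souslin \<R> A \<and> souslin \<R> (\<Omega> - A) \<and> A \<subseteq> \<Omega>"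
    using assms(1)
  proof induction
    case (Union a)
    have "souslin \<R> (\<Inter>i. \<Omega> - a i)" using Union by (intro souslin_INT) auto
    moreover have "\<Omega> - (\<Union>i. a i) = (\<Inter>i. \<Omega> - a i)" by auto
    ultimately have "souslin \<R> (\<Omega> - (\<Union>i. a i))" by (simp only:)
    then show ?case using Union by (auto intro!: souslin_UN)
  qed (use assms in \<open>auto simp: double_diff\<close>)
  then show ?thesis by simp
qed

text \<open>Compactness of a product of finite sets: the admissible prefixes form a finitely
  branching tree with members of every height, so it has an infinite branch.\<close>

lemma bounded_koenig:
  fixes s :: "nat \<Rightarrow> nat" and Q :: "nat \<Rightarrow> (nat \<Rightarrow> nat) \<Rightarrow> bool"
  assumes cong: "\<And>n \<sigma> \<tau>. (\<forall>i\<le>n. \<sigma> i = \<tau> i) \<Longrightarrow> Q n \<sigma> = Q n \<tau>"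
    and ex: "\<And>n. \<exists>\<sigma>. (\<forall>i\<le>n. \<sigma> i \<le> s i) \<and> (\<forall>k\<le>n. Q k \<sigma>)"
  shows "\<exists>\<sigma>. \<forall>k. Q k \<sigma>"
proof -
  \<comment> \<open>The invariant along the branch: the prefix chosen so far still has extensions of
    every height.\<close>
  define G where "G n \<tau> \<longleftrightarrow> (\<forall>m. \<exists>\<sigma>. (\<forall>i<n. \<sigma> i = \<tau> i) \<and> (\<forall>i\<le>m. \<sigma> i \<le> s i) \<and> (\<forall>k\<le>m. Q k \<sigma>))"
    for n \<tau>
  have step: "\<exists>j. G (Suc n) (\<tau>(n := j))" if G: "G n \<tau>" for n \<tau>
  proof (rule ccontr)
    assume "\<not> ?thesis"
    then have "\<forall>j. \<exists>m. \<not> (\<exists>\<sigma>. (\<forall>i<Suc n. \<sigma> i = (\<tau>(n := j)) i) \<and> (\<forall>i\<le>m. \<sigma> i \<le> s i) \<and> (\<forall>k\<le>m. Q k \<sigma>))"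
      unfolding G_def by blast
    then obtain m where m: "\<And>j \<sigma>. \<not> ((\<forall>i<Suc n. \<sigma> i = (\<tau>(n := j)) i) \<and> (\<forall>i\<le>m j. \<sigma> i \<le> s i) \<and> (\<forall>k\<le>m j. Q k \<sigma>))"
      by metis
    \<comment> \<open>A height beyond the failure heights \<open>m j\<close> of all admissible
      values \<open>j \<le> s n\<close> at once; the summand \<open>n\<close> makes the bound on
      \<open>\<sigma> n\<close> available.\<close>
    define M where "M = n + (\<Sum>j\<le>s n. m j)"
    obtain \<sigma> where \<sigma>: "\<forall>i<n. \<sigma> i = \<tau> i" "\<forall>i\<le>M. \<sigma> i \<le> s i" "\<forall>k\<le>M. Q k \<sigma>"
      using G unfolding G_def by blast
    have "m (\<sigma> n) \<le> (\<Sum>j\<le>s n. m j)"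
      using \<sigma>(2) by (intro member_le_sum) (auto simp: M_def)
    then have "m (\<sigma> n) \<le> M" unfolding M_def by simp
    then show False using m[where j="\<sigma> n" and \<sigma>=\<sigma>] \<sigma> by (auto simp: less_Suc_eq)
  qed
  then obtain nx where nx: "\<And>n \<tau>. G n \<tau> \<Longrightarrow> G (Suc n) (\<tau>(n := nx n \<tau>))" by metis
  define S where "S = rec_nat (\<lambda>_. 0) (\<lambda>n \<tau>. \<tau>(n := nx n \<tau>))"
  have S0: "S 0 = (\<lambda>_. 0)" and SS: "\<And>n. S (Suc n) = (S n)(n := nx n (S n))"
    by (auto simp: S_def)
  have "G 0 (S 0)"
    using ex by (simp add: G_def)
  then have GS: "G n (S n)" for n
    by (induction n) (simp_all only: SS nx)
  have stable: "S m i = S (Suc i) i" if "i < m" for m i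
    using that by (induction m) (auto simp: SS less_Suc_eq)
  have "Q k (\<lambda>i. S (Suc i) i)" for k
  proof -
    obtain \<sigma> where "\<forall>i<Suc k. \<sigma> i = S (Suc k) i" "Q k \<sigma>"
      using GS[of "Suc k"] unfolding G_def by blast
    then show ?thesis using cong[of k \<sigma> "\<lambda>i. S (Suc i) i"] stable[of _ "Suc k"]
      by (metis le_imp_less_Suc)
  qed
  then show ?thesis by blast
qed

text \<open>Upward continuity of \<open>I\<close> lets the bounds \<open>s 0, s 1, ...\<close> on a
  witness be fixed one after the other while the value stays above \<open>c\<close>. Truncating the
  conditions after stage \<open>n\<close> gives sets in \<R>, whose intersection falls back into
  \<open>D\<close> by \<open>bounded_koenig\<close>. Passing to the limit of \<open>I\<close> along
  these decreasing sets is left to the application.\<close>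

lemma choquet_capacitability:
  fixes I :: "'a set \<Rightarrow> ennreal"
  assumes mono: "\<And>A B. A \<subseteq> B \<Longrightarrow> I A \<le> I B"
    and cont: "\<And>A :: nat \<Rightarrow> 'a set. incseq A \<Longrightarrow> (SUP n. I (A n)) = I (\<Union>n. A n)"
    and Un: "\<And>A B. A \<in> \<R> \<Longrightarrow> B \<in> \<R> \<Longrightarrow> A \<union> B \<in> \<R>"
    and Int: "\<And>A B. A \<in> \<R> \<Longrightarrow> B \<in> \<R> \<Longrightarrow> A \<inter> B \<in> \<R>"
    and D: "souslin \<R> D" "c < I D"
  shows "\<exists>C. (\<forall>n::nat. C n \<in> \<R>) \<and> decseq C \<and> (\<Inter>n. C n) \<subseteq> D \<and> (\<forall>n. c < I (C n))"
proof -
  obtain R where R: "\<And>n \<sigma>. R n \<sigma> \<in> \<R>"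
    "\<And>n \<sigma> \<tau>. (\<forall>i\<le>n. \<sigma> i = \<tau> i) \<Longrightarrow> R n \<sigma> = R n \<tau>"
    "D = {p. \<exists>\<sigma>::nat\<Rightarrow>nat. \<forall>n::nat. p \<in> R n \<sigma>}"
    using D(1) unfolding souslin_def by blast
  \<comment> \<open>The part of \<open>D\<close> with a witness obeying the first \<open>n\<close>
    bounds. It is exhausted by raising the bound on coordinate \<open>n\<close>, which is where
    upward continuity enters.\<close>
  define E where "E n s = {p. \<exists>\<sigma>. (\<forall>i<n. \<sigma> i \<le> s i) \<and> (\<forall>k. p \<in> R k \<sigma>)}" for n and s :: "nat \<Rightarrow> nat"
  have step: "\<exists>j. c < I (E (Suc n) (s(n := j)))" if "c < I (E n s)" for n s
  proof -
    have "E (Suc n) (s(n := j)) \<subseteq> E (Suc n) (s(n := j'))" if "j \<le> j'" for j j'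
    proof
      fix p assume "p \<in> E (Suc n) (s(n := j))"
      then obtain \<sigma> where "\<forall>i<Suc n. \<sigma> i \<le> (s(n := j)) i" "\<forall>k. p \<in> R k \<sigma>"
        unfolding E_def by blast
      moreover from this have "\<forall>i<Suc n. \<sigma> i \<le> (s(n := j')) i"
        using that by (auto split: if_splits)
      ultimately show "p \<in> E (Suc n) (s(n := j'))" unfolding E_def by blast
    qed
    then have "incseq (\<lambda>j. E (Suc n) (s(n := j)))"
      by (simp add: incseq_def)
    moreover have "(\<Union>j. E (Suc n) (s(n := j))) = E n s"
    proof (intro equalityI subsetI)
      fix p assume "p \<in> E n s"
      then obtain \<sigma> where "\<forall>i<n. \<sigma> i \<le> s i" "\<forall>k. p \<in> R k \<sigma>"
        unfolding E_def by blast
      moreover from this have "\<forall>i<Suc n. \<sigma> i \<le> (s(n := \<sigma> n)) i"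
        by (auto simp: less_Suc_eq)
      ultimately have "p \<in> E (Suc n) (s(n := \<sigma> n))" unfolding E_def by blast
      then show "p \<in> (\<Union>j. E (Suc n) (s(n := j)))" by blast
    next
      fix p assume "p \<in> (\<Union>j. E (Suc n) (s(n := j)))"
      then obtain j \<sigma> where "\<forall>i<Suc n. \<sigma> i \<le> (s(n := j)) i" "\<forall>k. p \<in> R k \<sigma>"
        unfolding E_def by blast
      moreover from this have "\<forall>i<n. \<sigma> i \<le> s i"
        by (metis fun_upd_other less_Suc_eq nat_neq_iff)
      ultimately show "p \<in> E n s" unfolding E_def by blast
    qed
    ultimately have "c < (SUP j. I (E (Suc n) (s(n := j))))"
      using that cont[of "\<lambda>j. E (Suc n) (s(n := j))"] by simp
    then show ?thesis unfolding less_SUP_iff by blast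
  qed
  then obtain nx where nx: "\<And>n s. c < I (E n s) \<Longrightarrow> c < I (E (Suc n) (s(n := nx n s)))" by metis
  define S where "S = rec_nat (\<lambda>_. 0) (\<lambda>n s. s(n := nx n s))"
  have S0: "S 0 = (\<lambda>_. 0)" and SS: "\<And>n. S (Suc n) = (S n)(n := nx n (S n))"
    by (auto simp: S_def)
  have "E 0 (S 0) = D" by (simp add: E_def R(3))
  then have ES: "c < I (E n (S n))" for n
    by (induction n) (simp_all only: D(2) SS nx)
  define s where "s i = S (Suc i) i" for i
  have stable: "S m i = s i" if "i < m" for m i
    using that unfolding s_def by (induction m) (auto simp: SS less_Suc_eq)
  \<comment> \<open>In contrast to \<open>E\<close>, only the stages up to \<open>n\<close> are
    tested, so finitely many prefixes matter and \<open>C n\<close> is a finite union of finite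
    intersections.\<close>
  define C where "C n = {p. \<exists>\<sigma>. (\<forall>i\<le>n. \<sigma> i \<le> s i) \<and> (\<forall>k\<le>n. p \<in> R k \<sigma>)}" for n
  have "E (Suc n) (S (Suc n)) \<subseteq> C n" for n
  proof
    fix p assume "p \<in> E (Suc n) (S (Suc n))"
    then obtain \<sigma> where "\<forall>i<Suc n. \<sigma> i \<le> S (Suc n) i" "\<forall>k. p \<in> R k \<sigma>"
      unfolding E_def by blast
    then have "(\<forall>i\<le>n. \<sigma> i \<le> s i) \<and> (\<forall>k\<le>n. p \<in> R k \<sigma>)"
      using stable[of _ "Suc n"] by (simp add: less_Suc_eq_le)
    then show "p \<in> C n" unfolding C_def by blast
  qed
  then have "c < I (C n)" for n
    using ES[of "Suc n"] mono by (metis order_less_le_trans)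
  moreover have "decseq C"
  proof (intro decseq_SucI subsetI)
    fix n p assume "p \<in> C (Suc n)"
    then obtain \<sigma> where "\<forall>i\<le>Suc n. \<sigma> i \<le> s i" "\<forall>k\<le>Suc n. p \<in> R k \<sigma>"
      unfolding C_def by blast
    then have "(\<forall>i\<le>n. \<sigma> i \<le> s i) \<and> (\<forall>k\<le>n. p \<in> R k \<sigma>)" by simp
    then show "p \<in> C n" unfolding C_def by blast
  qed
  moreover have "(\<Inter>n. C n) \<subseteq> D"
  proof
    fix p assume "p \<in> (\<Inter>n. C n)"
    then have "\<And>n. \<exists>\<sigma>. (\<forall>i\<le>n. \<sigma> i \<le> s i) \<and> (\<forall>k\<le>n. p \<in> R k \<sigma>)"
      by (simp add: C_def)
    moreover have "(p \<in> R n \<sigma>) = (p \<in> R n \<tau>)" if "\<forall>i\<le>n. \<sigma> i = \<tau> i" for n \<sigma> \<tau>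
      using R(2)[OF that] by simp
    ultimately have "\<exists>\<sigma>. \<forall>k. p \<in> R k \<sigma>"
      by (rule bounded_koenig[rotated])
    then show "p \<in> D" by (simp add: R(3))
  qed
  moreover have "C n \<in> \<R>" for n
  proof -
    \<comment> \<open>Stages up to \<open>n\<close> ignore later coordinates, so setting these to 0
      leaves a finite set of representatives.\<close>
    define F where "F = {\<sigma>. (\<forall>i\<le>n. \<sigma> i \<le> s i) \<and> (\<forall>i>n. \<sigma> i = 0)}"
    have "finite F"
    proof (rule finite_subset)
      show "F \<subseteq> {\<sigma>. \<forall>i. (i \<in> {..n} \<longrightarrow> \<sigma> i \<in> {..(\<Sum>i\<le>n. s i)}) \<and> (i \<notin> {..n} \<longrightarrow> \<sigma> i = 0)}"
        by (auto simp: F_def intro!: order_trans[OF _ member_le_sum])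
    qed (intro finite_set_of_finite_funs; simp)
    moreover have "F \<noteq> {}" by (auto simp: F_def intro!: exI[of _ "\<lambda>_. 0"])
    moreover have "C n = (\<Union>\<sigma>\<in>F. \<Inter>k\<in>{..n}. R k \<sigma>)"
    proof (intro set_eqI iffI)
      fix p assume "p \<in> C n"
      then obtain \<sigma> where \<sigma>: "\<forall>i\<le>n. \<sigma> i \<le> s i" "\<forall>k\<le>n. p \<in> R k \<sigma>"
        by (auto simp: C_def)
      let ?\<tau> = "\<lambda>i. if i \<le> n then \<sigma> i else 0"
      have "?\<tau> \<in> F" using \<sigma> by (auto simp: F_def)
      moreover have "R k \<sigma> = R k ?\<tau>" if "k \<le> n" for k
        using that by (intro R(2)) auto
      ultimately show "p \<in> (\<Union>\<sigma>\<in>F. \<Inter>k\<in>{..n}. R k \<sigma>)"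
        using \<sigma>(2) by (intro UN_I[of ?\<tau>]) auto
    next
      fix p assume "p \<in> (\<Union>\<sigma>\<in>F. \<Inter>k\<in>{..n}. R k \<sigma>)"
      then obtain \<sigma> where "\<sigma> \<in> F" "\<forall>k\<le>n. p \<in> R k \<sigma>" by auto
      then show "p \<in> C n" unfolding C_def F_def by blast
    qed
    moreover have INT: "(\<Inter>k\<in>{..m}. R k \<sigma>) \<in> \<R>" for \<sigma> m
      by (induction m) (auto simp: R(1) atMost_Suc intro: Int)
    moreover have "(\<Union>\<sigma>\<in>F'. \<Inter>k\<in>{..n}. R k \<sigma>) \<in> \<R>" if "finite F'" "F' \<noteq> {}" for F'
      using that by (induction rule: finite_ne_induct) (auto intro: Un INT)
    ultimately show ?thesis by simp
  qed
  ultimately show ?thesis by blast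
qed

text \<open>Projection does not commute with intersections in general. Here the nested sections over
  a common point are nonempty and compact, so they share an element.\<close>

lemma decseq_compact_sections_fst:
  fixes C :: "nat \<Rightarrow> ('a \<times> 'b::heine_borel) set"
  assumes "decseq C" and comp: "\<And>n z. compact {y. (z, y) \<in> C n}"
  shows "fst ` (\<Inter>n. C n) = (\<Inter>n. fst ` C n)"
proof (intro equalityI subsetI)
  fix z assume z: "z \<in> (\<Inter>n. fst ` C n)"
  let ?K = "\<lambda>n. {y. (z, y) \<in> C n}"
  have "\<Inter>(range ?K) \<noteq> {}"
  proof (rule compact_nest)
    show "?K n \<noteq> {}" for n
    proof -
      have "z \<in> fst ` C n" using z by blast
      then show ?thesis by force
    qed
    show "?K n \<subseteq> ?K m" if "m \<le> n" for m n using \<open>decseq C\<close> that by (auto simp: decseq_def)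
  qed (rule comp)
  then obtain y where "\<forall>n. (z, y) \<in> C n" by auto
  then show "z \<in> fst ` (\<Inter>n. C n)" by force
qed auto

text \<open>The outer measure of the projection is a set function to which
  \<open>choquet_capacitability\<close> applies. It yields measurable subsets of the projection
  whose measure is arbitrarily close to its outer measure; finiteness of \<open>M\<close> turns this
  into a sandwich between sets \<open>B\<close> and \<open>E\<close> of equal measure, which the
  completion accepts.\<close>

theorem measurable_projection:
  fixes D :: "('a \<times> 'b::euclidean_space) set"
  assumes "finite_measure M" and D: "D \<in> sets (M \<Otimes>\<^sub>M borel)"
  shows "fst ` D \<in> sets (completion M)"
proof -
  interpret finite_measure M by fact
  define \<R>0 where "\<R>0 = {A \<times> K | A (K :: 'b set). A \<in> sets M \<and> compact K}"
  \<comment> \<open>Finite unions of rectangles with a measurable and a compact side are closed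
    under union and intersection, and they have compact sections and measurable projections, so
    projection commutes with their decreasing intersections.\<close>
  define \<R> where "\<R> = {\<Union>T | T. finite T \<and> T \<subseteq> \<R>0}"
  have R0: "A \<times> K \<in> \<R>" if "A \<in> sets M" "compact K" for A K
    using that unfolding \<R>_def \<R>0_def by (intro CollectI exI[of _ "{A \<times> K}"]) auto
  have Un: "H \<union> H' \<in> \<R>" if HH': "H \<in> \<R>" "H' \<in> \<R>" for H H'
  proof -
    obtain T T' where "finite T" "T \<subseteq> \<R>0" "H = \<Union>T" "finite T'" "T' \<subseteq> \<R>0" "H' = \<Union>T'"
      using HH' unfolding \<R>_def by blast
    then show ?thesis
      unfolding \<R>_def by (intro CollectI exI[of _ "T \<union> T'"]) auto
  qed
  have Int0: "B \<inter> B' \<in> \<R>0" if "B \<in> \<R>0" "B' \<in> \<R>0" for B B'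
  proof -
    obtain A K A' K' where "B = A \<times> K" "B' = A' \<times> K'" "A \<in> sets M" "A' \<in> sets M"
        "compact K" "compact K'"
      using \<open>B \<in> \<R>0\<close> \<open>B' \<in> \<R>0\<close> unfolding \<R>0_def by blast
    moreover from this have "B \<inter> B' = (A \<inter> A') \<times> (K \<inter> K')" by auto
    ultimately show ?thesis
      unfolding \<R>0_def by (intro CollectI exI[of _ "A \<inter> A'"] exI[of _ "K \<inter> K'"]) (auto intro: compact_Int)
  qed
  have Int: "H \<inter> H' \<in> \<R>" if HH': "H \<in> \<R>" "H' \<in> \<R>" for H H'
  proof -
    obtain T T' where T: "finite T" "T \<subseteq> \<R>0" "H = \<Union>T" "finite T'" "T' \<subseteq> \<R>0" "H' = \<Union>T'"
      using HH' unfolding \<R>_def by blast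
    define T'' where "T'' = (\<lambda>(B, B'). B \<inter> B') ` (T \<times> T')"
    have "finite T''" "H \<inter> H' = \<Union>T''" using T by (auto simp: T''_def)
    moreover have "T'' \<subseteq> \<R>0" using T Int0 by (auto simp: T''_def)
    ultimately show ?thesis unfolding \<R>_def by blast
  qed
  have section_compact: "compact {y. (z, y) \<in> H}" if "H \<in> \<R>" for z H
  proof -
    obtain T where T: "finite T" "T \<subseteq> \<R>0" "H = \<Union>T"
      using \<open>H \<in> \<R>\<close> unfolding \<R>_def by blast
    have "compact {y. (z, y) \<in> B}" if "B \<in> T" for B
    proof -
      have "B \<in> \<R>0" using T(2) that by blast
      then obtain A K where "B = A \<times> K" "compact K" unfolding \<R>0_def by blast
      then show ?thesis by (cases "z \<in> A") auto
    qed
    moreover have "{y. (z, y) \<in> H} = (\<Union>B\<in>T. {y. (z, y) \<in> B})" using T by auto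
    ultimately show ?thesis using T(1) by (simp add: compact_UN)
  qed
  have fst_sets: "fst ` H \<in> sets M" if "H \<in> \<R>" for H
  proof -
    obtain T where T: "finite T" "T \<subseteq> \<R>0" "H = \<Union>T"
      using \<open>H \<in> \<R>\<close> unfolding \<R>_def by blast
    have "fst ` B \<in> sets M" if "B \<in> T" for B
    proof -
      have "B \<in> \<R>0" using T(2) that by blast
      then obtain A K where "B = A \<times> K" "A \<in> sets M" unfolding \<R>0_def by blast
      then show ?thesis by (cases "K = {}") auto
    qed
    moreover have "fst ` H = (\<Union>B\<in>T. fst ` B)" using T by auto
    ultimately show ?thesis using T(1) by (auto intro: sets.finite_UN)
  qed

  have souslin_Un: "souslin \<R> (X \<union> Y)" if "souslin \<R> X" "souslin \<R> Y" for X Y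
  proof -
    have "souslin \<R> (\<Union>n::nat. if n = 0 then X else Y)"
      using that by (intro souslin_UN) auto
    moreover have "(\<Union>n::nat. if n = 0 then X else Y) = X \<union> Y" by (auto split: if_splits)
    ultimately show ?thesis by simp
  qed
  have souslin_open: "souslin \<R> (A \<times> U)" if A: "A \<in> sets M" and "open U" for A U
  proof (cases "U = {}")
    case True
    then show ?thesis using R0[of "{}" "{}"] by (auto intro: souslin_base)
  next
    case False
    obtain \<D> where \<D>: "countable \<D>" "\<And>X. X \<in> \<D> \<Longrightarrow> \<exists>a b. X = cbox a b" "\<Union>\<D> = U"
      using open_countable_Union_open_cbox[OF \<open>open U\<close>] by metis
    have "\<D> \<noteq> {}" using False \<D>(3) by auto
    then have "A \<times> U = (\<Union>n. A \<times> from_nat_into \<D> n)"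
      using \<D>(1,3) range_from_nat_into[of \<D>] by blast
    moreover have "compact (from_nat_into \<D> n)" for n
      using \<D>(2)[OF from_nat_into[OF \<open>\<D> \<noteq> {}\<close>]] by (metis compact_cbox)
    ultimately show ?thesis
      using R0[OF A] souslin_UN[of \<R> "\<lambda>n. A \<times> from_nat_into \<D> n"] souslin_base by metis
  qed
  have souslin_closed: "souslin \<R> (A \<times> K)" if A: "A \<in> sets M" and "closed K" for A K
  proof -
    have "A \<times> K = (\<Union>n. A \<times> (K \<inter> cball 0 (real n)))"
      by (auto simp: real_arch_simple)
    moreover have "A \<times> (K \<inter> cball 0 (real n)) \<in> \<R>" for n
      using \<open>closed K\<close> by (intro R0 A closed_Int_compact) auto
    ultimately show ?thesis
      using souslin_UN[of \<R> "\<lambda>n. A \<times> (K \<inter> cball 0 (real n))"] souslin_base by metis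
  qed
  \<comment> \<open>Rectangles with a closed side have Souslin complements: such a complement is the
    union of a rectangle with side \<open>UNIV\<close> and one with an open side, and open as well
    as closed sets are countable unions of compact ones.\<close>
  let ?G = "{A \<times> K | A K. A \<in> sets M \<and> K \<in> Collect (closed :: 'b set \<Rightarrow> bool)}"
  have "sets (M \<Otimes>\<^sub>M (borel :: 'b measure)) = sets (sigma (space M \<times> space (borel :: 'b measure)) ?G)"
  proof (rule sets_pair_eq[where Ca = "{space M}" and Cb = "{UNIV}"])
    show "sets (borel :: 'b measure) = sigma_sets (space borel) (Collect closed)"
      by (simp add: borel_eq_closed)
    show "sets M = sigma_sets (space M) (sets M)"
      by (simp add: sets.sigma_sets_eq)
  qed (use sets.sets_into_space in auto)
  also have "\<dots> = sigma_sets (space M \<times> UNIV) ?G"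
    using sets.sets_into_space by (subst sets_measure_of) auto
  finally have D': "D \<in> sigma_sets (space M \<times> UNIV) ?G" using D by simp
  have souslin_D: "souslin \<R> D"
  proof (rule sigma_sets_imp_souslin[OF D'])
    show "?G \<subseteq> Pow (space M \<times> UNIV)" using sets.sets_into_space by auto
    show "souslin \<R> {}" using R0[of "{}" "{}"] by (auto intro: souslin_base)
    show "souslin \<R> (space M \<times> UNIV)" by (rule souslin_open) auto
    fix B assume "B \<in> ?G"
    then obtain A K where B: "B = A \<times> K" "A \<in> sets M" "closed K" by auto
    then show "souslin \<R> B" using souslin_closed by simp
    have "space M \<times> UNIV - B = (space M - A) \<times> UNIV \<union> space M \<times> (- K)"
      using B sets.sets_into_space by auto
    moreover have "souslin \<R> ((space M - A) \<times> UNIV)" "souslin \<R> (space M \<times> (- K))"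
      using B by (intro souslin_open; auto)+
    ultimately show "souslin \<R> (space M \<times> UNIV - B)" by (simp add: souslin_Un)
  qed

  define I where "I H = outer_measure_of M (fst ` H \<inter> space M)" for H :: "('a \<times> 'b) set"
  have D_space: "fst ` D \<subseteq> space M"
    using sets.sets_into_space[OF D] by (auto simp: space_pair_measure)
  \<comment> \<open>A measurable hull of the projection, the outer half of the sandwich.\<close>
  obtain E where E: "E \<in> sets M" "fst ` D \<subseteq> E" "outer_measure_of M (fst ` D) = emeasure M E"
    using outer_measure_of_attain[OF D_space] by blast
  have inner: "\<exists>B\<in>sets M. B \<subseteq> fst ` D \<and> c \<le> emeasure M B" if c: "c < I D" for c
  proof -
    have cont: "(SUP n. I (A n)) = I (\<Union>n. A n)" if "incseq A" for A :: "nat \<Rightarrow> ('a \<times> 'b) set"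
    proof -
      have "incseq (\<lambda>n. fst ` A n \<inter> space M)"
        using that by (auto simp: incseq_def dest: subsetD)
      then show ?thesis
        unfolding I_def by (subst SUP_outer_measure_of_incseq) (auto simp: image_UN)
    qed
    have "\<exists>C. (\<forall>n::nat. C n \<in> \<R>) \<and> decseq C \<and> (\<Inter>n. C n) \<subseteq> D \<and> (\<forall>n. c < I (C n))"
      by (rule choquet_capacitability[OF _ cont Un Int souslin_D c])
         (auto simp: I_def intro!: outer_measure_of_mono)
    then obtain C where C: "\<And>n::nat. C n \<in> \<R>" "decseq C" "(\<Inter>n. C n) \<subseteq> D" "\<And>n. c < I (C n)"
      by blast
    have eq: "fst ` (\<Inter>n. C n) = (\<Inter>n. fst ` C n)"
      by (rule decseq_compact_sections_fst) (use C section_compact in auto)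
    have "I (C n) = emeasure M (fst ` C n)" for n
      using fst_sets[OF C(1)[of n]] sets.sets_into_space by (auto simp: I_def Int_absorb2)
    then have "c \<le> emeasure M (fst ` C n)" for n using C(4)[of n] by simp
    moreover have "(\<lambda>n. emeasure M (fst ` C n)) \<longlonglongrightarrow> emeasure M (\<Inter>n. fst ` C n)"
      using fst_sets C(1,2) by (intro Lim_emeasure_decseq) (auto simp: decseq_def image_mono)
    ultimately have "c \<le> emeasure M (\<Inter>n. fst ` C n)"
      by (intro LIMSEQ_le_const) auto
    moreover have "(\<Inter>n. fst ` C n) \<in> sets M" using fst_sets C(1) by auto
    moreover have "(\<Inter>n. fst ` C n) \<subseteq> fst ` D" using image_mono[OF C(3), of fst] unfolding eq .
    ultimately show ?thesis by blast
  qed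
  have ID: "I D = emeasure M E"
    using D_space E(3) by (simp add: I_def Int_absorb2)
  obtain B where B: "B \<in> sets M" "B \<subseteq> fst ` D" "emeasure M B = emeasure M E"
  proof -
    define r where "r = measure M E"
    have Er: "emeasure M E = ennreal r" "0 \<le> r" by (simp_all add: r_def emeasure_eq_measure)
    have "\<exists>B\<in>sets M. B \<subseteq> fst ` D \<and> ennreal (r - 1 / real (Suc n)) \<le> emeasure M B" for n
    proof (cases "r = 0")
      case True
      then show ?thesis by (intro bexI[of _ "{}"]) (auto simp: ennreal_neg)
    next
      case False
      then show ?thesis
        using Er by (intro inner) (auto simp: ID ennreal_less_iff intro!: ennreal_lessI)
    qed
    then obtain B where B: "\<And>n. B n \<in> sets M" "\<And>n. B n \<subseteq> fst ` D"
        "\<And>n. ennreal (r - 1 / real (Suc n)) \<le> emeasure M (B n)"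
      by metis
    have "r - 1 / real (Suc n) \<le> measure M (\<Union>n. B n)" for n
    proof -
      have "ennreal (r - 1 / real (Suc n)) \<le> emeasure M (\<Union>n. B n)"
        by (rule order_trans[OF B(3)[of n] emeasure_mono]) (use B in auto)
      then show ?thesis by (simp add: emeasure_eq_measure)
    qed
    then have "r \<le> measure M (\<Union>n. B n)"
    proof (intro LIMSEQ_le_const2[of "\<lambda>n. r - 1 / real (Suc n)" r])
      show "(\<lambda>n. r - 1 / real (Suc n)) \<longlonglongrightarrow> r"
        using tendsto_diff[OF tendsto_const lim_inverse_n'[THEN LIMSEQ_Suc]] by simp
    qed auto
    then have "emeasure M E \<le> emeasure M (\<Union>n. B n)"
      unfolding Er by (simp add: emeasure_eq_measure)
    moreover have "(\<Union>n. B n) \<subseteq> fst ` D" using B(2) by blast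
    moreover have "(\<Union>n. B n) \<in> sets M" using B(1) by blast
    moreover have "emeasure M (\<Union>n. B n) \<le> emeasure M E"
      using calculation(2) E by (intro emeasure_mono) blast+
    ultimately show ?thesis
      by (intro that[of "\<Union>n. B n"] antisym)
  qed
  show ?thesis
  proof (rule completion.complete_sets_sandwich[of B _ E])
    show "B \<in> sets (completion M)" "E \<in> sets (completion M)" using B E by auto
    show "emeasure (completion M) B = emeasure (completion M) E"
      "emeasure (completion M) B < \<infinity>"
      using B E by (simp_all add: less_top[symmetric])
  qed (use B E in auto)
qed

section \<open>Laws of large numbers\<close>

text \<open>The running maximum of the random walk with steps \<open>X (\<omega> i)\<close>, started
  at 0. The recursion splits off the first coordinate and shifts the rest, matching the product law
  of a first coordinate and an independent tail.\<close>

fun partial_max :: "('a \<Rightarrow> real) \<Rightarrow> nat \<Rightarrow> (nat \<Rightarrow> 'a) \<Rightarrow> real" where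
  "partial_max X 0 \<omega> = 0"
| "partial_max X (Suc n) \<omega> = max 0 (X (\<omega> 0) + partial_max X n (\<lambda>i. \<omega> (Suc i)))"

lemma partial_max_nonneg: "0 \<le> partial_max X n \<omega>"
  by (cases n) auto

lemma partial_max_Suc_mono: "partial_max X n \<omega> \<le> partial_max X (Suc n) \<omega>"
proof (induction n arbitrary: \<omega>)
  case (Suc n)
  show ?case using Suc[of "\<lambda>i. \<omega> (Suc i)"]
    unfolding partial_max.simps(2)[of X "Suc n"] partial_max.simps(2)[of X n \<omega>] by (intro max.mono) auto
qed simp

lemma partial_max_mono: "m \<le> n \<Longrightarrow> partial_max X m \<omega> \<le> partial_max X n \<omega>"
  by (rule lift_Suc_mono_le[of "\<lambda>n. partial_max X n \<omega>"]) (use partial_max_Suc_mono in auto)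

lemma sum_le_partial_max: "(\<Sum>s<n. X (\<omega> s)) \<le> partial_max X n \<omega>"
proof (induction n arbitrary: \<omega>)
  case (Suc n)
  then show ?case
    using Suc[of "\<lambda>i. \<omega> (Suc i)"]
    unfolding sum.lessThan_Suc_shift partial_max.simps(2) by linarith
qed simp

lemma partial_max_case_nat:
  "partial_max X (Suc n) (case_nat x \<omega>) = max 0 (X x + partial_max X n \<omega>)"
  by simp

section \<open>A one-sided strong law on sequence space by a maximal argument\<close>

context sequence_space
begin

lemma borel_measurable_partial_max [measurable]:
  assumes [measurable]: "X \<in> borel_measurable M"
  shows "partial_max X n \<in> borel_measurable S"
proof (induction n)
  case 0
  have "partial_max X 0 = (\<lambda>_. 0)" by auto
  then show ?case by simp
next
  case (Suc n)
  note [measurable] = Suc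
  have "partial_max X (Suc n) = (\<lambda>\<omega>. max 0 (X (\<omega> 0) + partial_max X n (\<lambda>i. \<omega> (Suc i))))"
    by auto
  moreover have "(\<lambda>\<omega> i. \<omega> (Suc i)) \<in> S \<rightarrow>\<^sub>M S"
    by (intro measurable_PiM_single') (auto simp: space_PiM PiE_iff)
  note [measurable] = measurable_compose[OF this Suc]
  ultimately show ?case by simp
qed

lemma measurable_cons_S [measurable]: "(\<lambda>(x, \<omega>). case_nat x \<omega>) \<in> M \<Otimes>\<^sub>M S \<rightarrow>\<^sub>M S"
  unfolding split_beta' by measurable

lemma integral_cons:
  fixes f :: "(nat \<Rightarrow> 'a) \<Rightarrow> real"
  assumes [measurable]: "f \<in> borel_measurable S"
  shows "integrable S f \<longleftrightarrow> integrable (M \<Otimes>\<^sub>M S) (\<lambda>(x, \<omega>). f (case_nat x \<omega>))"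
    and "(\<integral>\<omega>. f \<omega> \<partial>S) = (\<integral>(x, \<omega>). f (case_nat x \<omega>) \<partial>(M \<Otimes>\<^sub>M S))"
proof -
  show "integrable S f \<longleftrightarrow> integrable (M \<Otimes>\<^sub>M S) (\<lambda>(x, \<omega>). f (case_nat x \<omega>))"
    by (subst PiM_iter[symmetric], subst integrable_distr_eq) (simp_all add: split_beta')
  show "(\<integral>\<omega>. f \<omega> \<partial>S) = (\<integral>(x, \<omega>). f (case_nat x \<omega>) \<partial>(M \<Otimes>\<^sub>M S))"
    by (subst PiM_iter[symmetric], subst integral_distr) (simp_all add: split_beta')
qed

sublocale PS: pair_prob_space M S ..

lemma integrable_pair_fst:
  assumes f: "integrable M (f :: 'a \<Rightarrow> real)"
  shows "integrable (M \<Otimes>\<^sub>M S) (\<lambda>(x, \<omega>). f x)"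
proof (rule PS.Fubini_integrable)
  have [measurable]: "f \<in> borel_measurable M" using f by auto
  show "(\<lambda>(x, \<omega>). f x) \<in> borel_measurable (M \<Otimes>\<^sub>M S)" by measurable
qed (use f in \<open>simp_all add: prob_space\<close>)

lemma integrable_pair_snd:
  assumes f: "integrable S (f :: (nat \<Rightarrow> 'a) \<Rightarrow> real)"
  shows "integrable (M \<Otimes>\<^sub>M S) (\<lambda>(x, \<omega>). f \<omega>)"
proof (rule PS.Fubini_integrable)
  have [measurable]: "f \<in> borel_measurable S" using f by auto
  show "(\<lambda>(x, \<omega>). f \<omega>) \<in> borel_measurable (M \<Otimes>\<^sub>M S)" by measurable
qed (use f in simp_all)

lemma integrable_partial_max:
  assumes X: "integrable M X"
  shows "integrable S (partial_max X n)"
proof (induction n)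
  case 0
  have "partial_max X 0 = (\<lambda>_. 0)" by auto
  then show ?case by simp
next
  case (Suc n)
  note [measurable] = borel_measurable_integrable[OF X]
  show ?case
    unfolding integral_cons(1)[OF borel_measurable_partial_max[OF borel_measurable_integrable[OF X]]] partial_max_case_nat
    using Bochner_Integration.integrable_max[OF integrable_zero
        Bochner_Integration.integrable_add[OF integrable_pair_fst[OF X] integrable_pair_snd[OF Suc]]]
    by (simp add: split_beta')
qed

text \<open>
  The shift preserves the law and the event that the partial maxima are unbounded; on that event the
  nonnegative increments of the expected maxima tend to the expectation of \<open>X\<close> times its probability.
\<close>
lemma AE_partial_max_bounded:
  assumes X: "integrable M X" and neg: "(\<integral>x. X x \<partial>M) < 0"
  shows "AE \<omega> in S. \<exists>B. \<forall>n. partial_max X n \<omega> \<le> B"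
proof -
  have [measurable]: "X \<in> borel_measurable M" using X by auto
  define A where "A = {\<omega> \<in> space S. \<forall>b::nat. \<exists>n. partial_max X n \<omega> > real b}"
  have [measurable]: "A \<in> sets S" unfolding A_def by measurable
  \<comment> \<open>Prepending a coordinate changes the maxima by at most
    \<open>\<bar>X x\<bar>\<close>, up to an index shift, so unboundedness is unaffected.\<close>
  have A_shift: "case_nat x \<omega> \<in> A \<longleftrightarrow> \<omega> \<in> A" if "x \<in> space M" "\<omega> \<in> space S" for x \<omega>
  proof -
    have sp: "case_nat x \<omega> \<in> space S"
      using that by (auto simp: space_PiM PiE_iff split: nat.split)
    have "(\<forall>b::nat. \<exists>n. partial_max X n (case_nat x \<omega>) > real b) \<longleftrightarrow> (\<forall>b::nat. \<exists>n. partial_max X n \<omega> > real b)"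
    proof (intro iffI allI)
      fix b :: nat assume *: "\<forall>b::nat. \<exists>n. partial_max X n (case_nat x \<omega>) > real b"
      obtain b' :: nat where b': "real b + \<bar>X x\<bar> < real b'" using reals_Archimedean2 by blast
      obtain n where n: "partial_max X n (case_nat x \<omega>) > real b'" using * by blast
      then have "n \<noteq> 0" by (intro notI) simp
      then obtain n' where "n = Suc n'" using not0_implies_Suc by blast
      then have "X x + partial_max X n' \<omega> > real b'" using n by (auto simp: max_def split: if_splits)
      then show "\<exists>n. partial_max X n \<omega> > real b" using b' by (intro exI[of _ n']) linarith
    next
      fix b :: nat assume *: "\<forall>b::nat. \<exists>n. partial_max X n \<omega> > real b"
      obtain b' :: nat where b': "real b + \<bar>X x\<bar> < real b'" using reals_Archimedean2 by blast
      obtain n where n: "partial_max X n \<omega> > real b'" using * by blast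
      then show "\<exists>n. partial_max X n (case_nat x \<omega>) > real b"
        using b' by (intro exI[of _ "Suc n"]) (auto simp: max_def)
    qed
    then show ?thesis using sp that by (simp add: A_def)
  qed
  let ?P = "M \<Otimes>\<^sub>M S"
  \<comment> \<open>\<open>max (- partial_max X n \<omega>) (X x)\<close> is the increment
    \<open>partial_max X (Suc n) (case_nat x \<omega>) - partial_max X n \<omega>\<close>. It equals
    \<open>X x\<close> as soon as the maximum reaches \<open>- X x\<close>, hence eventually on
    \<open>A\<close>, and it is dominated by \<open>\<bar>X x\<bar>\<close>.\<close>
  let ?d = "\<lambda>n (x, \<omega>). indicator A \<omega> * max (- partial_max X n \<omega>) (X x) :: real"
  have int_max: "integrable S (\<lambda>\<omega>. indicator A \<omega> * partial_max X n \<omega>)" for n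
    using integrable_mult_indicator[OF _ integrable_partial_max[OF X], of A n] by simp
  have nonneg: "0 \<le> (\<integral>p. ?d n p \<partial>?P)" for n
  proof -
    have "(\<integral>\<omega>. indicator A \<omega> * partial_max X n \<omega> \<partial>S)
        \<le> (\<integral>\<omega>. indicator A \<omega> * partial_max X (Suc n) \<omega> \<partial>S)"
      by (intro integral_mono int_max mult_left_mono partial_max_Suc_mono) auto
    also have "\<dots> = (\<integral>(x, \<omega>). indicator A (case_nat x \<omega>) * partial_max X (Suc n) (case_nat x \<omega>) \<partial>?P)"
      by (rule integral_cons) measurable
    also have "\<dots> = (\<integral>(x, \<omega>). indicator A \<omega> * max 0 (X x + partial_max X n \<omega>) \<partial>?P)"
      by (intro Bochner_Integration.integral_cong)
         (auto simp: space_pair_measure A_shift indicator_def simp del: partial_max.simps simp: partial_max_case_nat)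
    finally have 1: "(\<integral>\<omega>. indicator A \<omega> * partial_max X n \<omega> \<partial>S)
        \<le> (\<integral>(x, \<omega>). indicator A \<omega> * max 0 (X x + partial_max X n \<omega>) \<partial>?P)" .
    have i2: "integrable ?P (\<lambda>(x, \<omega>). indicator A \<omega> * partial_max X n \<omega>)"
      by (rule integrable_pair_snd) (rule int_max)
    have 2: "(\<integral>\<omega>. indicator A \<omega> * partial_max X n \<omega> \<partial>S) = (\<integral>(x, \<omega>). indicator A \<omega> * partial_max X n \<omega> \<partial>?P)"
      using PS.integral_fst'[OF i2] by (simp add: M.prob_space)
    have i1: "integrable ?P (\<lambda>(x, \<omega>). indicator A \<omega> * max 0 (X x + partial_max X n \<omega>))"
    proof -
      have "integrable ?P (\<lambda>p. max 0 ((case p of (x, \<omega>) \<Rightarrow> X x) + (case p of (x, \<omega>) \<Rightarrow> partial_max X n \<omega>)))"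
        by (intro Bochner_Integration.integrable_max integrable_zero Bochner_Integration.integrable_add
            integrable_pair_fst[OF X] integrable_pair_snd[OF integrable_partial_max[OF X]])
      from integrable_mult_indicator[OF _ this, of "space M \<times> A"]
      have "integrable ?P (\<lambda>p. indicator (space M \<times> A) p * max 0 ((case p of (x, \<omega>) \<Rightarrow> X x) + (case p of (x, \<omega>) \<Rightarrow> partial_max X n \<omega>)))"
        by simp
      then show ?thesis
        by (rule Bochner_Integration.integrable_cong[THEN iffD1, rotated 2])
           (auto simp: space_pair_measure indicator_def)
    qed
    have "(\<integral>p. ?d n p \<partial>?P) = (\<integral>p. (case p of (x, \<omega>) \<Rightarrow> indicator A \<omega> * max 0 (X x + partial_max X n \<omega>))
        - (case p of (x, \<omega>) \<Rightarrow> indicator A \<omega> * partial_max X n \<omega>) \<partial>?P)"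
      by (intro Bochner_Integration.integral_cong) (auto simp: indicator_def max_def)
    also have "\<dots> = (\<integral>(x, \<omega>). indicator A \<omega> * max 0 (X x + partial_max X n \<omega>) \<partial>?P)
        - (\<integral>(x, \<omega>). indicator A \<omega> * partial_max X n \<omega> \<partial>?P)"
      by (rule Bochner_Integration.integral_diff[OF i1 i2])
    finally show ?thesis using 1 2 by simp
  qed
  have lim: "(\<lambda>n. \<integral>p. ?d n p \<partial>?P) \<longlonglongrightarrow> (\<integral>(x, \<omega>). indicator A \<omega> * X x \<partial>?P)"
  proof (rule integral_dominated_convergence[where w="\<lambda>(x, \<omega>). \<bar>X x\<bar>"])
    show "integrable ?P (\<lambda>(x, \<omega>). \<bar>X x\<bar>)"
      using X by (intro integrable_pair_fst) auto
    show "AE p in ?P. (\<lambda>n. ?d n p) \<longlonglongrightarrow> (case p of (x, \<omega>) \<Rightarrow> indicator A \<omega> * X x)"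
    proof (rule AE_I2)
      fix p assume "p \<in> space ?P"
      obtain x \<omega> where p: "p = (x, \<omega>)" by fastforce
      show "(\<lambda>n. ?d n p) \<longlonglongrightarrow> (case p of (x, \<omega>) \<Rightarrow> indicator A \<omega> * X x)"
      proof (cases "\<omega> \<in> A")
        case True
        obtain b :: nat where b: "\<bar>X x\<bar> < real b" using reals_Archimedean2 by blast
        obtain n where n: "partial_max X n \<omega> > real b" using True unfolding A_def by blast
        have "eventually (\<lambda>m. ?d m p = (case p of (x, \<omega>) \<Rightarrow> indicator A \<omega> * X x)) sequentially"
          using eventually_ge_at_top[of n]
        proof eventually_elim
          case (elim m)
          then show ?case using partial_max_mono[OF elim, of X \<omega>] n b True by (auto simp: p max_def)
        qed
        then show ?thesis by (rule tendsto_eventually)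
      qed (simp add: p)
    qed
    have "\<bar>indicator A \<omega> * max (- partial_max X n \<omega>) (X x)\<bar> \<le> \<bar>X x\<bar>" for n x \<omega>
      using partial_max_nonneg[of X n \<omega>] by (auto simp: indicator_def)
    then show "AE p in ?P. norm (?d n p) \<le> (case p of (x, \<omega>) \<Rightarrow> \<bar>X x\<bar>)" for n
      by (intro AE_I2) (simp add: split_beta')
  qed measurable
  have "0 \<le> (\<integral>(x, \<omega>). indicator A \<omega> * X x \<partial>?P)"
    by (rule LIMSEQ_le_const[OF lim]) (use nonneg in auto)
  also have "(\<integral>(x, \<omega>). indicator A \<omega> * X x \<partial>?P) = measure S A * (\<integral>x. X x \<partial>M)"
  proof -
    have i: "integrable ?P (\<lambda>(x, \<omega>). indicator A \<omega> * X x)"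
    proof -
      from integrable_mult_indicator[OF _ integrable_pair_fst[OF X], of "space M \<times> A"]
      have "integrable ?P (\<lambda>p. indicator (space M \<times> A) p * (case p of (x, \<omega>) \<Rightarrow> X x))"
        by simp
      then show ?thesis
        by (rule Bochner_Integration.integrable_cong[THEN iffD1, rotated 2])
           (auto simp: space_pair_measure indicator_def)
    qed
    show ?thesis using PS.integral_fst'[OF i] by (simp add: Int_absorb1 sets.sets_into_space)
  qed
  finally have "measure S A = 0"
    using neg by (smt (verit) measure_nonneg mult_pos_neg)
  then have "A \<in> null_sets S"
    by (simp add: null_sets_def emeasure_eq_measure)
  then have "AE \<omega> in S. \<omega> \<notin> A" by (rule AE_not_in)
  then show ?thesis
    using AE_space
  proof eventually_elim
    case (elim \<omega>)
    then have "\<exists>b::nat. \<forall>n. partial_max X n \<omega> \<le> real b" by (auto simp: A_def not_less)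
    then show ?case by blast
  qed
qed

text \<open>Subtracting a centre slightly above the mean leaves steps of negative mean, whose
  partial maxima are bounded. So the sums of \<open>g\<close> stay below \<open>n\<close> times the
  centre up to a constant, which the rest of \<open>e\<close> absorbs. Countably many centres serve
  every \<open>e\<close> off one null set.\<close>

theorem slln_upper:
  fixes g :: "'a \<Rightarrow> real"
  assumes g: "integrable M g"
  shows "AE \<omega> in S. \<forall>e>0. \<forall>\<^sub>F n in sequentially. (\<Sum>s<n. g (\<omega> s)) < real n * ((\<integral>x. g x \<partial>M) + e)"
proof -
  let ?m = "\<integral>x. g x \<partial>M"
  define X where "X k x = g x - (?m + 1 / real (Suc k))" for k x
  have "AE \<omega> in S. \<exists>B. \<forall>n. partial_max (X k) n \<omega> \<le> B" for k
  proof (rule AE_partial_max_bounded)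
    show "integrable M (X k)" unfolding X_def using g by auto
    show "(\<integral>x. X k x \<partial>M) < 0"
      unfolding X_def using g by (simp add: M.prob_space)
  qed
  then have "AE \<omega> in S. \<forall>k. \<exists>B. \<forall>n. partial_max (X k) n \<omega> \<le> B" by (simp add: AE_all_countable)
  then show ?thesis
  proof eventually_elim
    case (elim \<omega>)
    show ?case
    proof (intro allI impI)
      fix e :: real assume "e > 0"
      then obtain k where k: "1 / real (Suc k) < e" using nat_approx_posE by blast
      obtain B where B: "\<And>n. partial_max (X k) n \<omega> \<le> B" using elim by blast
      define d where "d = e - 1 / real (Suc k)"
      have "d > 0" using k by (simp add: d_def)
      obtain n0 :: nat where n0: "B / d < real n0" using reals_Archimedean2 by blast
      show "\<forall>\<^sub>F n in sequentially. (\<Sum>s<n. g (\<omega> s)) < real n * (?m + e)"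
        using eventually_ge_at_top[of n0]
      proof eventually_elim
        case (elim n)
        have "(\<Sum>s<n. X k (\<omega> s)) \<le> B" using sum_le_partial_max[of "X k" \<omega> n] B[of n] by linarith
        then have "(\<Sum>s<n. g (\<omega> s)) \<le> B + real n * (?m + 1 / real (Suc k))"
          by (simp add: X_def sum_subtractf)
        moreover have "B < real n * d"
        proof -
          have "B / d < real n" using n0 elim by linarith
          then show ?thesis using \<open>d > 0\<close> by (simp add: field_simps)
        qed
        ultimately show ?case by (simp add: d_def algebra_simps)
      qed
    qed
  qed
qed

end

section \<open>Uniform laws of large numbers for i.i.d. samples\<close>

locale iid_sample = prob_space M for M :: "'w measure" +
  fixes \<mu> :: "'z measure" and zs :: "nat \<Rightarrow> 'w \<Rightarrow> 'z"
  assumes indep: "indep_vars (\<lambda>_. \<mu>) zs {1..}"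
    and distr_zs: "\<And>s. s \<ge> 1 \<Longrightarrow> distr M \<mu> (zs s) = \<mu>"
begin

lemma measurable_zs [measurable]: "s \<ge> 1 \<Longrightarrow> zs s \<in> M \<rightarrow>\<^sub>M \<mu>"
  using indep by (auto simp: indep_vars_def)

lemma zs_space: "s \<ge> 1 \<Longrightarrow> \<omega> \<in> space M \<Longrightarrow> zs s \<omega> \<in> space \<mu>"
  using measurable_space[OF measurable_zs] by blast

lemma prob_space_mu: "prob_space \<mu>"
  using prob_space_distr[OF measurable_zs[of 1]] distr_zs[of 1] by simp

sublocale mu: prob_space \<mu> by (rule prob_space_mu)

text \<open>The samples are numbered from 1 and sequence space from 0, hence the reindexing by
  \<open>Suc\<close>.\<close>

lemma distr_sequence:
  "distr M (\<Pi>\<^sub>M i\<in>UNIV. \<mu>) (\<lambda>\<omega> i. zs (Suc i) \<omega>) = (\<Pi>\<^sub>M i\<in>(UNIV::nat set). \<mu>)"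
proof -
  let ?I = "{1..} :: nat set"
  have rv: "random_variable \<mu> (zs i)" if "i \<in> ?I" for i using measurable_zs that by simp
  have 1: "distr M (\<Pi>\<^sub>M i\<in>?I. \<mu>) (\<lambda>\<omega>. \<lambda>i\<in>?I. zs i \<omega>) = (\<Pi>\<^sub>M i\<in>?I. \<mu>)"
  proof -
    have "distr M (\<Pi>\<^sub>M i\<in>?I. \<mu>) (\<lambda>\<omega>. \<lambda>i\<in>?I. zs i \<omega>) = (\<Pi>\<^sub>M i\<in>?I. distr M \<mu> (zs i))"
      using indep_vars_iff_distr_eq_PiM'[where I="?I" and M'="\<lambda>_. \<mu>" and X=zs] rv indep by auto
    also have "\<dots> = (\<Pi>\<^sub>M i\<in>?I. \<mu>)" by (intro PiM_cong) (use distr_zs in auto)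
    finally show ?thesis .
  qed
  have "(\<Pi>\<^sub>M i\<in>(UNIV::nat set). \<mu>)
      = distr (\<Pi>\<^sub>M i\<in>?I. \<mu>) (\<Pi>\<^sub>M i\<in>UNIV. \<mu>) (\<lambda>\<omega>. \<lambda>n\<in>UNIV. \<omega> (Suc n))"
    by (rule distr_PiM_reindex[symmetric]) (auto intro: prob_space_mu)
  also have "\<dots> = distr (distr M (\<Pi>\<^sub>M i\<in>?I. \<mu>) (\<lambda>\<omega>. \<lambda>i\<in>?I. zs i \<omega>)) (\<Pi>\<^sub>M i\<in>UNIV. \<mu>) (\<lambda>\<omega>. \<lambda>n\<in>UNIV. \<omega> (Suc n))"
    by (simp only: 1)
  also have "\<dots> = distr M (\<Pi>\<^sub>M i\<in>UNIV. \<mu>) ((\<lambda>\<omega>. \<lambda>n\<in>UNIV. \<omega> (Suc n)) \<circ> (\<lambda>\<omega>. \<lambda>i\<in>?I. zs i \<omega>))"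
    by (rule distr_distr) (auto intro!: measurable_restrict measurable_component_singleton rv)
  also have "(\<lambda>\<omega>. \<lambda>n\<in>UNIV. \<omega> (Suc n)) \<circ> (\<lambda>\<omega>. \<lambda>i\<in>?I. zs i \<omega>) = (\<lambda>\<omega> i. zs (Suc i) \<omega>)"
    by (auto simp: fun_eq_iff)
  finally show ?thesis ..
qed

lemma slln_upper_sample:
  fixes g :: "'z \<Rightarrow> real"
  assumes "integrable \<mu> g"
  shows "AE \<omega> in M. \<forall>e>0. \<forall>\<^sub>F n in sequentially. (\<Sum>s=1..n. g (zs s \<omega>)) < real n * ((\<integral>z. g z \<partial>\<mu>) + e)"
proof -
  interpret sequence_space \<mu>
    by unfold_locales
  have meas: "(\<lambda>\<omega> i. zs (Suc i) \<omega>) \<in> M \<rightarrow>\<^sub>M (\<Pi>\<^sub>M i\<in>(UNIV::nat set). \<mu>)"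
    by (intro measurable_PiM_single') (auto simp: space_PiM zs_space)
  from slln_upper[OF assms]
  have "AE \<omega> in distr M (\<Pi>\<^sub>M i\<in>(UNIV::nat set). \<mu>) (\<lambda>\<omega> i. zs (Suc i) \<omega>).
      \<forall>e>0. \<forall>\<^sub>F n in sequentially. (\<Sum>s<n. g (\<omega> s)) < real n * ((\<integral>x. g x \<partial>\<mu>) + e)"
    by (simp only: distr_sequence)
  from AE_distrD[OF meas this] show ?thesis
    by (simp add: sum.atLeast1_atMost_eq)
qed

text \<open>A pathwise form of the uniform law: all convergent \<open>w\<close> and all diverging
  sample sizes \<open>n\<close> are quantified inside the event, so that random iterates may be
  inserted for \<open>w\<close>. Sums in place of averages avoid division by
  \<open>n i\<close>.\<close>

definition upper_ulln :: "'b::topological_space set \<Rightarrow> ('b \<Rightarrow> 'z \<Rightarrow> real) \<Rightarrow> 'w \<Rightarrow> bool" where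
  "upper_ulln K f \<omega> \<longleftrightarrow> (\<forall>w v n. (\<forall>i::nat. w i \<in> K) \<longrightarrow> v \<in> K \<longrightarrow> w \<longlonglongrightarrow> v \<longrightarrow>
    filterlim n at_top sequentially \<longrightarrow>
    (\<forall>e>0. \<forall>\<^sub>F i in sequentially.
      (\<Sum>s=1..n i. f (w i) (zs s \<omega>)) < real (n i) * ((\<integral>z. f v z \<partial>\<mu>) + e)))"

lemma AE_sample:
  assumes "AE z in \<mu>. Q z"
  shows "AE \<omega> in M. \<forall>s\<ge>1. Q (zs s \<omega>)"
proof -
  have "AE \<omega> in M. s \<ge> 1 \<longrightarrow> Q (zs s \<omega>)" for s
  proof (cases "s \<ge> 1")
    case True
    then have "AE z in distr M \<mu> (zs s). Q z" unfolding distr_zs[OF True] using assms by simp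
    from AE_distrD[OF measurable_zs[OF True] this] show ?thesis by simp
  qed simp
  then show ?thesis by (simp add: AE_all_countable)
qed

text \<open>
  Balls with centre in a countable dense set and radius \<open>1 / (m + 1)\<close> reduce the claim to countably many
  strong laws for the local suprema of \<open>f\<close>.
\<close>
theorem usc_ulln:
  fixes f :: "'b::euclidean_space \<Rightarrow> 'z \<Rightarrow> real"
  assumes usc: "\<And>z. z \<in> space \<mu> \<Longrightarrow> usc_on K (\<lambda>w. f w z)"
    and env: "\<And>w z. w \<in> K \<Longrightarrow> z \<in> space \<mu> \<Longrightarrow> \<bar>f w z\<bar> \<le> G z"
    and G: "integrable \<mu> G"
    and meas: "\<And>w. w \<in> K \<Longrightarrow> f w \<in> borel_measurable \<mu>"
    and sup: "\<And>q r. r > 0 \<Longrightarrow> K \<inter> ball q r \<noteq> {} \<Longrightarrow>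
       (\<lambda>z. SUP w\<in>K \<inter> ball q r. f w z) \<in> borel_measurable (completion \<mu>)"
  shows "AE \<omega> in M. upper_ulln K f \<omega>"
proof -
  obtain D :: "'b set" where D: "countable D" "\<And>X. open X \<Longrightarrow> X \<noteq> {} \<Longrightarrow> \<exists>d\<in>D. d \<in> X"
    using countable_dense_setE by blast
  \<comment> \<open>Balls that miss \<open>K\<close> are left out, since a supremum over the empty
    set carries no information.\<close>
  define J where "J = {(q, m::nat). q \<in> D \<and> K \<inter> ball q (1 / real (Suc m)) \<noteq> {}}"
  have "countable J"
    by (rule countable_subset[of _ "D \<times> UNIV"]) (auto simp: J_def D)
  define F where "F = (\<lambda>(q, m) z. SUP w\<in>K \<inter> ball q (1 / real (Suc m)). f w z)"
  have F_upper: "f w z \<le> F (q, m) z" if "w \<in> K" "w \<in> ball q (1 / real (Suc m))" "z \<in> space \<mu>" for w q m z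
    unfolding F_def prod.case
  proof (rule cSUP_upper)
    show "bdd_above ((\<lambda>w. f w z) ` (K \<inter> ball q (1 / real (Suc m))))"
      using env that(3) by (auto intro!: bdd_aboveI[of _ "G z"] simp: abs_le_iff)
  qed (use that in auto)
  have F_least: "F (q, m) z \<le> c" if "(q, m) \<in> J" "\<And>w. w \<in> K \<Longrightarrow> w \<in> ball q (1 / real (Suc m)) \<Longrightarrow> f w z \<le> c"
    for q m z c
    unfolding F_def prod.case by (rule cSUP_least) (use that in \<open>auto simp: J_def\<close>)
  have F_bound: "\<bar>F j z\<bar> \<le> G z" if "j \<in> J" "z \<in> space \<mu>" for j z
  proof -
    obtain q m where j: "j = (q, m)" by fastforce
    have "K \<inter> ball q (1 / real (Suc m)) \<noteq> {}" using that(1) by (simp add: J_def j)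
    then obtain w where w: "w \<in> K" "w \<in> ball q (1 / real (Suc m))" by blast
    have "F j z \<le> G z" using that env by (auto simp: j abs_le_iff intro!: F_least)
    moreover have "- G z \<le> F j z" using F_upper[OF w that(2)] env[OF w(1) that(2)] by (simp add: j)
    ultimately show ?thesis by simp
  qed
  \<comment> \<open>The suprema are known to be measurable only for the completion. The strong law
    is applied to versions \<open>u j\<close> measurable for \<mu>, which agree with them almost
    everywhere and hence, by \<open>AE_sample\<close>, at all samples.\<close>
  have "\<exists>u\<in>borel_measurable \<mu>. AE z in \<mu>. F j z = u z" if "j \<in> J" for j
  proof (rule completion_ex_borel_measurable_real)
    obtain q m where j: "j = (q, m)" by fastforce
    have "K \<inter> ball q (1 / real (Suc m)) \<noteq> {}" using that by (simp add: J_def j)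
    from sup[OF _ this] show "F j \<in> borel_measurable (completion \<mu>)" by (simp add: F_def j)
  qed
  then obtain u where u: "\<And>j. j \<in> J \<Longrightarrow> u j \<in> borel_measurable \<mu>" "\<And>j. j \<in> J \<Longrightarrow> AE z in \<mu>. F j z = u j z"
    by metis
  have u_bound: "AE z in \<mu>. \<bar>u j z\<bar> \<le> G z" if "j \<in> J" for j
    using u(2)[OF that] AE_space by eventually_elim (use F_bound[OF that] in force)
  have u_int: "integrable \<mu> (u j)" if "j \<in> J" for j
    using u_bound[OF that] by (intro Bochner_Integration.integrable_bound[OF G u(1)[OF that]]) auto

  \<comment> \<open>Upper semicontinuity makes the suprema over balls shrinking to \<open>v\<close>
    converge to \<open>f v z\<close>, and dominated convergence carries this over to the
    expectations.\<close>
  have approx: "\<exists>(q, m)\<in>J. v \<in> ball q (1 / real (Suc m)) \<and> (\<integral>z. u (q, m) z \<partial>\<mu>) < (\<integral>z. f v z \<partial>\<mu>) + e"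
    if v: "v \<in> K" and e: "e > 0" for v e
  proof -
    have "\<exists>d\<in>D. d \<in> ball v (1 / real (Suc m))" for m by (intro D(2)) auto
    then obtain q where q: "\<And>m. q m \<in> D" "\<And>m. dist v (q m) < 1 / real (Suc m)"
      by (metis mem_ball)
    have qJ: "(q m, m) \<in> J" for m using q v by (auto simp: J_def dist_commute)
    have "(\<lambda>m. \<integral>z. u (q m, m) z \<partial>\<mu>) \<longlonglongrightarrow> (\<integral>z. f v z \<partial>\<mu>)"
    proof (rule integral_dominated_convergence[OF _ _ G])
      show "AE z in \<mu>. norm (u (q m, m) z) \<le> G z" for m using u_bound[OF qJ] by simp
      have "AE z in \<mu>. \<forall>m. F (q m, m) z = u (q m, m) z"
        using u(2)[OF qJ] by (simp add: AE_all_countable)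
      then show "AE z in \<mu>. (\<lambda>m. u (q m, m) z) \<longlonglongrightarrow> f v z"
        using AE_space
      proof eventually_elim
        case (elim z)
        have "(\<lambda>m. F (q m, m) z) \<longlonglongrightarrow> f v z"
        proof (rule order_tendstoI)
          fix a assume "a < f v z"
          then show "\<forall>\<^sub>F m in sequentially. a < F (q m, m) z"
          proof (intro always_eventually allI)
            fix m
            have "v \<in> ball (q m) (1 / real (Suc m))" using q(2)[of m] by (simp only: mem_ball dist_commute)
            from F_upper[OF v this elim(2)] \<open>a < f v z\<close> show "a < F (q m, m) z" by linarith
          qed
        next
          fix a assume a: "f v z < a"
          define c where "c = (f v z + a) / 2"
          have c: "f v z < c" "c < a" using a by (auto simp: c_def)
          from usc[OF elim(2)] v c(1) have "\<forall>\<^sub>F y in at v within K. f y z < c"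
            unfolding usc_on_def by blast
          then obtain d where d: "d > 0" "\<And>y. y \<in> K \<Longrightarrow> y \<noteq> v \<Longrightarrow> dist y v < d \<Longrightarrow> f y z < c"
            unfolding eventually_at by blast
          obtain m0 :: nat where m0: "2 / d < real m0" using reals_Archimedean2 by blast
          show "\<forall>\<^sub>F m in sequentially. F (q m, m) z < a"
            using eventually_ge_at_top[of m0]
          proof eventually_elim
            case (elim m)
            \<comment> \<open>Two radii: from \<open>y\<close> to the centre \<open>q m\<close>, and
              from there to \<open>v\<close>.\<close>
            have "2 / real (Suc m) < d"
            proof -
              have "2 / d < real (Suc m)" using m0 elim by simp
              then show ?thesis using d(1) by (simp add: field_simps)
            qed
            have "F (q m, m) z \<le> c"
            proof (rule F_least[OF qJ])
              fix y assume y: "y \<in> K" "y \<in> ball (q m) (1 / real (Suc m))"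
              have "dist y v \<le> dist y (q m) + dist v (q m)" by (rule dist_triangle2)
              also have "\<dots> < 2 / real (Suc m)" using y(2) q(2)[of m] by (simp add: dist_commute)
              finally have "dist y v < d" using \<open>2 / real (Suc m) < d\<close> by simp
              then show "f y z \<le> c" using d(2)[OF y(1)] c(1) by (cases "y = v") force+
            qed
            then show ?case using c(2) by simp
          qed
        qed
        then show ?case using elim(1) by simp
      qed
    qed (use meas[OF v] u(1)[OF qJ] in auto)
    then have "\<forall>\<^sub>F m in sequentially. (\<integral>z. u (q m, m) z \<partial>\<mu>) < (\<integral>z. f v z \<partial>\<mu>) + e"
      using e by (intro order_tendstoD(2)) auto
    then obtain m where "(\<integral>z. u (q m, m) z \<partial>\<mu>) < (\<integral>z. f v z \<partial>\<mu>) + e"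
      using eventually_happens'[OF sequentially_bot] by blast
    then show ?thesis using qJ[of m] q(2)[of m] by (intro bexI[of _ "(q m, m)"]) (auto simp: dist_commute)
  qed

  have "AE \<omega> in M. \<forall>j\<in>J. (\<forall>e>0. \<forall>\<^sub>F n in sequentially.
        (\<Sum>s=1..n. u j (zs s \<omega>)) < real n * ((\<integral>z. u j z \<partial>\<mu>) + e)) \<and> (\<forall>s\<ge>1. F j (zs s \<omega>) = u j (zs s \<omega>))"
  proof (rule AE_ball_countable'[OF _ \<open>countable J\<close>])
    fix j assume "j \<in> J"
    from slln_upper_sample[OF u_int[OF this]] AE_sample[OF u(2)[OF this]]
    show "AE \<omega> in M. (\<forall>e>0. \<forall>\<^sub>F n in sequentially.
        (\<Sum>s=1..n. u j (zs s \<omega>)) < real n * ((\<integral>z. u j z \<partial>\<mu>) + e)) \<and> (\<forall>s\<ge>1. F j (zs s \<omega>) = u j (zs s \<omega>))"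
      by eventually_elim blast
  qed
  then show ?thesis
    using AE_space
  proof eventually_elim
    case (elim \<omega>)
    show ?case
      unfolding upper_ulln_def
    proof (intro allI impI)
      fix w :: "nat \<Rightarrow> 'b" and v and n :: "nat \<Rightarrow> nat" and e :: real
      assume w: "\<forall>i. w i \<in> K" "w \<longlonglongrightarrow> v" and v: "v \<in> K"
        and n: "filterlim n at_top sequentially" and e: "e > 0"
      obtain q m where qm: "(q, m) \<in> J" "v \<in> ball q (1 / real (Suc m))"
        "(\<integral>z. u (q, m) z \<partial>\<mu>) < (\<integral>z. f v z \<partial>\<mu>) + e / 2"
        using approx[OF v, of "e / 2"] e by auto
      have "\<forall>\<^sub>F n in sequentially. (\<Sum>s=1..n. u (q, m) (zs s \<omega>)) < real n * ((\<integral>z. u (q, m) z \<partial>\<mu>) + e / 2)"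
        using elim(1) qm(1) e by (meson half_gt_zero)
      then have "\<forall>\<^sub>F i in sequentially. (\<Sum>s=1..n i. u (q, m) (zs s \<omega>)) < real (n i) * ((\<integral>z. u (q, m) z \<partial>\<mu>) + e / 2)"
        using n by (rule eventually_compose_filterlim)
      moreover have "\<forall>\<^sub>F i in sequentially. w i \<in> ball q (1 / real (Suc m))"
        using w(2) qm(2) by (intro topological_tendstoD) auto
      ultimately show "\<forall>\<^sub>F i in sequentially.
          (\<Sum>s=1..n i. f (w i) (zs s \<omega>)) < real (n i) * ((\<integral>z. f v z \<partial>\<mu>) + e)"
      proof eventually_elim
        case (elim i)
        have "(\<Sum>s=1..n i. f (w i) (zs s \<omega>)) \<le> (\<Sum>s=1..n i. u (q, m) (zs s \<omega>))"
        proof (rule sum_mono)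
          fix s assume s: "s \<in> {1..n i}"
          then have "f (w i) (zs s \<omega>) \<le> F (q, m) (zs s \<omega>)"
            using w(1) elim(2) zs_space \<open>\<omega> \<in> space M\<close> by (intro F_upper) auto
          also have "\<dots> = u (q, m) (zs s \<omega>)"
            using \<open>\<forall>j\<in>J. _\<close> qm(1) s by auto
          finally show "f (w i) (zs s \<omega>) \<le> u (q, m) (zs s \<omega>)" .
        qed
        also have "\<dots> < real (n i) * ((\<integral>z. u (q, m) z \<partial>\<mu>) + e / 2)" by (rule elim(1))
        also have "\<dots> \<le> real (n i) * ((\<integral>z. f v z \<partial>\<mu>) + e)"
          using qm(3) by (intro mult_left_mono) auto
        finally show ?case .
      qed
    qed
  qed
qed

text \<open>For continuous \<open>f\<close> the supremum over the part of \<open>K\<close> in a ball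
  equals the one over a countable dense subset, which makes it measurable without
  projections.\<close>

lemma usc_ulln_continuous:
  fixes f :: "'b::euclidean_space \<Rightarrow> 'z \<Rightarrow> real"
  assumes cont: "\<And>z. z \<in> space \<mu> \<Longrightarrow> continuous_on K (\<lambda>w. f w z)"
    and env: "\<And>w z. w \<in> K \<Longrightarrow> z \<in> space \<mu> \<Longrightarrow> \<bar>f w z\<bar> \<le> G z"
    and G: "integrable \<mu> G"
    and meas: "\<And>w. w \<in> K \<Longrightarrow> f w \<in> borel_measurable \<mu>"
  shows "AE \<omega> in M. upper_ulln K f \<omega>"
proof (rule usc_ulln[OF _ env G meas])
  fix z assume "z \<in> space \<mu>"
  then show "usc_on K (\<lambda>w. f w z)"
    unfolding usc_on_def
    by (intro ballI allI impI order_tendstoD(2)) (use cont in \<open>auto simp: continuous_on_def\<close>)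
next
  fix q and r :: real assume "r > 0" and ne: "K \<inter> ball q r \<noteq> {}"
  obtain T where T: "countable T" "T \<subseteq> K \<inter> ball q r" "K \<inter> ball q r \<subseteq> closure T"
    using separable by blast
  have "T \<noteq> {}" using ne T(3) by auto
  have bdd: "bdd_above ((\<lambda>w. f w z) ` (K \<inter> ball q r))" if "z \<in> space \<mu>" for z
    using env that by (auto intro!: bdd_aboveI[of _ "G z"] simp: abs_le_iff)
  have bddT: "bdd_above ((\<lambda>w. f w z) ` T)" if "z \<in> space \<mu>" for z
    by (rule bdd_above_mono[OF bdd[OF that]]) (use T(2) in auto)
  have "(SUP w\<in>K \<inter> ball q r. f w z) = (SUP w\<in>T. f w z)" if z: "z \<in> space \<mu>" for z
  proof (rule antisym)
    show "(SUP w\<in>K \<inter> ball q r. f w z) \<le> (SUP w\<in>T. f w z)"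
    proof (rule cSUP_least[OF ne])
      fix w assume w: "w \<in> K \<inter> ball q r"
      then obtain t where t: "\<And>i. t i \<in> T" "t \<longlonglongrightarrow> w" using T(3) closure_sequential by blast
      have "(\<lambda>i. f (t i) z) \<longlonglongrightarrow> f w z"
      proof (rule continuous_on_tendsto_compose[OF cont[OF z] t(2)])
        show "\<forall>\<^sub>F i in sequentially. t i \<in> K"
          using t(1) T(2) by (intro always_eventually) blast
      qed (use w in blast)
      moreover have "f (t i) z \<le> (SUP w\<in>T. f w z)" for i
        using t(1) bddT[OF z] by (intro cSUP_upper) auto
      ultimately show "f w z \<le> (SUP w\<in>T. f w z)" by (intro LIMSEQ_le_const2) auto
    qed
    show "(SUP w\<in>T. f w z) \<le> (SUP w\<in>K \<inter> ball q r. f w z)"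
      using T(2) \<open>T \<noteq> {}\<close> bdd[OF z] by (intro cSUP_subset_mono) auto
  qed
  moreover have "(\<lambda>z. SUP w\<in>T. f w z) \<in> borel_measurable \<mu>"
    using T(1,2) meas bddT by (intro borel_measurable_cSUP) auto
  ultimately have "(\<lambda>z. SUP w\<in>K \<inter> ball q r. f w z) \<in> borel_measurable \<mu>"
    by (simp cong: measurable_cong)
  then show "(\<lambda>z. SUP w\<in>K \<inter> ball q r. f w z) \<in> borel_measurable (completion \<mu>)"
    by (rule measurable_completion)
qed

text \<open>For merely semicontinuous \<open>f\<close> local suprema are measurable only after completion.\<close>
lemma usc_ulln_joint:
  fixes f :: "'b::euclidean_space \<Rightarrow> 'z \<Rightarrow> real"
  assumes usc: "\<And>z. z \<in> space \<mu> \<Longrightarrow> usc_on K (\<lambda>w. f w z)"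
    and env: "\<And>w z. w \<in> K \<Longrightarrow> z \<in> space \<mu> \<Longrightarrow> \<bar>f w z\<bar> \<le> G z"
    and G: "integrable \<mu> G"
    and K: "K \<in> sets borel"
    and meas: "(\<lambda>(z, w). f w z) \<in> borel_measurable (\<mu> \<Otimes>\<^sub>M restrict_space borel K)"
  shows "AE \<omega> in M. upper_ulln K f \<omega>"
proof (rule usc_ulln[OF usc env G])
  fix w assume "w \<in> K"
  then have "(\<lambda>z. (z, w)) \<in> \<mu> \<rightarrow>\<^sub>M \<mu> \<Otimes>\<^sub>M restrict_space borel K"
    by (intro measurable_Pair) (auto simp: space_restrict_space)
  from measurable_compose[OF this meas] show "f w \<in> borel_measurable \<mu>" by simp
next
  fix q and r :: real assume "r > 0" and ne: "K \<inter> ball q r \<noteq> {}"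
  let ?F = "\<lambda>z. SUP w\<in>K \<inter> ball q r. f w z"
  have bdd: "bdd_above ((\<lambda>w. f w z) ` (K \<inter> ball q r))" if "z \<in> space \<mu>" for z
    using env that by (auto intro!: bdd_aboveI[of _ "G z"] simp: abs_le_iff)
  have "{z \<in> space (completion \<mu>). c < ?F z} \<in> sets (completion \<mu>)" for c
  proof -
    \<comment> \<open>The superlevel set of the local supremum is the projection of the part of
      \<open>E\<close> over the ball; this is where \<open>measurable_projection\<close>
      enters.\<close>
    define E where "E = {p \<in> space (\<mu> \<Otimes>\<^sub>M restrict_space borel K). c < (case p of (z, w) \<Rightarrow> f w z)}"
    have "E \<in> sets (\<mu> \<Otimes>\<^sub>M restrict_space borel K)"
      unfolding E_def by (rule borel_measurable_less[OF borel_measurable_const meas, unfolded pred_def])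
    moreover have "sets (\<mu> \<Otimes>\<^sub>M restrict_space borel K) \<subseteq> sets (\<mu> \<Otimes>\<^sub>M borel)"
      by (rule sets_pair_in_sets) (auto simp: sets_restrict_space_iff K intro!: pair_measureI)
    ultimately have "E \<in> sets (\<mu> \<Otimes>\<^sub>M borel)" by blast
    then have "E \<inter> (space \<mu> \<times> ball q r) \<in> sets (\<mu> \<Otimes>\<^sub>M borel)"
      by (intro sets.Int pair_measureI) auto
    from measurable_projection[OF _ this]
    have "fst ` (E \<inter> (space \<mu> \<times> ball q r)) \<in> sets (completion \<mu>)"
      by (simp add: mu.finite_measure_axioms)
    also have "fst ` (E \<inter> (space \<mu> \<times> ball q r)) = {z \<in> space (completion \<mu>). c < ?F z}"
    proof (intro equalityI subsetI)
      fix z assume "z \<in> fst ` (E \<inter> (space \<mu> \<times> ball q r))"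
      then obtain w where w: "z \<in> space \<mu>" "w \<in> K \<inter> ball q r" "c < f w z"
        by (auto simp: E_def space_pair_measure space_restrict_space)
      then show "z \<in> {z \<in> space (completion \<mu>). c < ?F z}"
        using less_cSUP_iff[OF ne bdd[OF w(1)], of c] by auto
    next
      fix z assume z: "z \<in> {z \<in> space (completion \<mu>). c < ?F z}"
      then have sp: "z \<in> space \<mu>" by simp
      then obtain w where w: "w \<in> K \<inter> ball q r" "c < f w z"
        using z less_cSUP_iff[OF ne bdd[OF sp], of c] by auto
      then have "(z, w) \<in> E \<inter> (space \<mu> \<times> ball q r)"
        using sp by (auto simp: E_def space_pair_measure space_restrict_space)
      then show "z \<in> fst ` (E \<inter> (space \<mu> \<times> ball q r))" by force
    qed
    finally show ?thesis .
  qed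
  then show "?F \<in> borel_measurable (completion \<mu>)"
    by (subst borel_measurable_iff_greater) simp
qed

end

section \<open>Convex functions and stationarity on polytopes\<close>

lemma has_derivative_gradient:
  fixes f :: "'a::euclidean_space \<Rightarrow> real"
  assumes "f differentiable (at x)"
  shows "(f has_derivative (\<lambda>h. h \<bullet> gradient f x)) (at x)"
proof -
  obtain f' where f': "(f has_derivative f') (at x)"
    using assms unfolding differentiable_def by blast
  then interpret linear f' by (rule has_derivative_linear)
  have "f' h = h \<bullet> (\<Sum>b\<in>Basis. f' b *\<^sub>R b)" for h
  proof -
    have "f' h = f' (\<Sum>b\<in>Basis. (h \<bullet> b) *\<^sub>R b)" by (simp add: euclidean_representation)
    then show ?thesis by (simp add: sum scale inner_sum_right mult.commute)
  qed
  then have D: "GDERIV f x :> (\<Sum>b\<in>Basis. f' b *\<^sub>R b)"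
    using f' unfolding gderiv_def by (metis (no_types, lifting) ext)
  have "GDERIV f x :> gradient f x"
    unfolding gradient_def
  proof (rule theI[where P="\<lambda>D. GDERIV f x :> D", OF D])
    fix D' assume "GDERIV f x :> D'"
    with D have "(\<lambda>h. h \<bullet> D') = (\<lambda>h. h \<bullet> (\<Sum>b\<in>Basis. f' b *\<^sub>R b))"
      unfolding gderiv_def by (rule has_derivative_unique[rotated])
    then show "D' = (\<Sum>b\<in>Basis. f' b *\<^sub>R b)" by (metis vector_eq_ldot inner_commute)
  qed
  then show ?thesis by (simp add: gderiv_def)
qed

lemma gradient_line_derivative:
  fixes f :: "'a::euclidean_space \<Rightarrow> real"
  assumes "f differentiable (at x)"
  shows "((\<lambda>t. (f (x + t *\<^sub>R d) - f x) / t) \<longlongrightarrow> gradient f x \<bullet> d) (at 0)"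
proof -
  have 1: "((\<lambda>t. x + t *\<^sub>R d) has_derivative (\<lambda>t. t *\<^sub>R d)) (at 0)"
    by (auto intro!: derivative_eq_intros)
  have 2: "(f has_derivative (\<lambda>h. h \<bullet> gradient f x)) (at (x + 0 *\<^sub>R d))"
    using has_derivative_gradient[OF assms] by simp
  have "((\<lambda>t. f (x + t *\<^sub>R d)) has_derivative (\<lambda>t. (t *\<^sub>R d) \<bullet> gradient f x)) (at 0)"
    using has_derivative_compose[OF 1 2] by simp
  then have "((\<lambda>t. f (x + t *\<^sub>R d)) has_field_derivative (gradient f x \<bullet> d)) (at 0)"
    unfolding has_field_derivative_def by (rule has_derivative_eq_rhs) (auto simp: inner_commute)
  then show ?thesis by (simp add: DERIV_def)
qed

lemma convex_on_ge_tangent: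
  fixes f :: "'a::euclidean_space \<Rightarrow> real"
  assumes f: "convex_on S f" and x: "x \<in> S" and y: "y \<in> S" and diff: "f differentiable (at x)"
  shows "gradient f x \<bullet> (y - x) \<le> f y - f x"
proof (rule tendsto_upperbound)
  show "((\<lambda>t. (f (x + t *\<^sub>R (y - x)) - f x) / t) \<longlongrightarrow> gradient f x \<bullet> (y - x)) (at_right 0)"
    using gradient_line_derivative[OF diff] by (rule tendsto_mono[rotated]) (simp add: at_le)
  show "\<forall>\<^sub>F t in at_right 0. (f (x + t *\<^sub>R (y - x)) - f x) / t \<le> f y - f x"
    using eventually_at_right_less[of 0] eventually_at_right_real[of 0 1, simplified]
  proof eventually_elim
    case (elim t)
    have "x + t *\<^sub>R (y - x) = (1 - t) *\<^sub>R x + t *\<^sub>R y" by (simp add: algebra_simps)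
    then have "f (x + t *\<^sub>R (y - x)) \<le> (1 - t) * f x + t * f y"
      using f x y elim unfolding convex_on_def by simp
    then show ?case using elim by (simp add: field_simps)
  qed
qed simp

text \<open>For fixed \<open>t\<close> the tangent inequality bounds the directional derivative at
  nearby points by a difference quotient that is continuous in base point and direction. At the
  limit point this quotient is below \<open>a\<close> for small \<open>t\<close>. So convexity
  yields upper semicontinuity of the directional derivative from differentiability alone.\<close>

lemma eventually_gradient_inner_less:
  fixes f :: "'a::euclidean_space \<Rightarrow> real" and y d :: "nat \<Rightarrow> 'a"
  assumes f: "convex_on S f" and "open S" and cont: "continuous_on S f"
    and diff: "\<And>x. x \<in> S \<Longrightarrow> f differentiable (at x)"
    and y: "y \<longlonglongrightarrow> y0" "y0 \<in> S" and d: "d \<longlonglongrightarrow> d0" and a: "gradient f y0 \<bullet> d0 < a"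
  shows "\<forall>\<^sub>F n in sequentially. gradient f (y n) \<bullet> d n < a"
proof -
  have "((\<lambda>t. (f (y0 + t *\<^sub>R d0) - f y0) / t) \<longlongrightarrow> gradient f y0 \<bullet> d0) (at_right 0)"
    using gradient_line_derivative[OF diff[OF y(2)]] by (rule tendsto_mono[rotated]) (simp add: at_le)
  then have "\<forall>\<^sub>F t in at_right 0. (f (y0 + t *\<^sub>R d0) - f y0) / t < a"
    using a by (rule order_tendstoD)
  moreover have "((\<lambda>t. y0 + t *\<^sub>R d0) \<longlongrightarrow> y0 + 0 *\<^sub>R d0) (at_right (0::real))"
    by (intro tendsto_intros)
  then have "\<forall>\<^sub>F t in at_right 0. y0 + t *\<^sub>R d0 \<in> S"
    using y(2) \<open>open S\<close> by (intro topological_tendstoD) auto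
  ultimately have "\<forall>\<^sub>F t in at_right 0. (f (y0 + t *\<^sub>R d0) - f y0) / t < a \<and> y0 + t *\<^sub>R d0 \<in> S \<and> 0 < t"
    using eventually_at_right_less[of "0::real"] by eventually_elim auto
  then obtain t :: real where t: "(f (y0 + t *\<^sub>R d0) - f y0) / t < a" "y0 + t *\<^sub>R d0 \<in> S" "0 < t"
    using eventually_happens trivial_limit_at_right_real by blast
  have lim: "(\<lambda>n. y n + t *\<^sub>R d n) \<longlonglongrightarrow> y0 + t *\<^sub>R d0" using y(1) d by (intro tendsto_intros)
  have fc: "isCont f z" if "z \<in> S" for z
    using cont \<open>open S\<close> that by (simp add: continuous_on_eq_continuous_at)
  have "(\<lambda>n. (f (y n + t *\<^sub>R d n) - f (y n)) / t) \<longlonglongrightarrow> (f (y0 + t *\<^sub>R d0) - f y0) / t"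
    using isCont_tendsto_compose[OF fc[OF t(2)] lim] isCont_tendsto_compose[OF fc[OF y(2)] y(1)] t(3)
    by (intro tendsto_intros) auto
  then have "\<forall>\<^sub>F n in sequentially. (f (y n + t *\<^sub>R d n) - f (y n)) / t < a"
    using t(1) by (rule order_tendstoD)
  moreover have "\<forall>\<^sub>F n in sequentially. y n + t *\<^sub>R d n \<in> S"
    using lim t(2) \<open>open S\<close> by (intro topological_tendstoD)
  moreover have "\<forall>\<^sub>F n in sequentially. y n \<in> S"
    using y \<open>open S\<close> by (intro topological_tendstoD)
  ultimately show ?thesis
  proof eventually_elim
    case (elim n)
    have "gradient f (y n) \<bullet> (t *\<^sub>R d n) \<le> f (y n + t *\<^sub>R d n) - f (y n)"
      using convex_on_ge_tangent[OF f elim(3,2) diff[OF elim(3)]] by simp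
    then have "gradient f (y n) \<bullet> d n \<le> (f (y n + t *\<^sub>R d n) - f (y n)) / t"
      using t(3) by (simp add: field_simps)
    then show ?case using elim(1) by simp
  qed
qed

text \<open>The directional derivative is linear in the direction, so upper semicontinuity for a
  direction and for its negative together give continuity.\<close>

lemma continuous_on_linearization:
  fixes f :: "'a::euclidean_space \<Rightarrow> 'b \<Rightarrow> real"
  assumes f: "convex_on S (\<lambda>u. f u z)" and "open S" and cont: "continuous_on S (\<lambda>u. f u z)"
    and diff: "\<And>x. x \<in> S \<Longrightarrow> (\<lambda>u. f u z) differentiable (at x)"
  shows "continuous_on (UNIV \<times> S) (\<lambda>(x, y). linearization f x z y)"
proof (rule continuous_on_sequentiallyI)
  fix u :: "nat \<Rightarrow> 'a \<times> 'a" and a assume u: "\<forall>n. u n \<in> UNIV \<times> S" and a: "a \<in> UNIV \<times> S" "u \<longlonglongrightarrow> a"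
  obtain x0 y0 where a_eq: "a = (x0, y0)" by fastforce
  define x y where "x n = fst (u n)" and "y n = snd (u n)" for n
  have x: "x \<longlonglongrightarrow> x0" and y: "y \<longlonglongrightarrow> y0"
    using tendsto_fst[OF a(2)] tendsto_snd[OF a(2)] unfolding x_def y_def a_eq by simp_all
  have y0: "y0 \<in> S" using a by (simp add: a_eq)
  let ?g = "gradient (\<lambda>u. f u z)"
  have "(\<lambda>n. ?g (y n) \<bullet> (x n - y n)) \<longlonglongrightarrow> ?g y0 \<bullet> (x0 - y0)"
  proof (rule order_tendstoI)
    fix c assume "?g y0 \<bullet> (x0 - y0) < c"
    then show "\<forall>\<^sub>F n in sequentially. ?g (y n) \<bullet> (x n - y n) < c"
      by (intro eventually_gradient_inner_less[OF f \<open>open S\<close> cont diff y y0])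
         (use x y in \<open>auto intro!: tendsto_intros\<close>)
  next
    fix c assume c: "c < ?g y0 \<bullet> (x0 - y0)"
    have "\<forall>\<^sub>F n in sequentially. ?g (y n) \<bullet> (y n - x n) < - c"
      by (rule eventually_gradient_inner_less[OF f \<open>open S\<close> cont diff y y0, where ?d0.0 = "y0 - x0"])
         (use x y c in \<open>auto intro!: tendsto_intros simp: inner_diff_right\<close>)
    then show "\<forall>\<^sub>F n in sequentially. c < ?g (y n) \<bullet> (x n - y n)"
      by eventually_elim (simp add: inner_diff_right)
  qed
  moreover have "(\<lambda>n. f (y n) z) \<longlonglongrightarrow> f y0 z"
    by (rule continuous_on_tendsto_compose[OF cont y y0]) (use u in \<open>auto simp: y_def mem_Times_iff\<close>)
  ultimately have "(\<lambda>n. linearization f (x n) z (y n)) \<longlonglongrightarrow> linearization f x0 z y0"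
    unfolding linearization_def by (rule tendsto_add[rotated])
  then show "(\<lambda>n. case u n of (x, y) \<Rightarrow> linearization f x z y) \<longlonglongrightarrow> (case a of (x, y) \<Rightarrow> linearization f x z y)"
    by (simp add: a_eq x_def y_def split_beta')
qed

text \<open>The gradient term is a pointwise limit of difference quotients of the measurable
  functions \<open>f x\<close>, taken at points of \<open>S\<close> near \<open>y\<close>;
  \<open>x\<close> itself may lie outside \<open>S\<close>.\<close>

lemma borel_measurable_linearization:
  fixes f :: "'a::euclidean_space \<Rightarrow> 'b \<Rightarrow> real"
  assumes "open S" and y: "y \<in> S" and meas: "\<And>x. x \<in> S \<Longrightarrow> f x \<in> borel_measurable M"
    and diff: "\<And>z. z \<in> space M \<Longrightarrow> (\<lambda>u. f u z) differentiable (at y)"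
  shows "(\<lambda>z. linearization f x z y) \<in> borel_measurable M"
proof -
  let ?d = "x - y"
  have "((\<lambda>t. y + t *\<^sub>R ?d) \<longlongrightarrow> y + 0 *\<^sub>R ?d) (at_right (0::real))"
    by (intro tendsto_intros)
  then have "\<forall>\<^sub>F t in at_right 0. y + t *\<^sub>R ?d \<in> S"
    using y \<open>open S\<close> by (intro topological_tendstoD) auto
  then obtain b where b: "b > 0" "\<And>t. 0 < t \<Longrightarrow> t < b \<Longrightarrow> y + t *\<^sub>R ?d \<in> S"
    unfolding eventually_at_right_field by blast
  \<comment> \<open>With \<open>n + 2\<close> the first step is \<open>b / 2\<close>, strictly below
    \<open>b\<close>.\<close>
  define t where "t n = b / real (n + 2)" for n
  have t: "0 < t n" "t n < b" for n using b(1) by (auto simp: t_def field_simps intro!: add_pos_nonneg)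
  have t0: "t \<longlonglongrightarrow> 0"
    unfolding t_def using LIMSEQ_ignore_initial_segment[OF lim_const_over_n[of b], of 2] by simp
  have "(\<lambda>z. gradient (\<lambda>u. f u z) y \<bullet> ?d) \<in> borel_measurable M"
  proof (rule borel_measurable_LIMSEQ_real)
    show "(\<lambda>n. (f (y + t n *\<^sub>R ?d) z - f y z) / t n) \<longlonglongrightarrow> gradient (\<lambda>u. f u z) y \<bullet> ?d"
      if z: "z \<in> space M" for z
    proof -
      have "filterlim t (at 0) sequentially"
        using t0 t(1) by (intro filterlim_atI always_eventually) (auto simp: less_imp_neq[symmetric])
      from filterlim_compose[OF gradient_line_derivative[OF diff[OF z]] this] show ?thesis by simp
    qed
    show "(\<lambda>z. (f (y + t n *\<^sub>R ?d) z - f y z) / t n) \<in> borel_measurable M" for n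
      using meas[OF b(2)[OF t]] meas[OF y] by measurable
  qed
  then show ?thesis
    unfolding linearization_def using meas[OF y] by measurable
qed

lemma continuous_on_Max_image:
  fixes f :: "'i \<Rightarrow> 'a::topological_space \<Rightarrow> real"
  assumes "finite I" "I \<noteq> {}" "\<And>i. i \<in> I \<Longrightarrow> continuous_on S (f i)"
  shows "continuous_on S (\<lambda>x. Max ((\<lambda>i. f i x) ` I))"
  using assms
proof (induction rule: finite_ne_induct)
  case (insert i I)
  then have "continuous_on S (\<lambda>x. max (f i x) (Max ((\<lambda>i. f i x) ` I)))"
    by (intro continuous_on_max) auto
  with insert show ?case by simp
qed simp

text \<open>To first order an active half-space constraint cannot increase along a tangent
  direction, and an inactive one stays strict for small steps; there are finitely many of them.
  Directional derivatives of expectations are controlled along segments inside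
  \<open>Xset P\<close>, so this makes all tangent directions accessible.\<close>

lemma polytope_feasible_direction:
  fixes X :: "'a::euclidean_space set"
  assumes "polytope X" "C \<subseteq> X" "x \<in> X" "v \<in> tangent_cone x C"
  shows "\<forall>\<^sub>F t in at_right 0. x + t *\<^sub>R v \<in> X"
proof -
  obtain y \<tau> where y: "\<And>i::nat. y i \<in> C" "\<And>i. \<tau> i > 0" "(\<lambda>i. (y i - x) /\<^sub>R \<tau> i) \<longlonglongrightarrow> v"
    using assms(4) unfolding tangent_cone_def by blast
  obtain H where H: "finite H" "X = \<Inter>H" "\<And>h. h \<in> H \<Longrightarrow> \<exists>a b. a \<noteq> 0 \<and> h = {x. a \<bullet> x \<le> b}"
    using polytope_imp_polyhedron[OF assms(1)] unfolding polyhedron_def by blast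
  have "\<forall>\<^sub>F t in at_right 0. x + t *\<^sub>R v \<in> h" if h: "h \<in> H" for h
  proof -
    obtain a b where ab: "h = {x. a \<bullet> x \<le> b}" using H(3)[OF h] by blast
    have xh: "a \<bullet> x \<le> b" and yh: "a \<bullet> y i \<le> b" for i
      using assms(2,3) y(1)[of i] H(2) h ab by auto
    show ?thesis
    proof (cases "a \<bullet> x = b")
      case True
      have "(\<lambda>i. a \<bullet> ((y i - x) /\<^sub>R \<tau> i)) \<longlonglongrightarrow> a \<bullet> v" using y(3) by (intro tendsto_intros)
      moreover have "a \<bullet> ((y i - x) /\<^sub>R \<tau> i) \<le> 0" for i
        using yh[of i] y(2)[of i] True by (simp add: inner_diff_right mult_nonneg_nonpos)
      ultimately have av: "a \<bullet> v \<le> 0" by (intro LIMSEQ_le_const2) auto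
      show ?thesis
        using eventually_at_right_less[of "0::real"]
        by eventually_elim (use av True in \<open>simp add: ab inner_add_right mult_nonneg_nonpos\<close>)
    next
      case False
      have "((\<lambda>t. a \<bullet> (x + t *\<^sub>R v)) \<longlongrightarrow> a \<bullet> (x + 0 *\<^sub>R v)) (at_right (0::real))"
        by (intro tendsto_intros)
      then have "\<forall>\<^sub>F t in at_right 0. a \<bullet> (x + t *\<^sub>R v) < b"
        using False xh by (intro order_tendstoD) auto
      then show ?thesis by eventually_elim (simp add: ab)
    qed
  qed
  then have "\<forall>\<^sub>F t in at_right 0. \<forall>h\<in>H. x + t *\<^sub>R v \<in> h"
    using H(1) by (simp add: eventually_ball_finite)
  then show ?thesis by eventually_elim (simp add: H(2))
qed

text \<open>The quadratic term is of second order along \<open>C\<close>, so it does not contribute to directional derivatives.\<close>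
lemma B_stationary_of_proximal_min:
  fixes X :: "'a::euclidean_space set"
  assumes X: "polytope X" and C: "C \<subseteq> X" "x \<in> C"
    and lip: "L-lipschitz_on X Q"
    and min: "\<And>u. u \<in> C \<Longrightarrow> Q x \<le> Q u + c * (norm (u - x))\<^sup>2"
    and dd: "\<And>v. (\<forall>\<^sub>F t in at_right 0. x + t *\<^sub>R v \<in> X) \<Longrightarrow> \<exists>D. has_dir_deriv Q x v D"
  shows "B_stationary Q C x"
  unfolding B_stationary_def
proof (intro conjI ballI C(2))
  fix v assume v: "v \<in> tangent_cone x C"
  have ev: "\<forall>\<^sub>F t in at_right 0. x + t *\<^sub>R v \<in> X"
    by (rule polytope_feasible_direction[OF X C(1) _ v]) (use C in auto)
  then obtain D where D: "has_dir_deriv Q x v D" using dd by blast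
  obtain y \<tau> where y: "\<And>i::nat. y i \<in> C" "\<And>i. \<tau> i > 0" "\<tau> \<longlonglongrightarrow> 0" "(\<lambda>i. (y i - x) /\<^sub>R \<tau> i) \<longlonglongrightarrow> v"
    using v unfolding tangent_cone_def by blast
  define w where "w i = (y i - x) /\<^sub>R \<tau> i" for i
  have w: "y i = x + \<tau> i *\<^sub>R w i" for i using y(2)[of i] by (simp add: w_def)
  have \<tau>: "filterlim \<tau> (at_right 0) sequentially"
    using y(2,3) by (simp add: filterlim_at less_imp_neq[symmetric])
  have "(\<lambda>i. (Q (x + \<tau> i *\<^sub>R v) - Q x) / \<tau> i) \<longlonglongrightarrow> D"
    using filterlim_compose[OF D[unfolded has_dir_deriv_def] \<tau>] by simp
  \<comment> \<open>The points \<open>y i\<close> lie in \<open>C\<close> but need not lie on the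
    ray along \<open>v\<close>. Minimality is used at \<open>y i\<close>, and the Lipschitz constant
    pays for moving to the ray, at a cost of \<open>L * norm (w i - v)\<close> after division by
    \<open>\<tau> i\<close>.\<close>
  moreover have "(\<lambda>i. - (c * \<tau> i * (norm (w i))\<^sup>2) - L * norm (w i - v)) \<longlonglongrightarrow> - (c * 0 * (norm v)\<^sup>2) - L * norm (v - v)"
    using y(3,4) unfolding w_def[symmetric] by (intro tendsto_intros)
  moreover have "\<forall>\<^sub>F i in sequentially. x + \<tau> i *\<^sub>R v \<in> X"
    using ev \<tau> by (rule eventually_compose_filterlim)
  then have "\<forall>\<^sub>F i in sequentially. - (c * \<tau> i * (norm (w i))\<^sup>2) - L * norm (w i - v) \<le> (Q (x + \<tau> i *\<^sub>R v) - Q x) / \<tau> i"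
  proof eventually_elim
    case (elim i)
    have "Q x \<le> Q (y i) + c * (norm (y i - x))\<^sup>2" by (rule min[OF y(1)])
    moreover have "norm (y i - x) = \<tau> i * norm (w i)" using y(2)[of i] by (simp add: w)
    moreover have "dist (Q (y i)) (Q (x + \<tau> i *\<^sub>R v)) \<le> L * dist (y i) (x + \<tau> i *\<^sub>R v)"
      using lip elim y(1)[of i] C(1) by (intro lipschitz_onD) auto
    moreover have "dist (y i) (x + \<tau> i *\<^sub>R v) = \<tau> i * norm (w i - v)"
      using y(2)[of i] by (simp add: w dist_norm flip: scaleR_diff_right)
    ultimately have "Q x - c * (\<tau> i * norm (w i))\<^sup>2 - L * (\<tau> i * norm (w i - v)) \<le> Q (x + \<tau> i *\<^sub>R v)"
      by (simp add: dist_real_def abs_le_iff)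
    then show ?case using y(2)[of i] by (simp add: field_simps power2_eq_square)
  qed
  ultimately have "- (c * 0 * (norm v)\<^sup>2) - L * norm (v - v) \<le> D"
    by (intro tendsto_le[OF sequentially_bot]) 
  then show "\<exists>D. has_dir_deriv Q x v D \<and> 0 \<le> D" using D by auto
qed

section \<open>Sample averages of the surrogates\<close>

text \<open>
  Continuous functions enclosing the approximations once \<open>\<gamma> \<le> 1 / m\<close>; unlike the indicators to which they
  converge, they admit a uniform law of large numbers in the decision variable.
\<close>
definition psi :: "nat \<Rightarrow> real \<Rightarrow> real" where "psi m t = min 1 (max 0 (2 + real m * t))"
definition chi :: "nat \<Rightarrow> real \<Rightarrow> real" where "chi m t = min 1 (max 0 (real m * t - 1))"

lemma psi_chi_range: "psi m t \<in> {0..1}" "chi m t \<in> {0..1}"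
  by (auto simp: psi_def chi_def)

lemma continuous_on_psi_chi: "continuous_on S (psi m)" "continuous_on S (chi m)"
  unfolding psi_def[abs_def] chi_def[abs_def] by (intro continuous_intros)+

lemma borel_measurable_psi_chi [measurable]: "psi m \<in> borel_measurable borel" "chi m \<in> borel_measurable borel"
  by (intro borel_measurable_continuous_onI continuous_on_psi_chi)+

lemma psi_tendsto: "(\<lambda>m. psi (Suc m) t) \<longlonglongrightarrow> indicator {0..} t"
proof (cases "0 \<le> t")
  case True
  then show ?thesis by (simp add: psi_def min_def max_def add_nonneg_nonneg)
next
  case False
  obtain m0 :: nat where m0: "2 / (- t) < real m0" using reals_Archimedean2 by blast
  have "\<forall>\<^sub>F m in sequentially. psi (Suc m) t = indicator {0..} t"
    using eventually_ge_at_top[of m0]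
  proof eventually_elim
    case (elim m)
    have "2 / (- t) < real (Suc m)" using m0 elim by simp
    then have "2 + real (Suc m) * t < 0" using False by (simp add: field_simps)
    then show ?case using False by (simp add: psi_def)
  qed
  then show ?thesis by (rule tendsto_eventually)
qed

lemma chi_tendsto: "(\<lambda>m. chi (Suc m) t) \<longlonglongrightarrow> indicator {0<..} t"
proof (cases "t \<le> 0")
  case True
  then have "real (Suc m) * t - 1 \<le> 0" for m by (smt (verit) mult_nonneg_nonpos of_nat_0_le_iff)
  then have "chi (Suc m) t = 0" for m unfolding chi_def by (simp only: max_absorb1)
  then show ?thesis using True by simp
next
  case False
  obtain m0 :: nat where m0: "2 / t < real m0" using reals_Archimedean2 by blast
  have "\<forall>\<^sub>F m in sequentially. chi (Suc m) t = indicator {0<..} t"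
    using eventually_ge_at_top[of m0]
  proof eventually_elim
    case (elim m)
    have "2 / t < real (Suc m)" using m0 elim by simp
    then have "2 < real (Suc m) * t" using False by (simp add: field_simps)
    then show ?case using False by (simp add: chi_def)
  qed
  then show ?thesis by (rule tendsto_eventually)
qed

lemma theta_shape_bounds:
  assumes "theta_shape \<theta>"
  shows "t \<le> 0 \<Longrightarrow> \<theta> t \<le> 0" "1 \<le> t \<Longrightarrow> 1 \<le> \<theta> t"
  using assms unfolding theta_shape_def mono_on_def by force+

text \<open>The transition from 0 to 1 takes place on \<open>[- \<gamma>, 0]\<close> for
  \<open>phi_ub\<close> and on \<open>[0, \<gamma>]\<close> for \<open>phi_lb\<close>, both within
  distance \<open>1 / (m + 1)\<close> of 0. On that range \<open>psi (Suc m)\<close> is already 1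
  and \<open>chi (Suc m)\<close> is still 0.\<close>

lemma phi_bracket:
  assumes "approximation_funs P" and g: "0 < \<gamma>" "\<gamma> \<le> 1 / real (Suc m)"
  shows "chi (Suc m) t \<le> phi_ub P t \<gamma>" "phi_ub P t \<gamma> \<le> psi (Suc m) t"
    and "chi (Suc m) t \<le> phi_lb P t \<gamma>" "phi_lb P t \<gamma> \<le> psi (Suc m) t"
proof -
  have th: "theta_shape (th_cvx P)" "theta_shape (th_cve P)"
    using assms(1) by (auto simp: approximation_funs_def)
  have ub1: "phi_ub P t \<gamma> = 1" if "0 \<le> t"
    using theta_shape_bounds(2)[OF th(1), of "1 + t / \<gamma>"] that g(1) by (simp add: phi_ub_def)
  have ub0: "phi_ub P t \<gamma> = 0" if "t \<le> - \<gamma>"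
    using theta_shape_bounds(1)[OF th(1), of "1 + t / \<gamma>"] that g(1) by (simp add: phi_ub_def field_simps)
  have lb1: "phi_lb P t \<gamma> = 1" if "\<gamma> \<le> t"
    using theta_shape_bounds(2)[OF th(2), of "t / \<gamma>"] that g(1) by (simp add: phi_lb_def field_simps)
  have lb0: "phi_lb P t \<gamma> = 0" if "t \<le> 0"
    using theta_shape_bounds(1)[OF th(2), of "t / \<gamma>"] that g(1) by (simp add: phi_lb_def divide_le_0_iff)
  have range: "phi_ub P t \<gamma> \<in> {0..1}" "phi_lb P t \<gamma> \<in> {0..1}"
    by (auto simp: phi_ub_def phi_lb_def)
  have psi1: "psi (Suc m) t = 1" if "- \<gamma> < t"
  proof -
    have "- (1 / real (Suc m)) \<le> t" using that g(2) by linarith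
    then have "- 1 \<le> real (Suc m) * t" by (simp add: field_simps)
    then show ?thesis by (simp add: psi_def)
  qed
  have chi0: "chi (Suc m) t = 0" if "t < \<gamma>"
  proof -
    have "t \<le> 1 / real (Suc m)" using that g(2) by linarith
    then have "real (Suc m) * t \<le> 1" by (simp add: field_simps)
    then show ?thesis by (simp add: chi_def)
  qed
  note r = psi_chi_range[of "Suc m" t]
  show "chi (Suc m) t \<le> phi_ub P t \<gamma>"
    using ub1 chi0 range r g(1) by (cases "0 \<le> t") auto
  show "phi_ub P t \<gamma> \<le> psi (Suc m) t"
    using ub0 psi1 range r by (cases "t \<le> - \<gamma>") auto
  show "chi (Suc m) t \<le> phi_lb P t \<gamma>"
    using lb1 chi0 range r by (cases "\<gamma> \<le> t") auto
  show "phi_lb P t \<gamma> \<le> psi (Suc m) t"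
    using lb0 psi1 range r g(1) by (cases "t \<le> 0") auto
qed

lemma phi_pos_neg_bracket:
  assumes "approximation_funs P" "0 < \<gamma>" "\<gamma> \<le> 1 / real (Suc m)"
  shows "chi (Suc m) t \<le> phi_pos a P t \<gamma>" "phi_pos a P t \<gamma> \<le> psi (Suc m) t"
    and "chi (Suc m) t \<le> phi_neg a P t \<gamma>" "phi_neg a P t \<gamma> \<le> psi (Suc m) t"
  using phi_bracket[OF assms] by (cases a; simp)+

text \<open>The common form of \<open>c_hat\<close>, \<open>c_ub\<close> and their continuous
  enclosures, as a function of the pair \<open>w\<close> of argument and base point. It increases
  with \<open>f\<close> and decreases with \<open>g\<close>, so upper bounds pair \<open>psi\<close>
  with \<open>chi\<close> and lower bounds pair \<open>chi\<close> with \<open>psi\<close>.\<close>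

definition weighted ::
    "('n::finite, 'd::finite) cc_problem \<Rightarrow> nat \<Rightarrow> (real \<Rightarrow> real) \<Rightarrow> (real \<Rightarrow> real) \<Rightarrow>
      (real^'n) \<times> (real^'n) \<Rightarrow> real^'d \<Rightarrow> real" where
  "weighted P k f g w z = (\<Sum>l=1..nL P. epos P k l * f (LZh P l (fst w) z (snd w))
                                     - eneg P k l * g (LZg P l (fst w) z (snd w)))"

lemma c_hat_weighted:
  "c_hat a P k x z \<gamma> y = weighted P k (\<lambda>t. phi_pos a P t \<gamma>) (\<lambda>t. phi_neg a P t \<gamma>) (x, y) z"
  by (simp add: c_hat_def weighted_def)

lemma c_ub_weighted: "c_ub P k x z y = weighted P k (indicator {0..}) (indicator {0<..}) (x, y) z"
  by (simp add: c_ub_def weighted_def)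

lemma epos_eneg_nonneg: "0 \<le> epos P k l" "0 \<le> eneg P k l"
  by (auto simp: epos_def eneg_def)

lemma epos_minus_eneg: "epos P k l - eneg P k l = ecoef P k l"
  by (auto simp: epos_def eneg_def)

lemma weighted_mono:
  assumes "\<And>t. f t \<le> f' t" "\<And>t. g' t \<le> g t"
  shows "weighted P k f g w z \<le> weighted P k f' g' w z"
  unfolding weighted_def
  by (intro sum_mono diff_mono mult_left_mono assms epos_eneg_nonneg)

lemma weighted_bound:
  assumes "\<And>t. f t \<in> {0..1}" "\<And>t. g t \<in> {0..1}"
  shows "\<bar>weighted P k f g w z\<bar> \<le> (\<Sum>l=1..nL P. epos P k l + eneg P k l)"
  unfolding weighted_def
proof (rule order_trans[OF sum_abs sum_mono])
  fix l
  let ?s = "f (LZh P l (fst w) z (snd w))" and ?t = "g (LZg P l (fst w) z (snd w))"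
  have "0 \<le> epos P k l * ?s" "0 \<le> eneg P k l * ?t"
    using assms epos_eneg_nonneg by (auto intro!: mult_nonneg_nonneg)
  moreover have "epos P k l * ?s \<le> epos P k l" "eneg P k l * ?t \<le> eneg P k l"
    using assms epos_eneg_nonneg by (auto intro!: mult_left_le)
  ultimately show "\<bar>epos P k l * ?s - eneg P k l * ?t\<bar> \<le> epos P k l + eneg P k l" by linarith
qed

lemma weighted_tendsto:
  assumes "\<And>t. (\<lambda>m. f m t) \<longlonglongrightarrow> f' t" "\<And>t. (\<lambda>m. g m t) \<longlonglongrightarrow> g' t"
  shows "(\<lambda>m. weighted P k (f m) (g m) w z) \<longlonglongrightarrow> weighted P k f' g' w z"
  unfolding weighted_def by (intro tendsto_intros assms)

lemma LZ_diag: "LZh P l x z x = Zdiff P l x z" "LZg P l x z x = Zdiff P l x z"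
  by (simp_all add: LZh_def LZg_def Zdiff_def linearization_def)

text \<open>For a single sample the random sign drops out under the absolute value, so the
  Rademacher average is the supremum of the absolute values of \<open>f\<close>.\<close>

lemma rademacher_one_bound:
  assumes le: "rademacher X S 1 f \<le> ennreal W" and W: "0 \<le> W" and x: "x \<in> X" and z: "\<xi> \<in> S"
  shows "\<bar>f x \<xi>\<bar> \<le> W"
proof -
  let ?p = "Pi_pmf {1..1::nat} 0 (\<lambda>_. pmf_of_set {-1, 1 :: real})"
  let ?\<xi> = "\<lambda>i\<in>{1..1::nat}. \<xi>"
  have "ennreal \<bar>f x \<xi>\<bar> = (\<integral>\<^sup>+\<sigma>. ennreal \<bar>f x \<xi>\<bar> \<partial>measure_pmf ?p)" by simp
  also have "\<dots> \<le> (\<integral>\<^sup>+\<sigma>. (SUP x\<in>X. ennreal \<bar>(\<Sum>i=1..1. \<sigma> i * f x (?\<xi> i)) / real 1\<bar>) \<partial>measure_pmf ?p)"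
  proof (rule nn_integral_mono_AE, unfold AE_measure_pmf_iff, intro ballI)
    fix \<sigma> assume "\<sigma> \<in> set_pmf ?p"
    then have "\<sigma> 1 \<in> {-1, 1}"
      using set_Pi_pmf_subset'[of "{1..1::nat}" 0 "\<lambda>_. pmf_of_set {-1, 1 :: real}"]
      by (auto simp: PiE_dflt_def)
    then have "\<bar>f x \<xi>\<bar> = \<bar>(\<Sum>i=1..1. \<sigma> i * f x (?\<xi> i)) / real 1\<bar>"
      by (auto simp: abs_mult)
    then show "ennreal \<bar>f x \<xi>\<bar> \<le> (SUP x\<in>X. ennreal \<bar>(\<Sum>i=1..1. \<sigma> i * f x (?\<xi> i)) / real 1\<bar>)"
      using x by (intro SUP_upper2[of x]) auto
  qed
  also have "\<dots> \<le> rademacher X S 1 f"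
    unfolding rademacher_def using z by (intro SUP_upper2[of ?\<xi>]) auto
  also have "\<dots> \<le> ennreal W" by (rule le)
  finally show ?thesis using W by simp
qed

section \<open>Continuity and measurability of the linearized constraint data\<close>

locale spsa_problem = prob_space M for M :: "'w measure" +
  fixes P :: "('n::finite, 'd::finite) cc_problem" and a :: approx
    and zt :: "'w \<Rightarrow> real^'d" and zs :: "nat \<Rightarrow> 'w \<Rightarrow> real^'d"
  assumes random: "random_functionals P M zt"
    and approximation: "approximation_funs P"
    and objective: "objective_assms P M zt"
    and rade: "rademacher_assms a P"
    and surrogate: "surrogate_assms P M zt"
    and iid: "iid_samples P M zt zs"
begin

definition law :: "(real^'d) measure" where "law = distr M (Xi_space P) zt"

lemma measurable_zt [measurable]: "zt \<in> M \<rightarrow>\<^sub>M Xi_space P"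
  using random by (simp add: random_functionals_def)

lemma space_law [simp]: "space law = Xi P"
  by (simp add: law_def Xi_space_def space_restrict_space)

lemma sets_law [simp, measurable_cong]: "sets law = sets (Xi_space P)"
  by (simp add: law_def)

lemma borel_measurable_law: "borel_measurable law = borel_measurable (Xi_space P)"
  by (rule measurable_cong_sets) auto

lemma integral_law:
  fixes f :: "real^'d \<Rightarrow> real"
  shows "f \<in> borel_measurable law \<Longrightarrow> (\<integral>z. f z \<partial>law) = (\<integral>\<omega>. f (zt \<omega>) \<partial>M)"
  unfolding borel_measurable_law unfolding law_def by (rule integral_distr[OF measurable_zt])

lemma integrable_law:
  fixes f :: "real^'d \<Rightarrow> real"
  shows "f \<in> borel_measurable law \<Longrightarrow> integrable law f \<longleftrightarrow> integrable M (\<lambda>\<omega>. f (zt \<omega>))"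
  unfolding borel_measurable_law unfolding law_def by (rule integrable_distr_eq[OF measurable_zt])

sublocale iid_sample M law zs
proof
  have 1: "indep_vars (\<lambda>_. Xi_space P) zs {1..}" and 2: "\<And>s. s \<ge> 1 \<Longrightarrow> distr M (Xi_space P) (zs s) = law"
    using iid by (auto simp: iid_samples_def law_def)
  show "indep_vars (\<lambda>_. law) zs {1..}"
    using 1 unfolding indep_vars_def by (simp add: measurable_cong_sets[OF refl sets_law])
  have "distr M law (zs s) = distr M (Xi_space P) (zs s)" for s by (rule distr_cong) auto
  then show "distr M law (zs s) = law" if "s \<ge> 1" for s using 2[OF that] by simp
qed

lemma polytope_X: "polytope (Xset P)" and open_O: "open (Odom P)" and X_sub_O: "Xset P \<subseteq> Odom P"
  using random by (auto simp: random_functionals_def)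

lemma compact_X: "compact (Xset P)"
  using polytope_X by (rule polytope_imp_compact)

definition regular :: "(real^'n \<Rightarrow> real^'d \<Rightarrow> real) \<Rightarrow> bool" where
  "regular f \<longleftrightarrow> (\<forall>z\<in>Xi P. convex_on (Odom P) (\<lambda>x. f x z) \<and> continuous_on (Odom P) (\<lambda>x. f x z) \<and>
     (\<forall>x\<in>Odom P. (\<lambda>u. f u z) differentiable (at x))) \<and> (\<forall>x\<in>Odom P. f x \<in> borel_measurable law)"

lemma component_fun_regular:
  assumes "component_fun P M zt Lip f"
  shows "regular f"
  using assms lipschitz_on_continuous_on unfolding component_fun_def regular_def borel_measurable_law by metis

lemma regular_components:
  assumes "l \<in> {1..nL P}"
  shows "i \<in> {1..nI P l} \<Longrightarrow> regular (gfun P i l)" "j \<in> {1..nJ P l} \<Longrightarrow> regular (hfun P j l)"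
    and "{1..nI P l} \<noteq> {}" "{1..nJ P l} \<noteq> {}"
  using random assms component_fun_regular unfolding random_functionals_def by fastforce+

lemma regular_continuous:
  assumes "regular f" "z \<in> Xi P"
  shows "continuous_on (Xset P \<times> Xset P) (\<lambda>w. f (fst w) z)"
    and "continuous_on (Xset P \<times> Xset P) (\<lambda>w. linearization f (fst w) z (snd w))"
proof -
  have f: "convex_on (Odom P) (\<lambda>x. f x z)" "continuous_on (Odom P) (\<lambda>x. f x z)"
     "\<And>x. x \<in> Odom P \<Longrightarrow> (\<lambda>u. f u z) differentiable (at x)"
    using assms by (auto simp: regular_def)
  show "continuous_on (Xset P \<times> Xset P) (\<lambda>w. f (fst w) z)"
    using X_sub_O by (intro continuous_on_compose2[OF f(2)] continuous_intros) auto
  show "continuous_on (Xset P \<times> Xset P) (\<lambda>w. linearization f (fst w) z (snd w))"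
    using continuous_on_subset[OF continuous_on_linearization[where f=f, OF f(1) open_O f(2,3)]] X_sub_O
    by (simp add: split_beta' subset_iff)
qed

lemma regular_measurable:
  assumes "regular f" "x \<in> Xset P" "y \<in> Xset P"
  shows "f x \<in> borel_measurable law" "(\<lambda>z. linearization f x z y) \<in> borel_measurable law"
proof -
  show "f x \<in> borel_measurable law" using assms X_sub_O by (auto simp: regular_def)
  show "(\<lambda>z. linearization f x z y) \<in> borel_measurable law"
    using assms X_sub_O by (intro borel_measurable_linearization[OF open_O]) (auto simp: regular_def)
qed

lemma continuous_on_LZ:
  assumes "l \<in> {1..nL P}" "z \<in> Xi P"
  shows "continuous_on (Xset P \<times> Xset P) (\<lambda>w. LZh P l (fst w) z (snd w))"
    and "continuous_on (Xset P \<times> Xset P) (\<lambda>w. LZg P l (fst w) z (snd w))"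
  unfolding LZh_def LZg_def
  by (intro continuous_on_diff continuous_on_Max_image finite_atLeastAtMost regular_components[OF assms(1)]
      regular_continuous[OF _ assms(2)]; assumption)+

lemma borel_measurable_LZ:
  assumes "l \<in> {1..nL P}" "x \<in> Xset P" "y \<in> Xset P"
  shows "(\<lambda>z. LZh P l x z y) \<in> borel_measurable law"
    and "(\<lambda>z. LZg P l x z y) \<in> borel_measurable law"
  unfolding LZh_def LZg_def
  by (intro borel_measurable_diff borel_measurable_Max finite_atLeastAtMost
      regular_measurable[OF _ assms(2,3)] regular_components[OF assms(1)]; assumption)+

lemma borel_measurable_weighted:
  assumes [measurable]: "f \<in> borel_measurable borel" "g \<in> borel_measurable borel"
    and w: "w \<in> Xset P \<times> Xset P"
  shows "weighted P k f g w \<in> borel_measurable law"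
proof -
  have "(\<lambda>z. f (LZh P l (fst w) z (snd w))) \<in> borel_measurable law"
    "(\<lambda>z. g (LZg P l (fst w) z (snd w))) \<in> borel_measurable law" if "l \<in> {1..nL P}" for l
    using borel_measurable_LZ[OF that, of "fst w" "snd w"] w by (auto simp: mem_Times_iff)
  then show ?thesis
    unfolding weighted_def[abs_def]
    by (intro borel_measurable_sum borel_measurable_diff borel_measurable_times borel_measurable_const)
qed

lemma continuous_on_weighted:
  assumes "continuous_on UNIV f" "continuous_on UNIV g" "z \<in> Xi P"
  shows "continuous_on (Xset P \<times> Xset P) (\<lambda>w. weighted P k f g w z)"
  unfolding weighted_def
  by (intro continuous_on_sum continuous_on_diff continuous_on_mult continuous_on_const
      continuous_on_compose2[OF assms(1)] continuous_on_compose2[OF assms(2)] continuous_on_LZ assms(3)) auto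

lemma integral_weighted_tendsto:
  assumes "\<And>t. (\<lambda>m. f m t) \<longlonglongrightarrow> f' t" "\<And>t. (\<lambda>m. g m t) \<longlonglongrightarrow> g' t"
    and "\<And>m t. f m t \<in> {0..1}" "\<And>m t. g m t \<in> {0..1}"
    and "\<And>m. f m \<in> borel_measurable borel" "\<And>m. g m \<in> borel_measurable borel"
      "f' \<in> borel_measurable borel" "g' \<in> borel_measurable borel"
    and w: "w \<in> Xset P \<times> Xset P"
  shows "(\<lambda>m. \<integral>z. weighted P k (f m) (g m) w z \<partial>law) \<longlonglongrightarrow> (\<integral>z. weighted P k f' g' w z \<partial>law)"
proof (rule integral_dominated_convergence[where w="\<lambda>_. \<Sum>l=1..nL P. epos P k l + eneg P k l"])
  show "AE z in law. norm (weighted P k (f m) (g m) w z) \<le> (\<Sum>l=1..nL P. epos P k l + eneg P k l)" for m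
    using weighted_bound[of "f m" "g m"] assms(3,4) by (intro AE_I2) simp
  show "AE z in law. (\<lambda>m. weighted P k (f m) (g m) w z) \<longlonglongrightarrow> weighted P k f' g' w z"
    using assms(1,2) by (intro AE_I2 weighted_tendsto)
qed (use assms borel_measurable_weighted in auto)

end

section \<open>Integrable bounds for the surrogate and the typical samples\<close>

context spsa_problem
begin

text \<open>For \<open>N = 1\<close> the Rademacher average is the supremum norm, so the assumed bound makes \<open>c0\<close> bounded.\<close>
lemma c0_bounded: obtains W where "\<And>x z. x \<in> Xset P \<Longrightarrow> z \<in> Xi P \<Longrightarrow> c0 P x z \<in> {0..W}"
proof -
  obtain W0 W1 W2 where W0: "W0 > 0" and W: "\<forall>N>0. \<forall>\<beta>::real. 0 < \<beta> \<and> \<beta> < 1 / 2 \<longrightarrow>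
      rademacher (Xset P) (Xi P) N (c0 P) \<le> ennreal (W0 / real N powr \<beta>) \<and>
      (\<forall>k\<in>{1..nK P}. \<forall>\<gamma>>0. rademacher (Xset P) (Xi P) N (\<lambda>x z. c_k a P k x z \<gamma>)
         \<le> ennreal (W1 / real N powr \<beta> + W2 / (\<gamma> * sqrt (real N))))"
    using rade unfolding rademacher_assms_def by (elim exE conjE) (rule that)
  have "rademacher (Xset P) (Xi P) 1 (c0 P) \<le> ennreal (W0 / real 1 powr (1 / 4))"
    by (rule W[rule_format, THEN conjunct1]) auto
  then have "rademacher (Xset P) (Xi P) 1 (c0 P) \<le> ennreal W0" by simp
  then have "\<bar>c0 P x z\<bar> \<le> W0" if "x \<in> Xset P" "z \<in> Xi P" for x z
    using rademacher_one_bound[of "Xset P" "Xi P" "c0 P" W0] that W0 by simp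
  moreover have "0 \<le> c0 P x z" if "x \<in> Xset P" "z \<in> Xi P" for x z
    using objective that unfolding objective_assms_def by blast
  ultimately show ?thesis by (intro that[of W0]) (auto simp: abs_le_iff)
qed

lemma c0_measurable: "x \<in> Xset P \<Longrightarrow> c0 P x \<in> borel_measurable law"
  using objective by (simp add: objective_assms_def borel_measurable_law)

lemma c0_continuous: "z \<in> Xi P \<Longrightarrow> continuous_on (Xset P) (\<lambda>x. c0 P x z)"
  using objective lipschitz_on_continuous_on unfolding objective_assms_def by metis

lemma c0_hat_ge: "x \<in> Xset P \<Longrightarrow> y \<in> Xset P \<Longrightarrow> z \<in> Xi P \<Longrightarrow> c0 P x z \<le> c0_hat P x z y"
  using surrogate by (simp add: surrogate_assms_def)

lemma c0_hat_diag: "y \<in> Xset P \<Longrightarrow> z \<in> Xi P \<Longrightarrow> c0_hat P y z y = c0 P y z"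
  using surrogate by (simp add: surrogate_assms_def)

lemma c0_hat_usc: "z \<in> Xi P \<Longrightarrow> usc_on (Xset P \<times> Xset P) (\<lambda>w. c0_hat P (fst w) z (snd w))"
  using surrogate by (simp add: surrogate_assms_def split_beta')

lemma c0_hat_dir_differentiable:
  "x \<in> Xset P \<Longrightarrow> y \<in> Xset P \<Longrightarrow> z \<in> Xi P \<Longrightarrow> dir_differentiable (\<lambda>u. c0_hat P u z y) x"
  using surrogate by (simp add: surrogate_assms_def B_differentiable_def)

lemma c0_hat_lipschitz:
  obtains Lip where "integrable law Lip"
    "\<And>y z. y \<in> Xset P \<Longrightarrow> z \<in> Xi P \<Longrightarrow> (Lip z)-lipschitz_on (Xset P) (\<lambda>x. c0_hat P x z y)"
proof -
  obtain Lip where "Lip \<in> borel_measurable (Xi_space P)" "integrable M (\<lambda>\<omega>. Lip (zt \<omega>))"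
     "\<forall>z\<in>Xi P. \<forall>y\<in>Xset P. (Lip z)-lipschitz_on (Xset P) (\<lambda>x. c0_hat P x z y)"
    using surrogate unfolding surrogate_assms_def by blast
  then show ?thesis using integrable_law[of Lip] by (intro that[of Lip]) (auto simp: borel_measurable_law)
qed

text \<open>On the diagonal the surrogate equals \<open>c0\<close>, which lies in
  \<open>{0..W}\<close>; elsewhere it differs from the diagonal value by at most the modulus times
  the diameter of \<open>Xset P\<close>. The bound holds for all base points at once, as domination
  in the uniform law requires.\<close>

lemma c0_hat_envelope:
  obtains G where "integrable law G"
    "\<And>x y z. x \<in> Xset P \<Longrightarrow> y \<in> Xset P \<Longrightarrow> z \<in> Xi P \<Longrightarrow> \<bar>c0_hat P x z y\<bar> \<le> G z"
proof -
  obtain W where W: "\<And>x z. x \<in> Xset P \<Longrightarrow> z \<in> Xi P \<Longrightarrow> c0 P x z \<in> {0..W}"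
    using c0_bounded by blast
  obtain Lip where Lip: "integrable law Lip"
    "\<And>y z. y \<in> Xset P \<Longrightarrow> z \<in> Xi P \<Longrightarrow> (Lip z)-lipschitz_on (Xset P) (\<lambda>x. c0_hat P x z y)"
    using c0_hat_lipschitz by blast
  define d where "d = diameter (Xset P)"
  have d: "dist x y \<le> d" if "x \<in> Xset P" "y \<in> Xset P" for x y
    unfolding d_def using that compact_imp_bounded[OF compact_X] by (rule diameter_bounded_bound[rotated])
  show ?thesis
  proof (rule that[of "\<lambda>z. W + Lip z * d"])
    show "integrable law (\<lambda>z. W + Lip z * d)" using Lip(1) by simp
    fix x y z assume xyz: "x \<in> Xset P" "y \<in> Xset P" "z \<in> Xi P"
    have "dist (c0_hat P x z y) (c0_hat P y z y) \<le> Lip z * dist x y"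
      using Lip(2)[OF xyz(2,3)] xyz by (intro lipschitz_onD)
    also have "\<dots> \<le> Lip z * d"
      using d[OF xyz(1,2)] lipschitz_on_nonneg[OF Lip(2)[OF xyz(2,3)]] by (intro mult_left_mono)
    finally show "\<bar>c0_hat P x z y\<bar> \<le> W + Lip z * d"
      using W[OF xyz(1,3)] W[OF xyz(2,3)] c0_hat_ge[OF xyz] c0_hat_diag[OF xyz(2,3)] by (auto simp: dist_real_def)
  qed
qed

lemma c0_hat_joint_measurable:
  "(\<lambda>(z, w). c0_hat P (fst w) z (snd w)) \<in> borel_measurable (law \<Otimes>\<^sub>M restrict_space borel (Xset P \<times> Xset P))"
proof -
  let ?R = "restrict_space borel (Xset P)" and ?R2 = "restrict_space borel (Xset P \<times> Xset P)"
  have m: "(\<lambda>(x, z, y). c0_hat P x z y) \<in> borel_measurable (?R \<Otimes>\<^sub>M Xi_space P \<Otimes>\<^sub>M ?R)"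
    using surrogate by (simp add: surrogate_assms_def)
  have proj: "fst \<in> ?R2 \<rightarrow>\<^sub>M ?R" "snd \<in> ?R2 \<rightarrow>\<^sub>M ?R"
    by (intro measurable_restrict_space2 measurable_restrict_space1 borel_measurable_continuous_onI
        continuous_intros; auto simp: space_restrict_space)+
  have "(\<lambda>z. z) \<in> law \<rightarrow>\<^sub>M Xi_space P" by (rule measurable_ident_sets) simp
  from measurable_Pair[OF measurable_compose[OF measurable_snd proj(1)]
      measurable_Pair[OF measurable_compose[OF measurable_fst this] measurable_compose[OF measurable_snd proj(2)]]]
  have "(\<lambda>p. (fst (snd p), fst p, snd (snd p))) \<in> law \<Otimes>\<^sub>M ?R2 \<rightarrow>\<^sub>M ?R \<Otimes>\<^sub>M Xi_space P \<Otimes>\<^sub>M ?R" .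
  from measurable_compose[OF this m] show ?thesis by (simp add: split_beta')
qed

lemma c0_hat_measurable:
  assumes "x \<in> Xset P" "y \<in> Xset P"
  shows "(\<lambda>z. c0_hat P x z y) \<in> borel_measurable law"
proof -
  have "(\<lambda>z. (z, (x, y))) \<in> law \<rightarrow>\<^sub>M law \<Otimes>\<^sub>M restrict_space borel (Xset P \<times> Xset P)"
    using assms by (intro measurable_Pair) (auto simp: space_restrict_space)
  from measurable_compose[OF this c0_hat_joint_measurable] show ?thesis by simp
qed

text \<open>The countably many sample events on which the limit argument rests. Each fixes a level
  \<open>m\<close> of the enclosures; negated functions encode lower bounds.\<close>

definition typical :: "'w \<Rightarrow> bool" where
  "typical \<omega> \<longleftrightarrow> (\<forall>k m. upper_ulln (Xset P \<times> Xset P) (weighted P k (psi (Suc m)) (chi (Suc m))) \<omega> \<and>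
       upper_ulln (Xset P \<times> Xset P) (\<lambda>w z. - weighted P k (chi (Suc m)) (psi (Suc m)) w z) \<omega>) \<and>
     upper_ulln (Xset P) (\<lambda>x z. - c0 P x z) \<omega> \<and>
     upper_ulln (Xset P \<times> Xset P) (\<lambda>w z. c0_hat P (fst w) z (snd w)) \<omega>"

lemma AE_typical: "AE \<omega> in M. typical \<omega>"
proof -
  let ?C = "\<lambda>k. \<Sum>l=1..nL P. epos P k l + eneg P k l"
  have b: "\<bar>weighted P k (psi m) (chi m) w z\<bar> \<le> ?C k" "\<bar>weighted P k (chi m) (psi m) w z\<bar> \<le> ?C k" for k m w z
    by (intro weighted_bound psi_chi_range)+
  have 1: "AE \<omega> in M. upper_ulln (Xset P \<times> Xset P) (weighted P k (psi (Suc m)) (chi (Suc m))) \<omega>" for k m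
  proof (rule usc_ulln_continuous[where G="\<lambda>_. ?C k"])
    show "continuous_on (Xset P \<times> Xset P) (\<lambda>w. weighted P k (psi (Suc m)) (chi (Suc m)) w z)"
      if "z \<in> space law" for z
      using that by (intro continuous_on_weighted continuous_on_psi_chi) simp
  qed (use b in \<open>auto intro!: borel_measurable_weighted\<close>)
  have neg: "AE \<omega> in M. upper_ulln (Xset P \<times> Xset P) (\<lambda>w z. - weighted P k (chi (Suc m)) (psi (Suc m)) w z) \<omega>" for k m
  proof (rule usc_ulln_continuous[where G="\<lambda>_. ?C k"])
    show "continuous_on (Xset P \<times> Xset P) (\<lambda>w. - weighted P k (chi (Suc m)) (psi (Suc m)) w z)"
      if "z \<in> space law" for z
      using that by (intro continuous_on_minus continuous_on_weighted continuous_on_psi_chi) simp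
  qed (use b in \<open>auto intro!: borel_measurable_uminus borel_measurable_weighted\<close>)
  obtain W where W: "\<And>x z. x \<in> Xset P \<Longrightarrow> z \<in> Xi P \<Longrightarrow> c0 P x z \<in> {0..W}"
    using c0_bounded by blast
  have 2: "AE \<omega> in M. upper_ulln (Xset P) (\<lambda>x z. - c0 P x z) \<omega>"
    by (rule usc_ulln_continuous[where G="\<lambda>_. W"])
       (use W in \<open>auto intro!: continuous_intros c0_continuous borel_measurable_uminus c0_measurable\<close>)
  obtain G where G: "integrable law G"
    "\<And>x y z. x \<in> Xset P \<Longrightarrow> y \<in> Xset P \<Longrightarrow> z \<in> Xi P \<Longrightarrow> \<bar>c0_hat P x z y\<bar> \<le> G z"
    using c0_hat_envelope by blast
  have 3: "AE \<omega> in M. upper_ulln (Xset P \<times> Xset P) (\<lambda>w z. c0_hat P (fst w) z (snd w)) \<omega>"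
  proof (rule usc_ulln_joint[OF _ _ G(1) _ c0_hat_joint_measurable])
    show "Xset P \<times> Xset P \<in> sets borel"
      using compact_X by (intro borel_closed closed_Times compact_imp_closed)
  qed (use G(2) c0_hat_usc in auto)
  show ?thesis
    unfolding typical_def using 1 neg 2 3 by (simp add: AE_all_countable AE_conj_iff)
qed

text \<open>One half of \<open>e\<close> goes into choosing a level \<open>m\<close> at which the
  expected enclosure is close to the indicator expression, the other into the uniform law at that
  fixed level, once \<open>g i\<close> is below \<open>1 / (m + 1)\<close>.\<close>

lemma typical_c_hat_upper:
  assumes good: "typical \<omega>"
    and w: "\<And>i. w i \<in> Xset P \<times> Xset P" "v \<in> Xset P \<times> Xset P" "w \<longlonglongrightarrow> v"
    and n: "filterlim n at_top sequentially"
    and g: "\<And>i. 0 < g i" "g \<longlonglongrightarrow> 0" and e: "0 < e"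
  shows "\<forall>\<^sub>F i in sequentially. (\<Sum>s=1..n i. c_hat a P k (fst (w i)) (zs s \<omega>) (g i) (snd (w i)))
    < real (n i) * ((\<integral>z. weighted P k (indicator {0..}) (indicator {0<..}) v z \<partial>law) + e)"
proof -
  have "(\<lambda>m. \<integral>z. weighted P k (psi (Suc m)) (chi (Suc m)) v z \<partial>law)
      \<longlonglongrightarrow> (\<integral>z. weighted P k (indicator {0..}) (indicator {0<..}) v z \<partial>law)"
    by (intro integral_weighted_tendsto psi_tendsto chi_tendsto psi_chi_range borel_measurable_psi_chi w(2)) auto
  then have "\<forall>\<^sub>F m in sequentially. (\<integral>z. weighted P k (psi (Suc m)) (chi (Suc m)) v z \<partial>law)
      < (\<integral>z. weighted P k (indicator {0..}) (indicator {0<..}) v z \<partial>law) + e / 2"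
    using e by (intro order_tendstoD(2)) auto
  then obtain m where m: "(\<integral>z. weighted P k (psi (Suc m)) (chi (Suc m)) v z \<partial>law)
      < (\<integral>z. weighted P k (indicator {0..}) (indicator {0<..}) v z \<partial>law) + e / 2"
    using eventually_happens'[OF sequentially_bot] by blast
  have "\<forall>\<^sub>F i in sequentially. (\<Sum>s=1..n i. weighted P k (psi (Suc m)) (chi (Suc m)) (w i) (zs s \<omega>))
      < real (n i) * ((\<integral>z. weighted P k (psi (Suc m)) (chi (Suc m)) v z \<partial>law) + e / 2)"
    using good w n e unfolding typical_def upper_ulln_def by (meson half_gt_zero)
  moreover have "\<forall>\<^sub>F i in sequentially. g i < 1 / real (Suc m)"
    using g(2) by (intro order_tendstoD(2)) auto
  ultimately show ?thesis
  proof eventually_elim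
    case (elim i)
    have "(\<Sum>s=1..n i. c_hat a P k (fst (w i)) (zs s \<omega>) (g i) (snd (w i)))
        \<le> (\<Sum>s=1..n i. weighted P k (psi (Suc m)) (chi (Suc m)) (w i) (zs s \<omega>))"
      unfolding c_hat_weighted prod.collapse
      using elim(2) by (intro sum_mono weighted_mono phi_pos_neg_bracket approximation g(1)) auto
    also have "\<dots> < real (n i) * ((\<integral>z. weighted P k (psi (Suc m)) (chi (Suc m)) v z \<partial>law) + e / 2)"
      by (rule elim(1))
    also have "\<dots> \<le> real (n i) * ((\<integral>z. weighted P k (indicator {0..}) (indicator {0<..}) v z \<partial>law) + e)"
      using m by (intro mult_left_mono) auto
    finally show ?case .
  qed
qed

text \<open>The mirror image: the minorant pairs \<open>chi\<close> with \<open>psi\<close>, so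
  strict and weak inequality trade places in the limiting indicators.\<close>

lemma typical_c_hat_lower:
  assumes good: "typical \<omega>"
    and w: "\<And>i. w i \<in> Xset P \<times> Xset P" "v \<in> Xset P \<times> Xset P" "w \<longlonglongrightarrow> v"
    and n: "filterlim n at_top sequentially"
    and g: "\<And>i. 0 < g i" "g \<longlonglongrightarrow> 0" and e: "0 < e"
  shows "\<forall>\<^sub>F i in sequentially.
    real (n i) * ((\<integral>z. weighted P k (indicator {0<..}) (indicator {0..}) v z \<partial>law) - e)
    < (\<Sum>s=1..n i. c_hat a P k (fst (w i)) (zs s \<omega>) (g i) (snd (w i)))"
proof -
  have "(\<lambda>m. \<integral>z. weighted P k (chi (Suc m)) (psi (Suc m)) v z \<partial>law)
      \<longlonglongrightarrow> (\<integral>z. weighted P k (indicator {0<..}) (indicator {0..}) v z \<partial>law)"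
    by (intro integral_weighted_tendsto psi_tendsto chi_tendsto psi_chi_range borel_measurable_psi_chi w(2)) auto
  then have "\<forall>\<^sub>F m in sequentially. (\<integral>z. weighted P k (indicator {0<..}) (indicator {0..}) v z \<partial>law) - e / 2
      < (\<integral>z. weighted P k (chi (Suc m)) (psi (Suc m)) v z \<partial>law)"
    using e by (intro order_tendstoD(1)) auto
  then obtain m where m: "(\<integral>z. weighted P k (indicator {0<..}) (indicator {0..}) v z \<partial>law) - e / 2
      < (\<integral>z. weighted P k (chi (Suc m)) (psi (Suc m)) v z \<partial>law)"
    using eventually_happens'[OF sequentially_bot] by blast
  have "\<forall>\<^sub>F i in sequentially. (\<Sum>s=1..n i. - weighted P k (chi (Suc m)) (psi (Suc m)) (w i) (zs s \<omega>))
      < real (n i) * ((\<integral>z. - weighted P k (chi (Suc m)) (psi (Suc m)) v z \<partial>law) + e / 2)"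
    using good w n e unfolding typical_def upper_ulln_def by (meson half_gt_zero)
  moreover have "\<forall>\<^sub>F i in sequentially. g i < 1 / real (Suc m)"
    using g(2) by (intro order_tendstoD(2)) auto
  ultimately show ?thesis
  proof eventually_elim
    case (elim i)
    have "real (n i) * ((\<integral>z. weighted P k (indicator {0<..}) (indicator {0..}) v z \<partial>law) - e)
        \<le> real (n i) * ((\<integral>z. weighted P k (chi (Suc m)) (psi (Suc m)) v z \<partial>law) - e / 2)"
      using m by (intro mult_left_mono) auto
    also have "\<dots> < (\<Sum>s=1..n i. weighted P k (chi (Suc m)) (psi (Suc m)) (w i) (zs s \<omega>))"
      using elim(1) by (simp add: sum_negf algebra_simps)
    also have "\<dots> \<le> (\<Sum>s=1..n i. c_hat a P k (fst (w i)) (zs s \<omega>) (g i) (snd (w i)))"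
      unfolding c_hat_weighted prod.collapse
      using elim(2) by (intro sum_mono weighted_mono phi_pos_neg_bracket approximation g(1)) auto
    finally show ?case .
  qed
qed

lemma integral_weighted_indicator:
  assumes xy: "x \<in> Xset P" "y \<in> Xset P" and [measurable]: "A \<in> sets borel" "B \<in> sets borel"
  shows "(\<integral>z. weighted P k (indicator A) (indicator B) (x, y) z \<partial>law) =
    (\<Sum>l=1..nL P. epos P k l * prob {\<omega>' \<in> space M. LZh P l x (zt \<omega>') y \<in> A}
                 - eneg P k l * prob {\<omega>' \<in> space M. LZg P l x (zt \<omega>') y \<in> B})"
proof -
  have prob_eq: "(\<integral>z. indicator C (F z) \<partial>law) = prob {\<omega>' \<in> space M. F (zt \<omega>') \<in> C}"
    "integrable law (\<lambda>z. indicator C (F z) :: real)"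
    if [measurable]: "F \<in> borel_measurable law" "C \<in> sets borel" for F :: "real^'d \<Rightarrow> real" and C
  proof -
    have m: "(\<lambda>z. indicator C (F z) :: real) \<in> borel_measurable law" by measurable
    have "(\<integral>z. (indicator C (F z) :: real) \<partial>law) = (\<integral>\<omega>'. indicator C (F (zt \<omega>')) \<partial>M)"
      by (rule integral_law[OF m])
    also have "\<dots> = (\<integral>\<omega>'. indicator {\<omega>'' \<in> space M. F (zt \<omega>'') \<in> C} \<omega>' \<partial>M)"
      by (intro Bochner_Integration.integral_cong) (auto simp: indicator_def)
    also have "\<dots> = prob {\<omega>' \<in> space M. F (zt \<omega>') \<in> C}"
      by (simp add: Int_absorb2 subset_eq)
    finally show "(\<integral>z. indicator C (F z) \<partial>law) = prob {\<omega>' \<in> space M. F (zt \<omega>') \<in> C}" .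
    show "integrable law (\<lambda>z. indicator C (F z) :: real)"
      by (rule mu.integrable_const_bound[of _ 1]) (auto simp: indicator_def)
  qed
  show ?thesis
    unfolding weighted_def fst_conv snd_conv
    by (subst Bochner_Integration.integral_sum)
       (auto intro!: sum.cong simp: prob_eq borel_measurable_LZ[OF _ xy])
qed

end

text \<open>All \<open>l i\<close> are at least 1, hence so is \<open>L\<close>. For infinite
  \<open>L\<close> the value \<open>real_of_ereal (1 / L)\<close> is 0, in accordance with the
  convention for an unbounded penalty parameter.\<close>

lemma tendsto_inverse_ereal_limit:
  fixes l :: "nat \<Rightarrow> real"
  assumes "(\<lambda>i. ereal (l i)) \<longlonglongrightarrow> L" "\<And>i. 1 \<le> l i"
  shows "(\<lambda>i. 1 / l i) \<longlonglongrightarrow> real_of_ereal (1 / L)"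
proof -
  have "1 \<le> L" using assms by (intro LIMSEQ_le_const[OF assms(1)]) auto
  then show ?thesis
  proof (cases L)
    case (real r)
    then have "l \<longlonglongrightarrow> r" "r \<noteq> 0" using assms(1) \<open>1 \<le> L\<close> by auto
    then show ?thesis using real by (auto intro!: tendsto_intros simp: one_ereal_def)
  next
    case PInf
    then have "filterlim l at_top sequentially" using assms(1) by (simp add: tendsto_PInfty_eq_at_top)
    then have "(\<lambda>i. 1 / l i) \<longlonglongrightarrow> 0"
      by (intro tendsto_divide_0[OF tendsto_const] filterlim_at_top_imp_at_infinity)
    then show ?thesis using PInf by (simp add: divide_ereal_def)
  qed auto
qed

section \<open>Directional derivatives and Lipschitz continuity of the limiting objective\<close>

context spsa_problem
begin

lemma integrable_c0_hat:
  assumes "u \<in> Xset P" "y \<in> Xset P"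
  shows "integrable law (\<lambda>z. c0_hat P u z y)"
proof -
  obtain G where G: "integrable law G"
    "\<And>x y z. x \<in> Xset P \<Longrightarrow> y \<in> Xset P \<Longrightarrow> z \<in> Xi P \<Longrightarrow> \<bar>c0_hat P x z y\<bar> \<le> G z"
    using c0_hat_envelope by blast
  show ?thesis
    by (rule Bochner_Integration.integrable_bound[OF G(1) c0_hat_measurable[OF assms]])
       (use G(2)[OF assms] in force)
qed

text \<open>Differentiation under the expectation: on the segment inside \<open>Xset P\<close> the
  difference quotients are dominated by \<open>Lip z * norm v\<close>.\<close>

lemma has_dir_deriv_Q_objective:
  assumes x: "x \<in> Xset P" and y: "y \<in> Xset P"
    and v: "\<forall>\<^sub>F t in at_right 0. x + t *\<^sub>R v \<in> Xset P"
  shows "\<exists>D. has_dir_deriv (\<lambda>u. \<integral>z. c0_hat P u z y \<partial>law) x v D"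
proof -
  obtain Lip where Lip: "integrable law Lip"
    "\<And>y z. y \<in> Xset P \<Longrightarrow> z \<in> Xi P \<Longrightarrow> (Lip z)-lipschitz_on (Xset P) (\<lambda>x. c0_hat P x z y)"
    using c0_hat_lipschitz by blast
  note int = integrable_c0_hat[OF _ y]
  have "\<forall>z\<in>Xi P. \<exists>D. has_dir_deriv (\<lambda>u. c0_hat P u z y) x v D"
    using c0_hat_dir_differentiable[OF x y] by (simp add: dir_differentiable_def)
  \<comment> \<open>\<open>D\<close> is chosen separately for each \<open>z\<close>; its
    measurability is recovered below from difference quotients along a fixed sequence.\<close>
  then obtain D where D: "\<And>z. z \<in> Xi P \<Longrightarrow> has_dir_deriv (\<lambda>u. c0_hat P u z y) x v (D z)"
    by metis
  obtain b where b: "b > 0" "\<And>t. 0 < t \<Longrightarrow> t < b \<Longrightarrow> x + t *\<^sub>R v \<in> Xset P"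
    using v unfolding eventually_at_right_field by blast
  let ?q = "\<lambda>t z. (c0_hat P (x + t *\<^sub>R v) z y - c0_hat P x z y) / t"
  have q_meas: "?q t \<in> borel_measurable law" if "0 < t" "t < b" for t
    using c0_hat_measurable[OF b(2)[OF that] y] c0_hat_measurable[OF x y] by measurable
  have q_lim: "(\<lambda>i. ?q (\<tau> i) z) \<longlonglongrightarrow> D z"
    if "\<And>i. 0 < \<tau> i" "\<tau> \<longlonglongrightarrow> 0" "z \<in> Xi P" for \<tau> :: "nat \<Rightarrow> real" and z
  proof -
    have "filterlim \<tau> (at_right 0) sequentially"
      using that(1,2) by (simp add: filterlim_at less_imp_neq[symmetric])
    from filterlim_compose[OF D[OF that(3), unfolded has_dir_deriv_def] this] show ?thesis by simp
  qed
  have D_meas: "D \<in> borel_measurable law"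
  proof (rule borel_measurable_LIMSEQ_real)
    have t0: "(\<lambda>n. b / real (n + 2)) \<longlonglongrightarrow> 0"
      using LIMSEQ_ignore_initial_segment[OF lim_const_over_n[of b], of 2] by simp
    show "(\<lambda>n. ?q (b / real (n + 2)) z) \<longlonglongrightarrow> D z" if "z \<in> space law" for z
      using b(1) t0 that by (intro q_lim) auto
    show "?q (b / real (n + 2)) \<in> borel_measurable law" for n
      using b(1) by (intro q_meas) (auto simp: field_simps intro!: add_pos_nonneg)
  qed
  have "has_dir_deriv (\<lambda>u. \<integral>z. c0_hat P u z y \<partial>law) x v (\<integral>z. D z \<partial>law)"
    unfolding has_dir_deriv_def
  proof (rule tendsto_at_right_sequentially[OF b(1)])
    fix \<tau> :: "nat \<Rightarrow> real"
    assume \<tau>: "\<And>i. 0 < \<tau> i" "\<And>i. \<tau> i < b" "\<tau> \<longlonglongrightarrow> 0"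
    have "(\<lambda>i. \<integral>z. ?q (\<tau> i) z \<partial>law) \<longlonglongrightarrow> (\<integral>z. D z \<partial>law)"
    proof (rule integral_dominated_convergence[OF D_meas q_meas[OF \<tau>(1,2)]])
      show "integrable law (\<lambda>z. Lip z * norm v)" using Lip(1) by simp
      show "AE z in law. (\<lambda>i. ?q (\<tau> i) z) \<longlonglongrightarrow> D z"
        using q_lim[OF \<tau>(1,3)] by (intro AE_I2) simp
      show "AE z in law. norm (?q (\<tau> i) z) \<le> Lip z * norm v" for i
      proof (rule AE_I2)
        fix z assume "z \<in> space law"
        then have "dist (c0_hat P (x + \<tau> i *\<^sub>R v) z y) (c0_hat P x z y) \<le> Lip z * dist (x + \<tau> i *\<^sub>R v) x"
          using b(2)[OF \<tau>(1,2)] x y by (intro lipschitz_onD[OF Lip(2)]) auto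
        then show "norm (?q (\<tau> i) z) \<le> Lip z * norm v"
          using \<tau>(1)[of i] by (simp add: dist_norm field_simps)
      qed
    qed
    also have "(\<lambda>i. \<integral>z. ?q (\<tau> i) z \<partial>law)
        = (\<lambda>i. ((\<integral>z. c0_hat P (x + \<tau> i *\<^sub>R v) z y \<partial>law) - (\<integral>z. c0_hat P x z y \<partial>law)) / \<tau> i)"
      using int[OF b(2)[OF \<tau>(1,2)]] int[OF x] by simp
    finally show "(\<lambda>i. ((\<integral>z. c0_hat P (x + \<tau> i *\<^sub>R v) z y \<partial>law) - (\<integral>z. c0_hat P x z y \<partial>law)) / \<tau> i)
        \<longlonglongrightarrow> (\<integral>z. D z \<partial>law)" .
  qed
  then show ?thesis ..
qed

lemma lipschitz_Q_objective:
  assumes y: "y \<in> Xset P"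
  shows "\<exists>L. L-lipschitz_on (Xset P) (\<lambda>u. \<integral>z. c0_hat P u z y \<partial>law)"
proof -
  obtain Lip where Lip: "integrable law Lip"
    "\<And>y z. y \<in> Xset P \<Longrightarrow> z \<in> Xi P \<Longrightarrow> (Lip z)-lipschitz_on (Xset P) (\<lambda>x. c0_hat P x z y)"
    using c0_hat_lipschitz by blast
  note int = integrable_c0_hat[OF _ y]
  have "(\<integral>z. Lip z \<partial>law)-lipschitz_on (Xset P) (\<lambda>u. \<integral>z. c0_hat P u z y \<partial>law)"
  proof (rule lipschitz_onI)
    show "0 \<le> (\<integral>z. Lip z \<partial>law)"
      using lipschitz_on_nonneg[OF Lip(2)[OF y]] by (intro integral_nonneg_AE AE_I2) simp
    fix u w assume uw: "u \<in> Xset P" "w \<in> Xset P"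
    have "dist (\<integral>z. c0_hat P u z y \<partial>law) (\<integral>z. c0_hat P w z y \<partial>law)
        = \<bar>\<integral>z. c0_hat P u z y - c0_hat P w z y \<partial>law\<bar>"
      using int[OF uw(1)] int[OF uw(2)] by (simp add: dist_real_def)
    also have "\<dots> \<le> (\<integral>z. Lip z * dist u w \<partial>law)"
    proof (rule integral_abs_bound_integral)
      show "integrable law (\<lambda>z. c0_hat P u z y - c0_hat P w z y)" using int uw by simp
      show "integrable law (\<lambda>z. Lip z * dist u w)" using Lip(1) by simp
      show "\<bar>c0_hat P u z y - c0_hat P w z y\<bar> \<le> Lip z * dist u w" if "z \<in> space law" for z
        using lipschitz_onD[OF Lip(2)[OF y] uw] that by (simp add: dist_real_def)
    qed
    finally show "dist (\<integral>z. c0_hat P u z y \<partial>law) (\<integral>z. c0_hat P w z y \<partial>law) \<le> (\<integral>z. Lip z \<partial>law) * dist u w"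
      by simp
  qed
  then show ?thesis ..
qed

end

section \<open>Limits of the subproblems\<close>

text \<open>One sample point and one subsequence, renumbered by \<open>i\<close>: \<open>y i\<close>
  and \<open>y' i\<close> stand for an iterate and its successor, with the common limit
  \<open>xi\<close>, and \<theta> stands for \<open>1 / \<lambda>\<^sub>\<infinity>\<close>.\<close>

locale spsa_limit = spsa_problem M P a zt zs
  for M :: "'w measure" and P :: "('n::finite, 'd::finite) cc_problem" and a zt
    and zs :: "nat \<Rightarrow> 'w \<Rightarrow> real^'d" +
  fixes \<omega> :: 'w and n :: "nat \<Rightarrow> nat" and l \<rho> g :: "nat \<Rightarrow> real" and \<theta> \<rho>_inf :: real
    and y y' :: "nat \<Rightarrow> real^'n" and xi :: "real^'n"
  assumes typical: "typical \<omega>" and \<omega>: "\<omega> \<in> space M"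
    and n: "filterlim n at_top sequentially" "\<And>i. 0 < n i"
    and l: "\<And>i. 1 \<le> l i" "(\<lambda>i. 1 / l i) \<longlonglongrightarrow> \<theta>"
    and \<rho>: "\<And>i. 0 \<le> \<rho> i" "\<rho> \<longlonglongrightarrow> \<rho>_inf" "(\<lambda>i. \<rho> i / l i) \<longlonglongrightarrow> 0"
    and g: "\<And>i. 0 < g i" "g \<longlonglongrightarrow> 0"
    and y: "\<And>i. y i \<in> Xset P" "y \<longlonglongrightarrow> xi"
    and y': "\<And>i. y' i \<in> Xset P" "y' \<longlonglongrightarrow> xi"
    and opt: "\<And>i u. u \<in> Xset P \<Longrightarrow>
      spsa_objective a P (\<lambda>s. zs s \<omega>) (n i) (l i) (\<rho> i) (g i) (y i) (y' i)
        \<le> spsa_objective a P (\<lambda>s. zs s \<omega>) (n i) (l i) (\<rho> i) (g i) (y i) u"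
begin

text \<open>The constraint function of (Q) with base point \<open>xi\<close>. It bounds the averages
  at a fixed \<open>u\<close> asymptotically from above; \<open>lower_constraint\<close> at
  \<open>xi\<close> does the same from below for the averages at the iterates.\<close>

definition upper_constraint :: "nat \<Rightarrow> real^'n \<Rightarrow> real" where
  "upper_constraint k u = (\<integral>z. weighted P k (indicator {0..}) (indicator {0<..}) (u, xi) z \<partial>law)"

definition lower_constraint :: "nat \<Rightarrow> real^'n \<Rightarrow> real" where
  "lower_constraint k u = (\<integral>z. weighted P k (indicator {0<..}) (indicator {0..}) (u, xi) z \<partial>law)"

definition limit_objective :: "real^'n \<Rightarrow> real" where
  "limit_objective u = (\<integral>z. c0_hat P u z xi \<partial>law)"

definition avg_objective :: "nat \<Rightarrow> real^'n \<Rightarrow> real" where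
  "avg_objective i u = (\<Sum>s=1..n i. c0_hat P u (zs s \<omega>) (y i)) / real (n i)"

definition avg_constraint :: "nat \<Rightarrow> nat \<Rightarrow> real^'n \<Rightarrow> real" where
  "avg_constraint i k u = (\<Sum>s=1..n i. c_hat a P k u (zs s \<omega>) (g i) (y i)) / real (n i)"

lemma xi: "xi \<in> Xset P"
  using closed_sequentially[OF compact_imp_closed[OF compact_X]] y by blast

lemma optimality:
  assumes "u \<in> Xset P"
  shows "avg_objective i (y' i) + l i * (\<Sum>k=1..nK P. max (avg_constraint i k (y' i) - zeta P k) 0)
    \<le> avg_objective i u + l i * (\<Sum>k=1..nK P. max (avg_constraint i k u - zeta P k) 0)
      + \<rho> i / 2 * (norm (u - y i))\<^sup>2"
proof -
  have "0 \<le> \<rho> i / 2 * (norm (y' i - y i))\<^sup>2" using \<rho>(1) by simp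
  then show ?thesis
    using opt[OF assms, of i] unfolding spsa_objective_def avg_objective_def avg_constraint_def by linarith
qed

lemma avg_objective_upper:
  assumes u: "u \<in> Xset P" and e: "0 < e"
  shows "\<forall>\<^sub>F i in sequentially. avg_objective i u < limit_objective u + e"
proof -
  have lim: "(\<lambda>i. (u, y i)) \<longlonglongrightarrow> (u, xi)" using y(2) by (intro tendsto_intros)
  have "\<forall>i. (u, y i) \<in> Xset P \<times> Xset P" "(u, xi) \<in> Xset P \<times> Xset P" using u y(1) xi by auto
  then have "\<forall>\<^sub>F i in sequentially. (\<Sum>s=1..n i. c0_hat P (fst (u, y i)) (zs s \<omega>) (snd (u, y i)))
      < real (n i) * ((\<integral>z. c0_hat P (fst (u, xi)) z (snd (u, xi)) \<partial>law) + e)"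
    using typical lim n(1) e unfolding typical_def upper_ulln_def by meson
  then show ?thesis
    by eventually_elim (use n(2) in \<open>simp add: avg_objective_def limit_objective_def divide_less_eq mult.commute\<close>)
qed

lemma avg_objective_lower:
  assumes e: "0 < e"
  shows "\<forall>\<^sub>F i in sequentially. limit_objective xi - e < avg_objective i (y' i)"
proof -
  have "\<forall>\<^sub>F i in sequentially. (\<Sum>s=1..n i. - c0 P (y' i) (zs s \<omega>))
      < real (n i) * ((\<integral>z. - c0 P xi z \<partial>law) + e)"
    using typical y' xi n(1) e unfolding typical_def upper_ulln_def by meson
  then show ?thesis
  proof eventually_elim
    case (elim i)
    have "limit_objective xi = (\<integral>z. c0 P xi z \<partial>law)"
      unfolding limit_objective_def using c0_hat_diag[OF xi] by (intro Bochner_Integration.integral_cong) auto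
    then have "real (n i) * (limit_objective xi - e) < (\<Sum>s=1..n i. c0 P (y' i) (zs s \<omega>))"
      using elim by (simp add: sum_negf algebra_simps)
    also have "\<dots> \<le> (\<Sum>s=1..n i. c0_hat P (y' i) (zs s \<omega>) (y i))"
      using zs_space[OF _ \<omega>] y(1) y'(1) by (intro sum_mono c0_hat_ge) auto
    finally show ?case
      using n(2)[of i] by (simp add: avg_objective_def less_divide_eq mult.commute)
  qed
qed

lemma avg_constraint_upper:
  assumes u: "u \<in> Xset P" and e: "0 < e"
  shows "\<forall>\<^sub>F i in sequentially. avg_constraint i k u < upper_constraint k u + e"
proof -
  have lim: "(\<lambda>i. (u, y i)) \<longlonglongrightarrow> (u, xi)" using y(2) by (intro tendsto_intros)
  have "\<forall>\<^sub>F i in sequentially. (\<Sum>s=1..n i. c_hat a P k (fst (u, y i)) (zs s \<omega>) (g i) (snd (u, y i)))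
      < real (n i) * ((\<integral>z. weighted P k (indicator {0..}) (indicator {0<..}) (u, xi) z \<partial>law) + e)"
    by (rule typical_c_hat_upper[OF typical _ _ lim n(1) g e]) (use u y xi in auto)
  then show ?thesis
    by eventually_elim (use n(2) in \<open>simp add: avg_constraint_def upper_constraint_def divide_less_eq mult.commute\<close>)
qed

lemma avg_constraint_lower:
  assumes e: "0 < e"
  shows "\<forall>\<^sub>F i in sequentially. lower_constraint k xi - e < avg_constraint i k (y' i)"
proof -
  have lim: "(\<lambda>i. (y' i, y i)) \<longlonglongrightarrow> (xi, xi)" using y(2) y'(2) by (intro tendsto_intros)
  have "\<forall>\<^sub>F i in sequentially.
      real (n i) * ((\<integral>z. weighted P k (indicator {0<..}) (indicator {0..}) (xi, xi) z \<partial>law) - e)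
      < (\<Sum>s=1..n i. c_hat a P k (fst (y' i, y i)) (zs s \<omega>) (g i) (snd (y' i, y i)))"
    by (rule typical_c_hat_lower[OF typical _ _ lim n(1) g e]) (use y y' xi in auto)
  then show ?thesis
    by eventually_elim (use n(2) in \<open>simp add: avg_constraint_def lower_constraint_def less_divide_eq mult.commute\<close>)
qed

text \<open>After division by \<open>l i\<close> the proximal term vanishes and the objectives enter
  with weight \<theta>, so the assumption on \<open>u\<close> removes them in the limit. For an
  unbounded penalty parameter \<theta> is 0 and that assumption holds automatically. What remains
  compares the violation at the iterates with the penalty of \<open>u\<close>, which is
  asymptotically zero.\<close>

lemma limit_feasible:
  assumes u: "u \<in> Xset P" and feas: "\<And>k. k \<in> {1..nK P} \<Longrightarrow> upper_constraint k u \<le> zeta P k"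
    and obj: "\<theta> * limit_objective u \<le> \<theta> * limit_objective xi" and k0: "k0 \<in> {1..nK P}"
  shows "lower_constraint k0 xi \<le> zeta P k0"
proof -
  let ?d = "lower_constraint k0 xi - zeta P k0" and ?K = "real (nK P)"
  \<comment> \<open>\<open>2 * \<theta>\<close> collects the errors of the two objectives, 1 the
    error of constraint \<open>k0\<close> at the iterates and \<open>?K\<close> the penalties of
    \<open>u\<close>.\<close>
  have bound: "?d \<le> e * (2 * \<theta> + 1 + ?K)" if e: "0 < e" for e
  proof -
    have "\<forall>\<^sub>F i in sequentially. \<forall>k\<in>{1..nK P}. avg_constraint i k u < upper_constraint k u + e"
      using avg_constraint_upper[OF u e] by (intro eventually_ball_finite) auto
    with avg_objective_upper[OF u e] avg_objective_lower[OF e] avg_constraint_lower[OF e, of k0]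
    have "\<forall>\<^sub>F i in sequentially. 1 / l i * (limit_objective xi - e) + (?d - e)
        \<le> 1 / l i * (limit_objective u + e) + ?K * e + \<rho> i / l i * ((norm (u - y i))\<^sup>2 / 2)"
    proof eventually_elim
      case (elim i)
      have "max (avg_constraint i k u - zeta P k) 0 \<le> e" if "k \<in> {1..nK P}" for k
        using elim(4) feas[OF that] that e by fastforce
      then have "(\<Sum>k=1..nK P. max (avg_constraint i k u - zeta P k) 0) \<le> (\<Sum>k=1..nK P. e)"
        by (intro sum_mono)
      then have 1: "(\<Sum>k=1..nK P. max (avg_constraint i k u - zeta P k) 0) \<le> ?K * e" by simp
      have "?d - e \<le> max (avg_constraint i k0 (y' i) - zeta P k0) 0" using elim(3) by simp
      also have "\<dots> \<le> (\<Sum>k=1..nK P. max (avg_constraint i k (y' i) - zeta P k) 0)"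
        using k0 by (intro member_le_sum) auto
      finally have 2: "?d - e \<le> (\<Sum>k=1..nK P. max (avg_constraint i k (y' i) - zeta P k) 0)" .
      have lpos: "0 < l i" using l(1)[of i] by simp
      have "(limit_objective xi - e) + l i * (?d - e)
          \<le> avg_objective i (y' i) + l i * (\<Sum>k=1..nK P. max (avg_constraint i k (y' i) - zeta P k) 0)"
        using elim(2) 2 lpos by (intro add_mono mult_left_mono) auto
      also have "\<dots> \<le> avg_objective i u + l i * (\<Sum>k=1..nK P. max (avg_constraint i k u - zeta P k) 0)
          + \<rho> i / 2 * (norm (u - y i))\<^sup>2" by (rule optimality[OF u])
      also have "\<dots> \<le> (limit_objective u + e) + l i * (?K * e) + \<rho> i / 2 * (norm (u - y i))\<^sup>2"
        using elim(1) 1 lpos \<rho>(1) by (intro add_mono mult_left_mono) auto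
      finally have "((limit_objective xi - e) + l i * (?d - e)) / l i
          \<le> ((limit_objective u + e) + l i * (?K * e) + \<rho> i / 2 * (norm (u - y i))\<^sup>2) / l i"
        using lpos by (intro divide_right_mono) auto
      then show ?case using lpos by (simp add: add_divide_distrib)
    qed
    moreover have "(\<lambda>i. 1 / l i * (limit_objective xi - e) + (?d - e)) \<longlonglongrightarrow> \<theta> * (limit_objective xi - e) + (?d - e)"
      by (intro tendsto_intros l(2))
    moreover have "(\<lambda>i. 1 / l i * (limit_objective u + e) + ?K * e + \<rho> i / l i * ((norm (u - y i))\<^sup>2 / 2))
        \<longlonglongrightarrow> \<theta> * (limit_objective u + e) + ?K * e + 0 * ((norm (u - xi))\<^sup>2 / 2)"
      using l(2) \<rho>(3) y(2) by (intro tendsto_intros) auto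
    ultimately have "\<theta> * (limit_objective xi - e) + (?d - e)
        \<le> \<theta> * (limit_objective u + e) + ?K * e + 0 * ((norm (u - xi))\<^sup>2 / 2)"
      by (intro tendsto_le[OF sequentially_bot])
    then show ?thesis using obj by (simp add: algebra_simps)
  qed
  have "0 \<le> \<theta>" using l(1) by (intro LIMSEQ_le_const[OF l(2)]) (auto intro: order_trans[OF zero_le_one])
  then have c: "0 < 2 * \<theta> + 1 + ?K" by (simp add: add_nonneg_pos add_pos_nonneg)
  show ?thesis
  proof (rule ccontr)
    assume "\<not> ?thesis"
    then have d: "0 < ?d" by simp
    \<comment> \<open>Taking for \<open>e\<close> the fraction of \<open>?d\<close> by twice the
      constant leaves \<open>?d \<le> ?d / 2\<close>.\<close>
    have "?d \<le> ?d / (2 * (2 * \<theta> + 1 + ?K)) * (2 * \<theta> + 1 + ?K)"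
      using d c by (intro bound divide_pos_pos) auto
    also have "\<dots> = ?d / 2" using c by (simp add: field_simps)
    finally show False using d by simp
  qed
qed

text \<open>Strict feasibility makes the penalty of \<open>u\<close> exactly zero from some index
  on, and the nonnegative penalty of the iterate is dropped. Hence no division by \<open>l i\<close>
  occurs and the objectives are compared at full weight, even for an unbounded penalty
  parameter.\<close>

lemma limit_proximal_min:
  assumes u: "u \<in> Xset P" and feas: "\<And>k. k \<in> {1..nK P} \<Longrightarrow> upper_constraint k u < zeta P k"
  shows "limit_objective xi \<le> limit_objective u + \<rho>_inf / 2 * (norm (u - xi))\<^sup>2"
proof -
  have ev: "\<forall>\<^sub>F i in sequentially. \<forall>k\<in>{1..nK P}. avg_constraint i k u < zeta P k"
    using avg_constraint_upper[OF u, of "zeta P k - upper_constraint k u" k for k] feas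
    by (intro eventually_ball_finite) auto
  have bound: "limit_objective xi - e \<le> limit_objective u + e + \<rho>_inf / 2 * (norm (u - xi))\<^sup>2" if e: "0 < e" for e
  proof (rule tendsto_le[OF sequentially_bot])
    show "(\<lambda>i. limit_objective u + e + \<rho> i / 2 * (norm (u - y i))\<^sup>2)
        \<longlonglongrightarrow> limit_objective u + e + \<rho>_inf / 2 * (norm (u - xi))\<^sup>2"
      using \<rho>(2) y(2) by (intro tendsto_intros) auto
    show "\<forall>\<^sub>F i in sequentially. limit_objective xi - e \<le> limit_objective u + e + \<rho> i / 2 * (norm (u - y i))\<^sup>2"
      using ev avg_objective_upper[OF u e] avg_objective_lower[OF e]
    proof eventually_elim
      case (elim i)
      have "(\<Sum>k=1..nK P. max (avg_constraint i k u - zeta P k) 0) = 0"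
        using elim(1) by (intro sum.neutral) fastforce
      moreover have "0 \<le> l i * (\<Sum>k=1..nK P. max (avg_constraint i k (y' i) - zeta P k) 0)"
        using l(1)[of i] by (intro mult_nonneg_nonneg sum_nonneg) auto
      ultimately show ?case using optimality[OF u, of i] elim(2,3) by simp
    qed
  qed simp
  show ?thesis
  proof (rule field_le_epsilon)
    fix e :: real assume "0 < e"
    then show "limit_objective xi \<le> limit_objective u + \<rho>_inf / 2 * (norm (u - xi))\<^sup>2 + e"
      using bound[of "e / 2"] by simp
  qed
qed

lemma upper_constraint_eq_prob:
  assumes "u \<in> Xset P"
  shows "upper_constraint k u =
    (\<Sum>l=1..nL P. epos P k l * prob {\<omega>' \<in> space M. LZh P l u (zt \<omega>') xi \<ge> 0}
                 - eneg P k l * prob {\<omega>' \<in> space M. LZg P l u (zt \<omega>') xi > 0})"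
  unfolding upper_constraint_def by (subst integral_weighted_indicator) (use assms xi in auto)

lemma upper_constraint_eq_c_ub:
  assumes "u \<in> Xset P"
  shows "upper_constraint k u = (\<integral>\<omega>'. c_ub P k u (zt \<omega>') xi \<partial>M)"
  unfolding upper_constraint_def c_ub_weighted
  by (rule integral_law) (use assms xi in \<open>auto intro!: borel_measurable_weighted\<close>)

lemma Q_feasible_iff: "u \<in> Q_feasible P M zt xi \<longleftrightarrow> u \<in> Xset P \<and> (\<forall>k\<in>{1..nK P}. upper_constraint k u \<le> zeta P k)"
  unfolding Q_feasible_def using upper_constraint_eq_prob by auto

lemma limit_objective_eq: "u \<in> Xset P \<Longrightarrow> limit_objective u = Q_objective P M zt xi u"
  unfolding limit_objective_def Q_objective_def by (rule integral_law[OF c0_hat_measurable[OF _ xi]])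

end

text \<open>The boundary events \<open>Z\<^sub>\<ell> = 0\<close> are the only place where the four indicator expressions differ.\<close>
locale spsa_limit_regular = spsa_limit +
  assumes null: "\<And>l. l \<in> {1..nL P} \<Longrightarrow> prob {\<omega>' \<in> space M. Zdiff P l xi (zt \<omega>') = 0} = 0"
begin

lemma prob_Zdiff_pos:
  assumes j: "j \<in> {1..nL P}"
  shows "prob {\<omega>' \<in> space M. Zdiff P j xi (zt \<omega>') > 0} = prob {\<omega>' \<in> space M. Zdiff P j xi (zt \<omega>') \<ge> 0}"
proof -
  have "(\<lambda>z. Zdiff P j xi z) \<in> borel_measurable law"
    using borel_measurable_LZ(1)[OF j xi xi] by (simp add: LZ_diag)
  then have "Zdiff P j xi \<in> borel_measurable (Xi_space P)" by (simp add: borel_measurable_law)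
  from measurable_compose[OF measurable_zt this]
  have [measurable]: "(\<lambda>\<omega>'. Zdiff P j xi (zt \<omega>')) \<in> borel_measurable M" .
  have "prob {\<omega>' \<in> space M. Zdiff P j xi (zt \<omega>') \<ge> 0}
      = prob ({\<omega>' \<in> space M. Zdiff P j xi (zt \<omega>') > 0} \<union> {\<omega>' \<in> space M. Zdiff P j xi (zt \<omega>') = 0})"
    by (rule arg_cong[of _ _ prob]) auto
  also have "\<dots> = prob {\<omega>' \<in> space M. Zdiff P j xi (zt \<omega>') > 0} + prob {\<omega>' \<in> space M. Zdiff P j xi (zt \<omega>') = 0}"
    by (rule finite_measure_Union) auto
  finally show ?thesis using null[OF j] by simp
qed

lemma upper_constraint_xi:
  "upper_constraint k xi = (\<Sum>l=1..nL P. ecoef P k l * prob {\<omega>' \<in> space M. Zdiff P l xi (zt \<omega>') \<ge> 0})"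
  unfolding upper_constraint_eq_prob[OF xi] LZ_diag
  by (intro sum.cong refl) (simp add: prob_Zdiff_pos epos_minus_eneg flip: left_diff_distrib)

text \<open>This closes the gap between the lower limit at the iterates and the constraint of (Q):
  the conclusion of \<open>limit_feasible\<close> becomes feasibility of \<open>xi\<close>.\<close>

lemma lower_constraint_xi: "lower_constraint k xi = upper_constraint k xi"
  unfolding upper_constraint_xi lower_constraint_def
  by (subst integral_weighted_indicator)
     (auto intro!: sum.cong simp: xi LZ_diag prob_Zdiff_pos epos_minus_eneg simp flip: left_diff_distrib)

lemma CCP_feasible_iff: "xi \<in> CCP_feasible P M zt \<longleftrightarrow> xi \<in> Q_feasible P M zt xi"
  unfolding CCP_feasible_def Q_feasible_iff upper_constraint_xi using xi by auto

lemma feasible_of_improving: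
  assumes "u \<in> Q_feasible P M zt xi"
    and "\<theta> * Q_objective P M zt xi u \<le> \<theta> * Q_objective P M zt xi xi"
  shows "xi \<in> Q_feasible P M zt xi"
  using limit_feasible[of u] assms xi limit_objective_eq
  by (auto simp: Q_feasible_iff lower_constraint_xi)

lemma B_stationary_limit:
  assumes feas: "xi \<in> Q_feasible P M zt xi" and cl: "closure_condition P M zt xi"
  shows "B_stationary (Q_objective P M zt xi) (Q_feasible P M zt xi) xi"
proof -
  let ?S = "{u \<in> Xset P. \<forall>k\<in>{1..nK P}. upper_constraint k u < zeta P k}"
  have "{x \<in> Xset P. \<forall>k\<in>{1..nK P}. (\<integral>\<omega>'. c_ub P k x (zt \<omega>') xi \<partial>M) \<le> zeta P k} = Q_feasible P M zt xi"
    using Q_feasible_iff upper_constraint_eq_c_ub by auto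
  moreover have "{x \<in> Xset P. \<forall>k\<in>{1..nK P}. (\<integral>\<omega>'. c_ub P k x (zt \<omega>') xi \<partial>M) < zeta P k} = ?S"
    using upper_constraint_eq_c_ub by auto
  ultimately have sub: "Q_feasible P M zt xi \<subseteq> closure ?S"
    using cl by (simp add: closure_condition_def)
  obtain L where L: "L-lipschitz_on (Xset P) limit_objective"
    using lipschitz_Q_objective[OF xi] by (auto simp: limit_objective_def[abs_def])
  \<comment> \<open>\<open>limit_proximal_min\<close> covers strictly feasible points; the closure
    condition and continuity of the objective extend it to all feasible ones.\<close>
  have min: "limit_objective xi \<le> limit_objective u + \<rho>_inf / 2 * (norm (u - xi))\<^sup>2"
    if u: "u \<in> Q_feasible P M zt xi" for u
  proof -
    obtain w where w: "\<And>i. w i \<in> ?S" "w \<longlonglongrightarrow> u" using sub u closure_sequential by blast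
    have "u \<in> Xset P" using u Q_feasible_iff by blast
    then have "(\<lambda>i. limit_objective (w i)) \<longlonglongrightarrow> limit_objective u"
      using w by (intro continuous_on_tendsto_compose[OF lipschitz_on_continuous_on[OF L] w(2)]) auto
    then have "(\<lambda>i. limit_objective (w i) + \<rho>_inf / 2 * (norm (w i - xi))\<^sup>2)
        \<longlonglongrightarrow> limit_objective u + \<rho>_inf / 2 * (norm (u - xi))\<^sup>2"
      using w(2) by (intro tendsto_intros)
    then show ?thesis
      by (rule LIMSEQ_le_const) (use w(1) limit_proximal_min in auto)
  qed
  have *: "B_stationary limit_objective (Q_feasible P M zt xi) xi"
  proof (rule B_stationary_of_proximal_min[OF polytope_X _ feas L min])
    show "Q_feasible P M zt xi \<subseteq> Xset P" using Q_feasible_iff by blast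
    show "\<exists>D. has_dir_deriv limit_objective xi v D"
      if "\<forall>\<^sub>F t in at_right 0. xi + t *\<^sub>R v \<in> Xset P" for v
      using has_dir_deriv_Q_objective[OF xi xi that] by (simp add: limit_objective_def[abs_def])
  qed
  \<comment> \<open>The two objectives are integrals over the law and over \<open>M\<close>,
    identified on \<open>Xset P\<close>, where measurability is known. Tangent directions stay in
    \<open>Xset P\<close> for small steps, so the difference quotients agree.\<close>
  have "has_dir_deriv (Q_objective P M zt xi) xi v D"
    if v: "v \<in> tangent_cone xi (Q_feasible P M zt xi)" and D: "has_dir_deriv limit_objective xi v D" for v D
  proof -
    have "\<forall>\<^sub>F t in at_right 0. xi + t *\<^sub>R v \<in> Xset P"
      using Q_feasible_iff by (intro polytope_feasible_direction[OF polytope_X _ xi v]) blast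
    then have "\<forall>\<^sub>F t in at_right 0. (limit_objective (xi + t *\<^sub>R v) - limit_objective xi) / t
        = (Q_objective P M zt xi (xi + t *\<^sub>R v) - Q_objective P M zt xi xi) / t"
      by eventually_elim (simp add: limit_objective_eq xi)
    from tendsto_cong[OF this] show ?thesis using D by (simp add: has_dir_deriv_def)
  qed
  then show ?thesis using * unfolding B_stationary_def by blast
qed

end

text \<open>The accumulation point is quantified inside the almost-sure statement, so it may depend
  on \<omega> in any manner. In the probabilities and expectations it is frozen and
  \<open>\<omega>'\<close> is the variable of integration, which gives the boundary condition its
  meaning for a random limit point.\<close>

theorem corollary28:
  fixes M :: "'w measure"
    and P :: "('n::finite, 'd::finite) cc_problem"
    and a :: approx
    and zt :: "'w \<Rightarrow> real^'d"
    and zs :: "nat \<Rightarrow> 'w \<Rightarrow> real^'d"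
    and N :: "nat \<Rightarrow> nat"
    and lam \<rho> \<gamma> :: "nat \<Rightarrow> real"
    and lam_inf :: ereal
    and x :: "nat \<Rightarrow> 'w \<Rightarrow> real^'n"
    and \<kappa> :: "nat set"
  assumes "prob_space M"
    and "random_functionals P M zt"
    and "approximation_funs P"
    and "objective_assms P M zt"
    and "constraint_assms a P M zt"
    and "rademacher_assms a P"
    and "surrogate_assms P M zt"
    and "iid_samples P M zt zs"
    and "spsa_params a P M zt N lam lam_inf \<rho> \<gamma>"
    and "\<gamma> \<longlonglongrightarrow> 0"
    and "spsa_iterates a P M zs N lam \<rho> \<gamma> x"
    and "\<kappa> \<subseteq> {1..}" and "infinite \<kappa>"
    and "AE \<omega> in M. ((\<lambda>\<nu>. norm (x (\<nu> + 1) \<omega> - x \<nu> \<omega>)) \<longlongrightarrow> 0) (inf sequentially (principal \<kappa>))"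
  shows "AE \<omega> in M. \<forall>x_inf.
    acc_point_along (\<lambda>\<nu>. x \<nu> \<omega>) \<kappa> x_inf \<and>
    (\<forall>l\<in>{1..nL P}. \<P>(\<omega>' in M. Zdiff P l x_inf (zt \<omega>') = 0) = 0) \<longrightarrow>
      ((\<exists>x_hat\<in>Xset P.
          (\<forall>k\<in>{1..nK P}.
             (\<Sum>l=1..nL P. epos P k l * \<P>(\<omega>' in M. LZh P l x_hat (zt \<omega>') x_inf \<ge> 0)
                          - eneg P k l * \<P>(\<omega>' in M. LZg P l x_hat (zt \<omega>') x_inf > 0)) \<le> zeta P k) \<and>
          real_of_ereal (1 / lam_inf) * (\<integral>\<omega>'. c0_hat P x_hat (zt \<omega>') x_inf \<partial>M)
            \<le> real_of_ereal (1 / lam_inf) * (\<integral>\<omega>'. c0_hat P x_inf (zt \<omega>') x_inf \<partial>M))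
        \<longleftrightarrow> x_inf \<in> Q_feasible P M zt x_inf) \<and>
      (x_inf \<in> Q_feasible P M zt x_inf \<longleftrightarrow> x_inf \<in> CCP_feasible P M zt) \<and>
      (x_inf \<in> Q_feasible P M zt x_inf \<and> closure_condition P M zt x_inf
        \<longrightarrow> B_stationary (Q_objective P M zt x_inf) (Q_feasible P M zt x_inf) x_inf)"
proof -
  interpret spsa_problem M P a zt zs
    by (intro spsa_problem.intro spsa_problem_axioms.intro assms)
  have params: "strict_mono N" "N 0 = 0" "\<And>\<nu>. \<nu> \<ge> 1 \<Longrightarrow> lam \<nu> > 0" "mono_on {1..} lam" "lam 1 = 1"
    "(\<lambda>\<nu>. ereal (lam \<nu>)) \<longlonglongrightarrow> lam_inf" "\<And>\<nu>. \<nu> \<ge> 1 \<Longrightarrow> \<rho> \<nu> > 0" "\<And>\<nu>. \<nu> \<ge> 1 \<Longrightarrow> \<gamma> \<nu> > 0"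
    using assms(9) unfolding spsa_params_def by blast+
  obtain \<rho>_inf where \<rho>_inf: "\<rho> \<longlonglongrightarrow> \<rho>_inf"
    using assms(9) unfolding spsa_params_def by blast
  obtain \<alpha>2 where \<alpha>2: "\<And>\<nu>. \<nu> \<ge> 1 \<Longrightarrow> \<rho> \<nu> / lam \<nu> \<le> \<alpha>2 / real \<nu>"
    using assms(9) unfolding spsa_params_def by (elim conjE exE) blast
  have lam1: "1 \<le> lam \<nu>" if "\<nu> \<ge> 1" for \<nu>
    using params(4,5) that unfolding mono_on_def by (metis atLeast_iff order_refl)
  have ratio: "(\<lambda>\<nu>. \<rho> \<nu> / lam \<nu>) \<longlonglongrightarrow> 0"
  proof (rule tendsto_sandwich[OF _ _ tendsto_const lim_const_over_n[of \<alpha>2]])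
    show "\<forall>\<^sub>F \<nu> in sequentially. 0 \<le> \<rho> \<nu> / lam \<nu>"
      using eventually_ge_at_top[of 1] by eventually_elim (use params(3,7) in \<open>simp add: less_imp_le\<close>)
    show "\<forall>\<^sub>F \<nu> in sequentially. \<rho> \<nu> / lam \<nu> \<le> \<alpha>2 / real \<nu>"
      using eventually_ge_at_top[of 1] by eventually_elim (rule \<alpha>2)
  qed
  obtain x1 where x1: "x1 \<in> Xset P" "\<And>\<omega>. \<omega> \<in> space M \<Longrightarrow> x 1 \<omega> = x1"
    using assms(11) unfolding spsa_iterates_def by blast
  have argmin: "is_arg_min (spsa_objective a P (\<lambda>s. zs s \<omega>) (N \<nu>) (lam \<nu>) (\<rho> \<nu>) (\<gamma> \<nu>) (x \<nu> \<omega>))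
      (\<lambda>y. y \<in> Xset P) (x (\<nu> + 1) \<omega>)" if "\<omega> \<in> space M" "\<nu> \<ge> 1" for \<omega> \<nu>
    using assms(11) that unfolding spsa_iterates_def by blast
  have x_in: "x \<nu> \<omega> \<in> Xset P" if "\<omega> \<in> space M" "\<nu> \<ge> 1" for \<omega> \<nu>
  proof (cases "\<nu> = 1")
    case False
    then show ?thesis using argmin[OF that(1), of "\<nu> - 1"] that(2) by (simp add: is_arg_min_def)
  qed (use x1 that in simp)
  show ?thesis
    using AE_typical assms(14) AE_space
  proof eventually_elim
    case (elim \<omega>)
    show ?case
    proof (intro allI impI)
      fix x_inf
      assume H: "acc_point_along (\<lambda>\<nu>. x \<nu> \<omega>) \<kappa> x_inf \<and>
        (\<forall>l\<in>{1..nL P}. prob {\<omega>' \<in> space M. Zdiff P l x_inf (zt \<omega>') = 0} = 0)"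
      then obtain r where r: "strict_mono r" "range r \<subseteq> \<kappa>" "(\<lambda>i. x (r i) \<omega>) \<longlonglongrightarrow> x_inf"
        unfolding acc_point_along_def by blast
      have r1: "r i \<ge> 1" for i using r(2) assms(12) by force
      have r_sub: "filterlim r sequentially sequentially" using r(1) by (rule filterlim_subseq)
      \<comment> \<open>Transfers the step-length assumption, stated along \<kappa>, to the
        subsequence.\<close>
      have "filterlim r (inf sequentially (principal \<kappa>)) sequentially"
        using r_sub r(2) by (auto simp: filterlim_inf filterlim_principal intro!: always_eventually)
      from filterlim_compose[OF elim(2) this]
      have "(\<lambda>i. norm (x (r i + 1) \<omega> - x (r i) \<omega>)) \<longlonglongrightarrow> 0" .
      then have "(\<lambda>i. x (r i + 1) \<omega> - x (r i) \<omega>) \<longlonglongrightarrow> 0" by (rule tendsto_norm_zero_cancel)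
      from tendsto_add[OF this r(3)] have next_lim: "(\<lambda>i. x (r i + 1) \<omega>) \<longlonglongrightarrow> x_inf" by simp
      let ?\<theta> = "real_of_ereal (1 / lam_inf)"
      interpret spsa_limit_regular M P a zt zs \<omega> "\<lambda>i. N (r i)" "\<lambda>i. lam (r i)" "\<lambda>i. \<rho> (r i)"
        "\<lambda>i. \<gamma> (r i)" ?\<theta> \<rho>_inf "\<lambda>i. x (r i) \<omega>" "\<lambda>i. x (r i + 1) \<omega>" x_inf
      proof
        show "filterlim (\<lambda>i. N (r i)) at_top sequentially"
          using filterlim_compose[OF filterlim_subseq[OF params(1)] r_sub] .
        show "0 < N (r i)" for i
          using strict_monoD[OF params(1), of 0 "r i"] r1[of i] by simp
        show "(\<lambda>i. 1 / lam (r i)) \<longlonglongrightarrow> ?\<theta>"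
          using filterlim_compose[OF params(6) r_sub] lam1[OF r1] by (rule tendsto_inverse_ereal_limit)
        show "(\<lambda>i. \<rho> (r i)) \<longlonglongrightarrow> \<rho>_inf" using filterlim_compose[OF \<rho>_inf r_sub] .
        show "(\<lambda>i. \<rho> (r i) / lam (r i)) \<longlonglongrightarrow> 0" using filterlim_compose[OF ratio r_sub] .
        show "(\<lambda>i. \<gamma> (r i)) \<longlonglongrightarrow> 0" using filterlim_compose[OF assms(10) r_sub] .
        show "spsa_objective a P (\<lambda>s. zs s \<omega>) (N (r i)) (lam (r i)) (\<rho> (r i)) (\<gamma> (r i)) (x (r i) \<omega>) (x (r i + 1) \<omega>)
          \<le> spsa_objective a P (\<lambda>s. zs s \<omega>) (N (r i)) (lam (r i)) (\<rho> (r i)) (\<gamma> (r i)) (x (r i) \<omega>) u"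
          if "u \<in> Xset P" for i u
          using argmin[OF elim(3) r1[of i]] that by (simp add: is_arg_min_linorder)
        show "prob {\<omega>' \<in> space M. Zdiff P l x_inf (zt \<omega>') = 0} = 0" if "l \<in> {1..nL P}" for l
          using H that by blast
      qed (use elim lam1 r1 params(7,8) x_in r(3) next_lim in \<open>auto simp: less_imp_le\<close>)
      have improving: "(\<exists>u\<in>Xset P. (\<forall>k\<in>{1..nK P}.
             (\<Sum>l=1..nL P. epos P k l * prob {\<omega>' \<in> space M. LZh P l u (zt \<omega>') x_inf \<ge> 0}
                          - eneg P k l * prob {\<omega>' \<in> space M. LZg P l u (zt \<omega>') x_inf > 0}) \<le> zeta P k) \<and>
          ?\<theta> * (\<integral>\<omega>'. c0_hat P u (zt \<omega>') x_inf \<partial>M) \<le> ?\<theta> * (\<integral>\<omega>'. c0_hat P x_inf (zt \<omega>') x_inf \<partial>M))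
        \<longleftrightarrow> (\<exists>u\<in>Q_feasible P M zt x_inf. ?\<theta> * Q_objective P M zt x_inf u \<le> ?\<theta> * Q_objective P M zt x_inf x_inf)"
        by (auto simp: Q_feasible_def Q_objective_def)
      show "((\<exists>x_hat\<in>Xset P.
          (\<forall>k\<in>{1..nK P}.
             (\<Sum>l=1..nL P. epos P k l * prob {\<omega>' \<in> space M. LZh P l x_hat (zt \<omega>') x_inf \<ge> 0}
                          - eneg P k l * prob {\<omega>' \<in> space M. LZg P l x_hat (zt \<omega>') x_inf > 0}) \<le> zeta P k) \<and>
          real_of_ereal (1 / lam_inf) * (\<integral>\<omega>'. c0_hat P x_hat (zt \<omega>') x_inf \<partial>M)
            \<le> real_of_ereal (1 / lam_inf) * (\<integral>\<omega>'. c0_hat P x_inf (zt \<omega>') x_inf \<partial>M))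
        \<longleftrightarrow> x_inf \<in> Q_feasible P M zt x_inf) \<and>
      (x_inf \<in> Q_feasible P M zt x_inf \<longleftrightarrow> x_inf \<in> CCP_feasible P M zt) \<and>
      (x_inf \<in> Q_feasible P M zt x_inf \<and> closure_condition P M zt x_inf
        \<longrightarrow> B_stationary (Q_objective P M zt x_inf) (Q_feasible P M zt x_inf) x_inf)"
        \<comment> \<open>The converse of \<open>feasible_of_improving\<close> takes
          \<open>x_inf\<close> itself as the improving point.\<close>
        unfolding improving
        using feasible_of_improving CCP_feasible_iff B_stationary_limit by blast
    qed
  qed
qed

end
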